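(* Suppose that $L\ge cs^2\log s$ with large enough $c>0$. Let $\widehat x$ be the composite adaptive estimate of $(x_t)_{|t|\le L}$, $x\in\mathcal H_s$, built from the observations $(y_\tau)_{|\tau|\le L}$ by the procedure described in the context (with $s$ known, and with $K$ selected to minimize the total risk bound of the recovery over $D_L$). Then for any $\alpha\in(0,1/2]$, $$\mathrm{Risk}_{D_L,2,\alpha}(\widehat x|\mathcal H_s)\le C\sigma s^{3/2}\log[L/\alpha],$$ where $C$ is an absolute constant and $$\mathrm{Risk}_{D_L,2,\alpha}(\widehat x|\mathcal H_s)=\inf\Big\{r:\ \sup_{x\in\mathcal H_s}\mathrm{Prob}\{\|\widehat x-x\|_{L,2}\ge r\}\le\alpha\Big\}.$$
   Context: $\mathbb{C}(\mathbb{Z})$ is the space of two-sided complex sequences; $\mathbb{C}_m(\mathbb{Z})$ is the subspace of sequences vanishing outside $\{-m,\dots,m\}$. Convolution: $[\varphi*y]_t=\sum_{\tau\in\mathbb{Z}}\varphi_\tau y_{t-\tau}$. Shift: $[\Delta x]_t=x_{t-1}$, with inverse $\Delta^{-1}$. Semi-norm: $\|x\|_{n,2}=\big(\sum_{|\tau|\le n}|x_\tau|^2\big)^{1/2}$. The unitary DFT $F_m:\mathbb{C}_m(\mathbb{Z})\to\mathbb{C}^{2m+1}$ is $(F_m[x])_k=\frac{1}{\sqrt{2m+1}}\sum_{|\tau|\le m}\exp\big(-\frac{2\pi i k\tau}{2m+1}\big)x_\tau$, $1\le k\le 2m+1$; $\|\cdot\|_1$ on $\mathbb{C}^{2m+1}$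 is the $\ell_1$-norm. Observations: $y_\tau=x_\tau+\sigma\zeta_\tau$, $|\tau|\le L$, $\sigma>0$, with i.i.d. noises $\zeta_\tau=\zeta_\tau^1+i\zeta_\tau^2$ independent of $x$, $\zeta_\tau^1,\zeta_\tau^2$ i.i.d. $\mathcal N(0,1)$. For an integer $s\ge1$ and $\omega\in[0,2\pi)^s$ (entries may repeat), $\mathcal H_s[\omega]$ is the set of all $x\in\mathbb{C}(\mathbb{Z})$ with $p(\Delta)x=0$, $p(z)=\prod_{k=1}^s(1-e^{i\omega_k}z)$; $\mathcal H_s=\bigcup_{\omega\in[0,2\pi)^s}\mathcal H_s[\omega]$ (generalized harmonic oscillations with at most $s$ unknown frequencies counted with multiplicity). Constant $C_0$: the absolute constant in the following filter bound: for any $s\ge1$, $\omega\in[0,2\pi)^s$ and $m\ge c's^2\log s$ ($c'$ an absolute constant) there is a filter $\phi^o\in\mathbb{C}_m(\mathbb{Z})$, depending only on $\omega$, such that $x=\phi^o*\Delta^mx$ for all $x\in\mathcal H_s[\omega]$ and $\|\phi^o\|_2\le C_0s\sqrt{\log m/m}$. Composite estimate. $L$ and $K\le L$ are assumed even; put $k=(L-K)/2$, $D_L=\{-L,\dots,L\}$, $D_K=\{-K,\dots,K\}$, $D_-=\{-L,\dots,-K-1\}$, $D_+=\{K+1,\dots,L\}$, and $\bar\varrho^+=2C_0^2s^2\log L$. (1) Center: with $m=L-K$, $n=K$, $\bar\varrho=4s$, let $\widehat\varphi$ be an optimal solution to $\min_{\phi\in\mathbb{C}_m(\mathbb{Z})}\|y-\phi*y\|_{n,2}^2$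 subject to $\|F_m[\phi]\|_1\le\bar\varrho/\sqrt{2m+1}$; set $\widehat x_t=[\widehat\varphi*y]_t$ for $t\in D_K$. (2) Right end: with $m=(L+K)/2$, $n=k$, $\bar\varrho=\bar\varrho^+$, let $\widehat\varphi^+$ be an optimal solution to $\min_{\phi\in\mathbb{C}_m(\mathbb{Z})}\|\Delta^{-m}(y-\phi*\Delta^my)\|_{n,2}^2$ subject to $\|F_m[\phi]\|_1\le\bar\varrho/\sqrt{2m+1}$; set $\widehat x_t=[\widehat\varphi^+*\Delta^my]_t$ for $t\in D_+$. (3) Left end: with $m=(L+K)/2$, $n=k$, $\bar\varrho=\bar\varrho^+$, let $\widehat\varphi^-$ be an optimal solution to $\min_{\phi\in\mathbb{C}_m(\mathbb{Z})}\|\Delta^{m}(y-\phi*\Delta^{-m}y)\|_{n,2}^2$ subject to $\|F_m[\phi]\|_1\le\bar\varrho/\sqrt{2m+1}$; set $\widehat x_t=[\widehat\varphi^-*\Delta^{-m}y]_t$ for $t\in D_-$. $K$ is selected to minimize the "total" risk bound of the adaptive recovery over $D_L$, that is, the sum of the risk bounds for the three pieces. With $\kappa_{m,n}=\sqrt{(2n+1)/(2m+1)}$ these are, up to absolute constant factors: for the center ($m=L-K$, $n=K$), $\sigma s\kappa_{m,n}\sqrt{\log[1/\alpha]}+\sigma\big(s(\kappa_{m,n}^2+1)\log[(m+n)/\alpha]+s\big)^{1/2}$; for each of the two ends ($m=(L+K)/2$, $n=k$), $\sigma s^2\log[m]\,\kappa_{m,n}\sqrt{\log[1/\alpha]}+\sigma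 s(\kappa_{m,n}+1)\sqrt{\log[m]\log[(m+n)/\alpha]}$.
   Formalization: For s=1 the conditions L ≥ cs² log s and m ≥ c's² log s are void and the claim fails (L=0 leaves log[L/α] undefined; the filter bound is false at s=m=1); they are read as L ≥ c·max{1, s² log s} and m ≥ c'·max{1, s² log s}, unchanged for s ≥ 2. *)

theory Defs
  imports "HOL-Probability.Probability" "HOL-Computational_Algebra.Polynomial"
begin

section \<open>Two-sided sequences, convolution filters, discrete Fourier transform\<close>

type_synonym seq = "int \<Rightarrow> complex"

definition seqs_upto :: "nat \<Rightarrow> seq set" where
  "seqs_upto m = {x. \<forall>\<tau>. \<tau> \<notin> {- int m..int m} \<longrightarrow> x \<tau> = 0}"

definition conv :: "seq \<Rightarrow> seq \<Rightarrow> seq" where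
  "conv \<phi> y = (\<lambda>t. \<Sum>\<^sub>\<infinity>\<tau>\<in>UNIV. \<phi> \<tau> * y (t - \<tau>))"

text \<open>\<open>lag j\<close> is the (possibly negative) power \<open>\<Delta>^j\<close> of the shift \<open>(\<Delta> x) t = x (t - 1)\<close>.\<close>

definition lag :: "int \<Rightarrow> seq \<Rightarrow> seq" where
  "lag j x = (\<lambda>t. x (t - j))"

definition seminorm2 :: "nat \<Rightarrow> seq \<Rightarrow> real" where
  "seminorm2 n x = sqrt (\<Sum>\<tau>\<in>{- int n..int n}. (cmod (x \<tau>))\<^sup>2)"

text \<open>Vectors of length \<open>2m+1\<close> are functions on \<open>nat\<close> whose entries \<open>1, \<dots>, 2m+1\<close> are used.\<close>

definition dft :: "nat \<Rightarrow> seq \<Rightarrow> nat \<Rightarrow> complex" where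
  "dft m x k = 1 / complex_of_real (sqrt (2 * real m + 1)) *
     (\<Sum>\<tau>\<in>{- int m..int m}.
        exp (- (2 * complex_of_real pi * \<i> * of_nat k * of_int \<tau> / (2 * of_nat m + 1))) * x \<tau>)"

definition l1_norm :: "nat \<Rightarrow> (nat \<Rightarrow> complex) \<Rightarrow> real" where
  "l1_norm m v = (\<Sum>k = 1..2 * m + 1. cmod (v k))"


section \<open>Generalized harmonic oscillations\<close>

definition freqs :: "nat \<Rightarrow> (nat \<Rightarrow> real) set" where
  "freqs s = {\<omega>. \<forall>k\<in>{1..s}. \<omega> k \<in> {0..<2 * pi}}"

definition char_poly :: "nat \<Rightarrow> (nat \<Rightarrow> real) \<Rightarrow> complex poly" where
  "char_poly s \<omega> = (\<Prod>k = 1..s. [:1, - exp (\<i> * complex_of_real (\<omega> k)):])"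

definition poly_lag :: "complex poly \<Rightarrow> seq \<Rightarrow> seq" where
  "poly_lag p x = (\<lambda>t. \<Sum>j\<le>degree p. coeff p j * lag (int j) x t)"

definition oscillations_at :: "nat \<Rightarrow> (nat \<Rightarrow> real) \<Rightarrow> seq set" where
  "oscillations_at s \<omega> = {x. \<forall>t. poly_lag (char_poly s \<omega>) x t = 0}"

definition oscillations :: "nat \<Rightarrow> seq set" where
  "oscillations s = (\<Union>\<omega>\<in>freqs s. oscillations_at s \<omega>)"

text \<open>
  The absolute constant of the one-sided filter bound, which fixes a parameter of the
  composite estimate.  The condition \<open>m \<ge> c' s^2 log s\<close> is void for \<open>s = 1\<close>, although the
  bound is false for \<open>s = m = 1\<close> (its right-hand side is then 0).  It is therefore read as
  \<open>m \<ge> c' max {1, s^2 log s}\<close>, which is the same condition for every \<open>s \<ge> 2\<close>; likewise for the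
  condition \<open>L \<ge> c s^2 log s\<close> on the observation range.
\<close>

definition filter_bound_constant :: "real \<Rightarrow> bool" where
  "filter_bound_constant C0 \<longleftrightarrow>
     (\<exists>c' > 0. \<forall>s \<ge> 1. \<forall>\<omega>\<in>freqs s. \<forall>m.
        real m \<ge> c' \<and> real m \<ge> c' * (real s)\<^sup>2 * ln (real s) \<longrightarrow>
        (\<exists>\<phi>\<in>seqs_upto m.
           (\<forall>x\<in>oscillations_at s \<omega>. x = conv \<phi> (lag (int m) x)) \<and>
           seminorm2 m \<phi> \<le> C0 * real s * sqrt (ln (real m) / real m)))"


section \<open>The composite adaptive estimate\<close>

text \<open>
  The three estimation problems are the instances \<open>a = 0\<close> (center), \<open>a = m\<close> (right end) and
  \<open>a = - m\<close> (left end) of minimizing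
  \<open>\<parallel>\<Delta>^(-a) (y - \<phi> * \<Delta>^a y)\<parallel>\<^sub>n\<^sub>,\<^sub>2\<^sup>2\<close> over the same kind of feasible set.
\<close>

definition optimal_filter :: "int \<Rightarrow> nat \<Rightarrow> nat \<Rightarrow> real \<Rightarrow> seq \<Rightarrow> seq \<Rightarrow> bool" where
  "optimal_filter a m n \<rho> y \<phi> \<longleftrightarrow>
     is_arg_min
       (\<lambda>\<phi>. (seminorm2 n (lag (- a) (\<lambda>t. y t - conv \<phi> (lag a y) t)))\<^sup>2)
       (\<lambda>\<phi>. \<phi> \<in> seqs_upto m \<and> l1_norm m (dft m \<phi>) \<le> \<rho> / sqrt (2 * real m + 1))
       \<phi>"

text \<open>
  Used for even \<open>L\<close>, \<open>K\<close> with \<open>K \<le> L\<close>, so that the two divisions below are exact and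
  the values of \<open>y\<close> outside \<open>{-L..L}\<close> are never used.
\<close>

definition composite_estimate :: "real \<Rightarrow> nat \<Rightarrow> nat \<Rightarrow> nat \<Rightarrow> seq \<Rightarrow> seq \<Rightarrow> bool" where
  "composite_estimate C0 s L K y xh \<longleftrightarrow>
     (let m = (L + K) div 2; k = (L - K) div 2; \<rho> = 2 * C0\<^sup>2 * (real s)\<^sup>2 * ln (real L) in
      \<exists>\<phi> \<phi>r \<phi>l.
        optimal_filter 0 (L - K) K (4 * real s) y \<phi> \<and>
        optimal_filter (int m) m k \<rho> y \<phi>r \<and>
        optimal_filter (- int m) m k \<rho> y \<phi>l \<and>
        (\<forall>t\<in>{- int K..int K}. xh t = conv \<phi> y t) \<and>
        (\<forall>t\<in>{int K + 1..int L}. xh t = conv \<phi>r (lag (int m) y) t) \<and>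
        (\<forall>t\<in>{- int L..- int K - 1}. xh t = conv \<phi>l (lag (- int m) y) t))"

definition kappa :: "nat \<Rightarrow> nat \<Rightarrow> real" where
  "kappa m n = sqrt ((2 * real n + 1) / (2 * real m + 1))"

definition center_bound :: "real \<Rightarrow> nat \<Rightarrow> real \<Rightarrow> nat \<Rightarrow> nat \<Rightarrow> real" where
  "center_bound \<sigma> s \<alpha> m n =
     \<sigma> * real s * kappa m n * sqrt (ln (1 / \<alpha>)) +
     \<sigma> * sqrt (real s * ((kappa m n)\<^sup>2 + 1) * ln (real (m + n) / \<alpha>) + real s)"

definition end_bound :: "real \<Rightarrow> nat \<Rightarrow> real \<Rightarrow> nat \<Rightarrow> nat \<Rightarrow> real" where
  "end_bound \<sigma> s \<alpha> m n =
     \<sigma> * (real s)\<^sup>2 * ln (real m) * kappa m n * sqrt (ln (1 / \<alpha>)) +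
     \<sigma> * real s * (kappa m n + 1) * sqrt (ln (real m) * ln (real (m + n) / \<alpha>))"

text \<open>
  The bounds of the pieces are only specified up to absolute constant factors;
  \<open>A\<close> and \<open>B\<close> are these factors for the center and for each of the two ends.
\<close>

definition total_bound ::
    "real \<Rightarrow> real \<Rightarrow> real \<Rightarrow> nat \<Rightarrow> real \<Rightarrow> nat \<Rightarrow> nat \<Rightarrow> real" where
  "total_bound A B \<sigma> s \<alpha> L K =
     A * center_bound \<sigma> s \<alpha> (L - K) K +
     2 * (B * end_bound \<sigma> s \<alpha> ((L + K) div 2) ((L - K) div 2))"


section \<open>Observations and risk\<close>

text \<open>The law of \<open>\<zeta>\<^sup>1 + \<i> \<zeta>\<^sup>2\<close> with independent standard normal \<open>\<zeta>\<^sup>1\<close>, \<open>\<zeta>\<^sup>2\<close>.\<close>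

definition std_complex_normal :: "complex measure" where
  "std_complex_normal =
     distr (density lborel std_normal_density \<Otimes>\<^sub>M density lborel std_normal_density) borel
       (\<lambda>(u, v). Complex u v)"

text \<open>
  The joint law of the i.i.d. noises.  The risk of a recovery depends on the noise only through
  this law, so its sample space carries the noise as coordinate process.
\<close>

definition noise_law :: "nat \<Rightarrow> seq measure" where
  "noise_law L = (\<Pi>\<^sub>M \<tau>\<in>{- int L..int L}. std_complex_normal)"

definition observation :: "real \<Rightarrow> nat \<Rightarrow> seq \<Rightarrow> seq \<Rightarrow> seq" where
  "observation \<sigma> L x \<zeta> =
     (\<lambda>\<tau>. if \<tau> \<in> {- int L..int L} then x \<tau> + complex_of_real \<sigma> * \<zeta> \<tau> else 0)"

text \<open>
  A recovery \<open>xh\<close> maps observations to sequences.  Optimal filters need not be unique and may be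
  selected in a nonmeasurable way, hence the outer measure; it agrees with the probability on
  measurable events.  The infimum is extended real, so that it is \<open>\<infinity>\<close> if no \<open>r\<close> qualifies.
\<close>

definition risk :: "real \<Rightarrow> nat \<Rightarrow> real \<Rightarrow> (seq \<Rightarrow> seq) \<Rightarrow> seq set \<Rightarrow> ereal" where
  "risk \<sigma> L \<alpha> xh X =
     Inf {ereal r | r.
       (SUP x\<in>X. outer_measure_of (noise_law L)
          {\<zeta> \<in> space (noise_law L).
             seminorm2 L (\<lambda>t. xh (observation \<sigma> L x \<zeta>) t - x t) \<ge> r}) \<le> ennreal \<alpha>}"

end

theory Submission
  imports Defs
begin

text \<open>
  The argument rests on a one-sided reproducing filter of squared norm \<open>O (s\<^sup>2 / m)\<close>, without the
  logarithm.  Squaring the filter of the assumed bound would overshoot the radius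
  \<open>2 C0\<^sup>2 s\<^sup>2 ln L\<close> by a factor of about two, whereas the squared logarithm-free filter is feasible for
  every \<open>C0 \<noteq> 0\<close> once \<open>L\<close> is large.  By duality its norm is the diagonal value at the endpoint of the
  reproducing kernel of the solution space.  That value is \<open>s (1 - \<rho>\<^sup>2)\<close> at most for the weights
  \<open>\<rho>^(2 j)\<close> on a half-line (peel off one Blaschke factor at a time), and with \<open>1 - \<rho>\<close> of order \<open>s / m\<close>
  half of the weighted energy of a solution lies in the window.

  On each of the three windows, comparing the optimal filter with the squared reproducing filter
  leaves three Gaussian quantities: the energy of filtered noise, the noise projected on the
  solution space, and a Toeplitz quadratic form for each vector of the Fourier basis.  Their
  exponential moments give a risk controlled by \<open>\<rho> \<kappa> sqrt (ln (1 / \<alpha>))\<close> alone, and the minimality of \<open>K\<close>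
  bounds this quantity through a comparison with \<open>L - K\<close> of order \<open>L / (s ln L)\<close>.
\<close>

section \<open>Values of exponential sums at the end of a window\<close>

text \<open>The obstacle is that the optimal filter depends on the very noise it is applied to, so
  no estimate for a fixed filter covers it. Two facts restore uniformity. The feasible set is an
  l1-ball in the Fourier domain, so every feasible filter is a combination of \<open>2 m + 1\<close>
  basis filters with coefficients of bounded l1-norm, and controlling all of these costs only a
  logarithm. And for a solution \<open>x\<close> the residual of any filter applied to
  \<open>x\<close> is again a solution, so its correlation with the noise sees only the projection
  of the noise on a space of dimension at most \<open>s\<close>. The endpoint estimate serves the
  two ends. The center wants a filter without lag, and there averaging suffices: the projection on
  the solution space has trace at most \<open>s\<close>, so among \<open>n + 1\<close> points one
  has diagonal value at most \<open>s / (n + 1)\<close>. Squaring its row gives exactly the radius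
  \<open>4 s\<close>. The condition \<open>\<alpha> \<le> 1 / 2\<close> keeps
  \<open>ln (1 / \<alpha>)\<close> away from \<open>0\<close>. Terms in which
  \<open>\<rho> * kappa m n\<close> comes without the factor \<open>sqrt (ln (1 / \<alpha>))\<close>
  can therefore be absorbed, up to constants, by the product with this factor.\<close>

fun rec_killed :: "complex list \<Rightarrow> (nat \<Rightarrow> complex) \<Rightarrow> bool" where
  "rec_killed [] f \<longleftrightarrow> (\<forall>j. f j = 0)"
| "rec_killed (w # ws) f \<longleftrightarrow> rec_killed ws (\<lambda>j. f (Suc j) - w * f j)"

lemma rec_killed_lincomb:
  assumes "finite I" "\<And>i. i \<in> I \<Longrightarrow> rec_killed ws (f i)"
  shows "rec_killed ws (\<lambda>j. \<Sum>i\<in>I. c i * f i j)"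
  using assms
proof (induction ws arbitrary: f)
  case (Cons w ws)
  have "rec_killed ws (\<lambda>j. \<Sum>i\<in>I. c i * (f i (Suc j) - w * f i j))"
    using Cons.prems by (intro Cons.IH) auto
  then show ?case
    by (simp add: sum_subtractf sum_distrib_left algebra_simps)
qed simp

lemma rec_killed_scale: "rec_killed ws f \<Longrightarrow> rec_killed ws (\<lambda>j. c * f j)"
  using rec_killed_lincomb[of "{()}" ws "\<lambda>_. f" "\<lambda>_. c"] by simp

lemma rec_killed_shift: "rec_killed ws f \<Longrightarrow> rec_killed ws (\<lambda>j. f (j + l))"
  by (induction ws arbitrary: f) auto

lemma rec_killed_geometric:
  "rec_killed ws f \<Longrightarrow> rec_killed (map (\<lambda>w. r * w) ws) (\<lambda>j. r ^ j * f j)"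
proof (induction ws arbitrary: f)
  case (Cons w ws)
  from Cons have "rec_killed (map (\<lambda>w. r * w) ws) (\<lambda>j. r ^ j * (f (Suc j) - w * f j))"
    by simp
  from rec_killed_scale[OF this, of r] show ?case
    by (simp add: algebra_simps)
qed simp

text \<open>For the shift \<open>S\<close> one has
  \<open>S^d - w^d = (S - w) (w^(d-1) + ... + S^(d-1))\<close>. So the first sampled factor turns
  \<open>f\<close> into a combination of shifts of \<open>f'\<close>, which the remaining roots
  kill.\<close>

lemma rec_killed_sample:
  assumes "rec_killed ws f"
  shows "rec_killed (map (\<lambda>w. w ^ d) ws) (\<lambda>i. f (l + i * d))"
  using assms
proof (induction ws arbitrary: f)
  case (Cons w ws)
  define f' where "f' = (\<lambda>j. f (Suc j) - w * f j)"
  have tele: "(\<Sum>i<e. w ^ (e - Suc i) * f' (j + i)) = f (j + e) - w ^ e * f j" for j e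
  proof (induction e)
    case (Suc e)
    have "(\<Sum>i<e. w ^ (Suc e - Suc i) * f' (j + i)) = w * (\<Sum>i<e. w ^ (e - Suc i) * f' (j + i))"
      unfolding sum_distrib_left
      by (intro sum.cong) (auto simp: Suc_diff_Suc simp flip: power_Suc mult.assoc)
    then have "(\<Sum>i<Suc e. w ^ (Suc e - Suc i) * f' (j + i)) = w * (f (j + e) - w ^ e * f j) + f' (j + e)"
      using Suc by simp
    then show ?case by (simp add: f'_def algebra_simps)
  qed simp
  have "rec_killed ws (\<lambda>j. \<Sum>i<d. w ^ (d - Suc i) * f' (j + i))"
    using Cons.prems by (intro rec_killed_lincomb rec_killed_shift) (auto simp: f'_def)
  then have "rec_killed ws (\<lambda>j. f (j + d) - w ^ d * f j)"
    by (simp add: tele)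
  from Cons.IH[OF this] show ?case
    by (simp add: algebra_simps)
qed simp

text \<open>The rate \<open>3\<close> is independent of the number of roots: if the difference
  \<open>h'\<close> grows with constant \<open>2 M\<close>, then
  \<open>3^i * (2 * M) + 3^i * M = 3^(i+1) * M\<close> closes the induction. Polynomial growth of
  high degree is thus traded for a fixed exponential rate.\<close>

lemma rec_killed_growth:
  assumes "rec_killed ws h" "\<And>w. w \<in> set ws \<Longrightarrow> cmod w = 1"
    and "\<And>l. l < length ws \<Longrightarrow> cmod (h l) \<le> M" "0 \<le> M"
  shows "cmod (h i) \<le> 3 ^ i * M"
  using assms
proof (induction ws arbitrary: h M i)
  case (Cons w ws)
  define h' where "h' = (\<lambda>j. h (Suc j) - w * h j)"
  have w: "cmod w = 1" using Cons.prems by simp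
  have h': "cmod (h' i) \<le> 3 ^ i * (2 * M)" for i
  proof (rule Cons.IH)
    fix l assume "l < length ws"
    then have "cmod (h (Suc l)) \<le> M" "cmod (h l) \<le> M" using Cons.prems(3) by auto
    then show "cmod (h' l) \<le> 2 * M"
      using norm_triangle_ineq4[of "h (Suc l)" "w * h l"] w by (simp add: h'_def norm_mult)
  qed (use Cons.prems in \<open>auto simp: h'_def\<close>)
  show ?case
  proof (induction i)
    case 0 then show ?case using Cons.prems(3)[of 0] by simp
  next
    case (Suc i)
    have "cmod (h (Suc i)) = cmod (h' i + w * h i)" by (simp add: h'_def)
    also have "\<dots> \<le> cmod (h' i) + cmod (h i)"
      using norm_triangle_ineq[of "h' i" "w * h i"] w by (simp add: norm_mult)
    also have "\<dots> \<le> 3 ^ i * (2 * M) + 3 ^ i * M" using h'[of i] Suc by linarith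
    finally show ?case by (simp add: algebra_simps)
  qed
qed (use \<open>0 \<le> M\<close> in simp)

text \<open>Any rate above \<open>\<rho>\<close> absorbs the polynomial factors produced by repeated
  roots. The constant is not tracked, because the result only serves to make series converge and
  limits vanish.\<close>

lemma rec_killed_decay:
  assumes "rec_killed as g" "\<And>a. a \<in> set as \<Longrightarrow> cmod a \<le> \<rho>" "0 \<le> \<rho>" "\<rho> < r"
  shows "\<exists>A\<ge>0. \<forall>j. cmod (g j) \<le> A * r ^ j"
  using assms
proof (induction as arbitrary: g)
  case Nil then show ?case by (intro exI[of _ 0]) auto
next
  case (Cons a as)
  define h where "h = (\<lambda>j. g (Suc j) - a * g j)"
  obtain A where A: "A \<ge> 0" "\<And>j. cmod (h j) \<le> A * r ^ j"
    using Cons.IH[of h] Cons.prems by (auto simp: h_def)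
  \<comment> \<open>\<open>B\<close> is chosen so that \<open>A + \<rho> * B \<le> r * B\<close>,
    which is the induction step below.\<close>
  define B where "B = cmod (g 0) + A / (r - \<rho>)"
  have AB: "A + \<rho> * B \<le> r * B"
  proof -
    have "A \<le> (r - \<rho>) * B"
      using Cons.prems(4) by (simp add: B_def distrib_left)
    then show ?thesis by (simp add: left_diff_distrib)
  qed
  have B: "B \<ge> 0" using A Cons.prems by (simp add: B_def)
  have "cmod (g j) \<le> B * r ^ j" for j
  proof (induction j)
    case 0 then show ?case using A Cons.prems by (simp add: B_def)
  next
    case (Suc j)
    have "cmod (g (Suc j)) = cmod (h j + a * g j)" by (simp add: h_def)
    also have "\<dots> \<le> cmod (h j) + cmod a * cmod (g j)"
      by (metis norm_mult norm_triangle_ineq)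
    also have "\<dots> \<le> A * r ^ j + \<rho> * (B * r ^ j)"
      using A Suc Cons.prems by (intro add_mono mult_mono) auto
    also have "\<dots> = (A + \<rho> * B) * r ^ j" by (simp add: algebra_simps)
    also have "\<dots> \<le> (r * B) * r ^ j" using AB Cons.prems by (intro mult_right_mono) auto
    finally show ?case by (simp add: algebra_simps)
  qed
  then show ?case using B by blast
qed

text \<open>Power series in the backward shift commute with the recurrence; this lets the inverse of
  \<open>1 - cnj a S\<close> act on solutions.\<close>

lemma rec_killed_suminf:
  assumes "rec_killed ws h" "\<And>j. summable (\<lambda>i. c i * h (j + i))"
  shows "rec_killed ws (\<lambda>j. \<Sum>i. c i * h (j + i))"
  using assms
proof (induction ws arbitrary: h)
  case (Cons w ws)
  have s: "summable (\<lambda>i. w * (c i * h (j + i)))" "summable (\<lambda>i. c i * h (Suc j + i))" for j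
    using Cons.prems(2) Cons.prems(2)[of "Suc j"] by (auto intro: summable_mult)
  have eq: "c i * (h (Suc (j + i)) - w * h (j + i)) = c i * h (Suc j + i) - w * (c i * h (j + i))" for i j
    by (simp add: algebra_simps)
  have "rec_killed ws (\<lambda>j. \<Sum>i. c i * (h (Suc (j + i)) - w * h (j + i)))"
  proof (rule Cons.IH)
    show "summable (\<lambda>i. c i * (h (Suc (j + i)) - w * h (j + i)))" for j
      unfolding eq using s by (intro summable_diff)
  qed (use Cons.prems in auto)
  then show ?case
    unfolding eq suminf_diff[OF s(2,1), symmetric] suminf_mult[OF Cons.prems(2)] by simp
qed simp

text \<open>Both squares have the same cross term \<open>2 * Re (a * z * cnj w)\<close>, which
  cancels. This is the pointwise form of the energy balance of a Blaschke factor.\<close>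

lemma cmod_diff_swap:
  "(cmod (z + cnj a * w))\<^sup>2 - (cmod (w + a * z))\<^sup>2 = (1 - (cmod a)\<^sup>2) * ((cmod z)\<^sup>2 - (cmod w)\<^sup>2)"
  unfolding cmod_power2 by simp algebra

text \<open>In the induction step, \<open>g1\<close> is the image of \<open>g\<close> under the Blaschke factor
  \<open>(S - a) / (1 - cnj a S)\<close> of the backward shift \<open>S\<close>.  It is killed by the remaining factors, and the
  energy lost, \<open>\<parallel>g\<parallel>\<^sup>2 - \<parallel>g1\<parallel>\<^sup>2\<close>, controls \<open>g 0 + cnj a * g1 0\<close>.\<close>

lemma rec_killed_head_bound:
  assumes "rec_killed as g" "\<And>a. a \<in> set as \<Longrightarrow> cmod a = \<rho>" "0 \<le> \<rho>" "\<rho> < 1"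
  shows "summable (\<lambda>j. (cmod (g j))\<^sup>2) \<and>
    (cmod (g 0))\<^sup>2 \<le> real (length as) * (1 - \<rho>\<^sup>2) * (\<Sum>j. (cmod (g j))\<^sup>2)"
  using assms
proof (induction as arbitrary: g)
  case (Cons a as)
  obtain r where r: "\<rho> < r" "r < 1" using dense Cons.prems by blast
  have dec: "summable (\<lambda>j. (cmod (u j))\<^sup>2)" "u \<longlonglongrightarrow> 0" "\<And>j. summable (\<lambda>i. cnj a ^ i * u (j + i))"
    if u: "\<And>j. cmod (u j) \<le> A * r ^ j" for u A
  proof -
    have r0: "0 \<le> r" using r Cons.prems by simp
    have "(cmod (u j))\<^sup>2 \<le> A\<^sup>2 * (r\<^sup>2) ^ j" for j
      using power_mono[OF u[of j], of 2] by (simp add: power_mult_distrib power_mult[symmetric] mult.commute)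
    moreover have "r\<^sup>2 < 1" using r r0 by (simp add: abs_square_less_1)
    ultimately show "summable (\<lambda>j. (cmod (u j))\<^sup>2)"
      using r0 by (intro summable_comparison_test'[OF summable_mult[OF summable_geometric[of "r\<^sup>2"]]]) auto
    have "(\<lambda>j. A * r ^ j) \<longlonglongrightarrow> A * 0" using r r0 by (intro tendsto_intros) auto
    then show "u \<longlonglongrightarrow> 0" using u by (intro Lim_null_comparison[of u "\<lambda>j. A * r ^ j"]) auto
    fix j
    have "norm (cnj a ^ i * u (j + i)) \<le> (A * r ^ j) * r ^ i" for i
    proof -
      have "cmod a ^ i \<le> 1" using Cons.prems(2)[of a] Cons.prems(3,4) by (simp add: power_le_one)
      then have "norm (cnj a ^ i * u (j + i)) \<le> 1 * (A * r ^ (j + i))"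
        unfolding norm_mult norm_power complex_mod_cnj using u[of "j+i"] by (intro mult_mono) auto
      then show ?thesis by (simp add: power_add)
    qed
    then show "summable (\<lambda>i. cnj a ^ i * u (j + i))"
      using r r0 by (intro summable_comparison_test'[OF summable_mult[OF summable_geometric[of r]]]) auto
  qed
  have bd: "\<exists>A\<ge>0. \<forall>j. cmod (u j) \<le> A * r ^ j" if "rec_killed bs u" "set bs \<subseteq> set (a # as)" for bs u
    using that Cons.prems r by (intro rec_killed_decay[of bs u \<rho>]) (fastforce intro: order.refl)+
  define h where "h = (\<lambda>j. g (Suc j) - a * g j)"
  have hk: "rec_killed as h" using Cons.prems by (simp add: h_def)
  obtain Ag where Ag: "\<And>j. cmod (g j) \<le> Ag * r ^ j" using bd[of "a # as" g] Cons.prems by auto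
  obtain Ah where Ah: "\<And>j. cmod (h j) \<le> Ah * r ^ j" using bd[of as h] hk by auto
  \<comment> \<open>\<open>h\<close> is \<open>(S - a)\<close> applied to \<open>g\<close>; the
    Neumann series inverts \<open>1 - cnj a S\<close> on it and converges because \<open>h\<close>
    decays geometrically.\<close>
  define g1 where "g1 = (\<lambda>j. \<Sum>i. cnj a ^ i * h (j + i))"
  have g1k: "rec_killed as g1" unfolding g1_def by (intro rec_killed_suminf hk dec(3)[OF Ah])
  obtain A1 where A1: "\<And>j. cmod (g1 j) \<le> A1 * r ^ j" using bd[of as g1] g1k by auto
  have step: "g1 j - cnj a * g1 (Suc j) = h j" for j
  proof -
    have "(\<Sum>i. cnj a ^ (Suc i) * h (j + Suc i)) = g1 j - h j"
      using suminf_split_head[OF dec(3)[OF Ah, of j]] by (simp add: g1_def)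
    moreover have "(\<Sum>i. cnj a ^ (Suc i) * h (j + Suc i)) = cnj a * g1 (Suc j)"
      using suminf_mult[OF dec(3)[OF Ah, of "Suc j"], of "cnj a"] by (simp add: g1_def mult.assoc)
    ultimately have "cnj a * g1 (Suc j) = g1 j - h j" by (rule trans[OF sym, rotated])
    then show ?thesis by simp
  qed
  have IH: "(cmod (g1 0))\<^sup>2 \<le> real (length as) * (1 - \<rho>\<^sup>2) * (\<Sum>j. (cmod (g1 j))\<^sup>2)"
    using Cons.IH[OF g1k] Cons.prems by auto
  \<comment> \<open>\<open>c\<close> is the combination for which the shift acts as the swap in
    \<open>cmod_diff_swap\<close>: by \<open>step\<close>,
    \<open>c (Suc j) = g1 j + a * g j\<close>. Hence the energy differences telescope in
    \<open>en\<close>.\<close>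
  define c where "c = (\<lambda>j. g j + cnj a * g1 j)"
  have cS: "c (Suc j) = g1 j + a * g j" for j
    using step[of j] by (simp add: c_def h_def algebra_simps)
  have a: "cmod a = \<rho>" using Cons.prems by simp
  have en: "(1 - \<rho>\<^sup>2) * (\<Sum>j<n. (cmod (g j))\<^sup>2 - (cmod (g1 j))\<^sup>2) = (cmod (c 0))\<^sup>2 - (cmod (c n))\<^sup>2" for n
  proof (induction n)
    case (Suc n)
    then show ?case using cmod_diff_swap[of "g n" a "g1 n"] a
      by (simp add: cS c_def[THEN fun_cong, of n] algebra_simps)
  qed simp
  define G where "G = (\<Sum>j. (cmod (g j))\<^sup>2)"
  define G1 where "G1 = (\<Sum>j. (cmod (g1 j))\<^sup>2)"
  have "(\<lambda>n. (1 - \<rho>\<^sup>2) * (\<Sum>j<n. (cmod (g j))\<^sup>2 - (cmod (g1 j))\<^sup>2)) \<longlonglongrightarrow> (1 - \<rho>\<^sup>2) * (G - G1)"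
    unfolding sum_subtractf G_def G1_def using dec(1)[OF Ag] dec(1)[OF A1]
    by (intro tendsto_intros summable_LIMSEQ)
  moreover have "(\<lambda>n. (cmod (c 0))\<^sup>2 - (cmod (c n))\<^sup>2) \<longlonglongrightarrow> (cmod (c 0))\<^sup>2 - (cmod (0 + cnj a * 0))\<^sup>2"
    unfolding c_def using dec(2)[OF Ag] dec(2)[OF A1] by (intro tendsto_intros)
  ultimately have lim: "(1 - \<rho>\<^sup>2) * (G - G1) = (cmod (c 0))\<^sup>2"
    unfolding en using LIMSEQ_unique by fastforce
  have rho: "0 < 1 - \<rho>\<^sup>2" using Cons.prems by (simp add: abs_square_less_1)
  have G1: "G1 \<ge> 0" unfolding G1_def by (intro suminf_nonneg dec(1)[OF A1]) auto
  have d: "G - G1 \<ge> 0" using lim rho by (metis zero_le_mult_iff zero_le_power2 not_less)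
  define l where "l = real (length as)"
  have "g 0 = c 0 - cnj a * g1 0" by (simp add: c_def)
  then have "cmod (g 0) \<le> cmod (c 0) + cmod a * cmod (g1 0)"
    by (metis complex_mod_cnj norm_mult norm_triangle_ineq4)
  also have "\<dots> \<le> cmod (c 0) + cmod (g1 0)"
    using a Cons.prems by (simp add: mult_left_le_one_le)
  finally have le: "cmod (g 0) \<le> cmod (c 0) + cmod (g1 0)" .
  define p where "p = sqrt ((1 - \<rho>\<^sup>2) * (G - G1))"
  define q where "q = sqrt ((1 - \<rho>\<^sup>2) * G1)"
  have p: "cmod (c 0) = p" by (simp add: p_def lim)
  have q: "cmod (g1 0) \<le> sqrt l * q"
    using IH unfolding q_def G1_def[symmetric] l_def
    by (simp add: real_sqrt_mult[symmetric] real_le_rsqrt mult.assoc)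
  have "cmod (g 0) \<le> p + sqrt l * q" using le p q by simp
  then have "(cmod (g 0))\<^sup>2 \<le> (p + sqrt l * q)\<^sup>2" by (intro power_mono) auto
  \<comment> \<open>Cauchy-Schwarz for \<open>(1, sqrt l)\<close> and \<open>(p, q)\<close>. As the
    energies of \<open>p\<close> and \<open>q\<close> add up to that of \<open>g\<close>, one more
    root raises the factor by exactly one.\<close>
  also have "\<dots> \<le> (1 + l) * (p\<^sup>2 + q\<^sup>2)"
  proof -
    have "(1 + (sqrt l)\<^sup>2) * (p\<^sup>2 + q\<^sup>2) - (p + sqrt l * q)\<^sup>2 = (sqrt l * p - q)\<^sup>2"
      by (simp add: power2_eq_square algebra_simps)
    moreover have "(1 + (sqrt l)\<^sup>2) * (p\<^sup>2 + q\<^sup>2) = (1 + l) * (p\<^sup>2 + q\<^sup>2)" by (simp add: l_def)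
    ultimately show ?thesis using zero_le_power2[of "sqrt l * p - q"] by linarith
  qed
  also have "p\<^sup>2 + q\<^sup>2 = (1 - \<rho>\<^sup>2) * G"
  proof -
    have "p\<^sup>2 = (1 - \<rho>\<^sup>2) * (G - G1)" "q\<^sup>2 = (1 - \<rho>\<^sup>2) * G1"
      using rho d G1 by (auto simp: p_def q_def)
    then show ?thesis by (simp add: algebra_simps)
  qed
  finally show ?case using dec(1)[OF Ag] by (simp add: l_def G_def algebra_simps)
qed simp

text \<open>Sampling with step \<open>d\<close> yields sequences of the same kind, which grow by at most \<open>3\<close> per sample
  while the weight decays by \<open>1 / 81\<close>.\<close>

lemma rec_killed_tail:
  assumes k: "rec_killed ws f" "\<And>w. w \<in> set ws \<Longrightarrow> cmod w = 1"
    and d: "d > 0" and \<beta>: "\<rho> ^ (2 * d) = 1 / 81" "0 < \<rho>" "\<rho> < 1"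
    and s: "s = length ws" "s \<ge> 1"
  shows "(\<Sum>j<n. (cmod (f j))\<^sup>2 * \<rho> ^ (2 * j)) \<le> 2 * (\<Sum>j<4 * s * d. (cmod (f j))\<^sup>2 * \<rho> ^ (2 * j))"
proof -
  define e where "e = (\<lambda>j. (cmod (f j))\<^sup>2 * \<rho> ^ (2 * j))"
  have e0: "e j \<ge> 0" for j using \<beta> by (simp add: e_def)
  \<comment> \<open>One residue class modulo \<open>d\<close> at a time: along it \<open>h\<close>
    solves a recurrence whose roots \<open>w ^ d\<close> are still unimodular, and the weight is
    \<open>1 / 81 ^ i\<close> up to a constant.\<close>
  have res: "(\<Sum>i<N. e (l + i * d)) \<le> 2 * (\<Sum>i<4 * s. e (l + i * d))" for N l
  proof -
    define h where "h = (\<lambda>i. f (l + i * d))"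
    have eh: "e (l + i * d) = \<rho> ^ (2 * l) * ((cmod (h i))\<^sup>2 / 81 ^ i)" for i
    proof -
      have "\<rho> ^ (2 * (l + i * d)) = \<rho> ^ (2 * l) * (\<rho> ^ (2 * d)) ^ i"
        by (simp add: power_add[symmetric] power_mult[symmetric] algebra_simps)
      then show ?thesis by (simp add: e_def h_def \<beta> power_one_over)
    qed
    define E where "E = (\<Sum>i<4 * s. (cmod (h i))\<^sup>2 / 81 ^ i)"
    have E0: "E \<ge> 0" unfolding E_def by (intro sum_nonneg) auto
    have hl: "cmod (h i) \<le> 9 ^ s * sqrt E" if "i < s" for i
    proof -
      have "(cmod (h i))\<^sup>2 / 81 ^ i \<le> E" unfolding E_def
        using that by (intro member_le_sum) auto
      then have "(cmod (h i))\<^sup>2 \<le> 81 ^ i * E" by (simp add: divide_simps mult.commute)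
      also have "\<dots> \<le> 81 ^ s * E" using that E0 by (intro mult_right_mono power_increasing) auto
      also have "\<dots> = (9 ^ s * sqrt E)\<^sup>2"
        using E0 by (simp add: power_mult_distrib power_mult[symmetric] mult.commute[of s 2]) (simp add: power_mult)
      finally show ?thesis by (rule power2_le_imp_le) (use E0 in simp)
    qed
    have hk: "rec_killed (map (\<lambda>w. w ^ d) ws) h" unfolding h_def by (intro rec_killed_sample k)
    have gr: "cmod (h i) \<le> 3 ^ i * (9 ^ s * sqrt E)" for i
      by (rule rec_killed_growth[OF hk]) (use k(2) hl s E0 in \<open>auto simp: norm_power\<close>)
    have tail: "(cmod (h i))\<^sup>2 / 81 ^ i \<le> (81 ^ s * E) * (1/9) ^ i" for i
    proof -
      have "(cmod (h i))\<^sup>2 \<le> (3 ^ i * (9 ^ s * sqrt E))\<^sup>2" using gr by (intro power_mono) auto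
      also have "\<dots> = 9 ^ i * (81 ^ s * E)"
        using E0 by (simp add: power_mult_distrib power_mult[symmetric] mult.commute[of _ 2]) (simp add: power_mult)
      finally have "(cmod (h i))\<^sup>2 / 81 ^ i \<le> 9 ^ i * (81 ^ s * E) / 81 ^ i" by (intro divide_right_mono) auto
      also have "9 ^ i * (81 ^ s * E) / 81 ^ i = (81 ^ s * E) * (9 / 81) ^ i"
        unfolding power_divide by simp
      finally show ?thesis by simp
    qed
    have "(\<Sum>i<N. (cmod (h i))\<^sup>2 / 81 ^ i) \<le> (\<Sum>i<4 * s+N. (cmod (h i))\<^sup>2 / 81 ^ i)"
      by (intro sum_mono2) auto
    also have "\<dots> = E + (\<Sum>i<N. (cmod (h (4 * s+i)))\<^sup>2 / 81 ^ (4 * s+i))"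
      unfolding E_def by (induction N) auto
    also have "(\<Sum>i<N. (cmod (h (4 * s+i)))\<^sup>2 / 81 ^ (4 * s+i)) \<le> (\<Sum>i<N. (81 ^ s * E) * (1/9) ^ (4 * s+i))"
      by (intro sum_mono tail)
    also have "\<dots> = (81 ^ s * E) * (1/9) ^ (4 * s) * (\<Sum>i<N. (1/9) ^ i)"
      unfolding sum_distrib_left by (intro sum.cong) (auto simp: power_add)
    also have "(\<Sum>i<N. (1/9::real) ^ i) \<le> 9/8"
      by (simp add: sum_gp_strict)
    \<comment> \<open>Bounding the first \<open>s\<close> samples by the energy \<open>E\<close>
      costs \<open>81 ^ s\<close>. Starting the tail at sample \<open>4 s\<close> gains
      \<open>9 ^ (4 s) = 81 ^ (2 s)\<close>, which explains the window of \<open>4 s\<close>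
      samples.\<close>
    also have "(81 ^ s * E) * (1/9) ^ (4 * s) * (9/8) = E * (9/8) * (1/81) ^ s"
      by (simp add: power_mult power_one_over power_mult_distrib[symmetric] divide_simps)
    also have "\<dots> \<le> E * (9/8) * (1/81) ^ 1"
      using E0 s by (intro mult_left_mono power_decreasing) auto
    also have "\<dots> \<le> E" using E0 by simp
    finally have "(\<Sum>i<N. (cmod (h i))\<^sup>2 / 81 ^ i) \<le> 2 * E" using E0 by (simp add: mult_left_mono)
    then have "\<rho> ^ (2 * l) * (\<Sum>i<N. (cmod (h i))\<^sup>2 / 81 ^ i) \<le> \<rho> ^ (2 * l) * (2 * E)"
      using \<beta> by (intro mult_left_mono) auto
    then show ?thesis unfolding eh sum_distrib_left[symmetric] E_def by (simp add: algebra_simps)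
  qed
  have grp: "(\<Sum>j<N * d. e j) = (\<Sum>l<d. \<Sum>i<N. e (l + i * d))" for N
  proof -
    have "(\<Sum>j<N * d. e j) = (\<Sum>i<N. sum e {i * d..<i * d + d})" by (simp add: sum.nat_group)
    also have "\<dots> = (\<Sum>i<N. \<Sum>l<d. e (l + i * d))"
    proof (rule sum.cong[OF refl])
      fix i show "sum e {i * d..<i * d + d} = (\<Sum>l<d. e (l + i * d))"
        using sum.shift_bounds_nat_ivl[of e 0 "i * d" d] by (simp add: lessThan_atLeast0 add.commute)
    qed
    also have "\<dots> = (\<Sum>l<d. \<Sum>i<N. e (l + i * d))" by (rule sum.swap)
    finally show ?thesis .
  qed
  have "(\<Sum>j<n. e j) \<le> (\<Sum>j<n * d. e j)" using d e0 by (intro sum_mono2) auto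
  also have "\<dots> \<le> (\<Sum>l<d. 2 * (\<Sum>i<4 * s. e (l + i * d)))" unfolding grp by (intro sum_mono res)
  also have "\<dots> = 2 * (\<Sum>j<4 * s * d. e j)" unfolding grp by (simp add: sum_distrib_left)
  finally show ?thesis by (simp add: e_def)
qed

text \<open>The constant is \<open>80 = 2 * 5 * 8\<close>: \<open>2\<close> for the tail outside the
  window, \<open>5 / d\<close> for \<open>1 - \<rho>^2\<close>, and \<open>8\<close> for rounding in
  \<open>d = n div (4 s)\<close>. The two factors \<open>s\<close> come from the number of roots and
  from \<open>d\<close>.\<close>

lemma rec_killed_window_bound:
  assumes k: "rec_killed ws f" "\<And>w. w \<in> set ws \<Longrightarrow> cmod w = 1"
    and s: "s = length ws" "s \<ge> 1" and n: "n \<ge> 4 * s"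
  shows "(cmod (f 0))\<^sup>2 \<le> 80 * (real s)\<^sup>2 / real n * (\<Sum>j<n. (cmod (f j))\<^sup>2)"
proof -
  define d where "d = n div (4 * s)"
  have d: "d > 0" using n s by (auto simp: d_def div_greater_zero_iff)
  have dn: "4 * s * d \<le> n" by (simp add: d_def)
  have "n mod (4 * s) < 4 * s" using s by (intro mod_less_divisor) auto
  moreover have "n = 4 * s * d + n mod (4 * s)" by (simp add: d_def)
  moreover have "4 * s \<le> 4 * s * d" using d by simp
  ultimately have "n \<le> 8 * s * d" by linarith
  then have dn2: "real n \<le> 8 * real s * real d" by (metis of_nat_le_iff of_nat_mult of_nat_numeral)
  \<comment> \<open>The \<open>d\<close>-th root of \<open>1 / 9\<close>, so that the weight loses
    the factor \<open>81\<close> over one sampling step.\<close>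
  define \<rho> where "\<rho> = exp (- (ln 9 / real d))"
  have \<rho>: "0 < \<rho>" "\<rho> < 1" using d by (auto simp: \<rho>_def)
  have \<beta>: "\<rho> ^ (2 * d) = 1 / 81"
  proof -
    have "\<rho> ^ (2 * d) = exp (- (2 * ln 9))" using d by (simp add: \<rho>_def exp_of_nat_mult[symmetric])
    also have "\<dots> = 1 / (exp (ln 9))\<^sup>2" by (simp add: exp_minus exp_double field_simps)
    also have "\<dots> = 1 / 81" by simp
    finally show ?thesis .
  qed
  have l9: "ln (9::real) \<le> 2.5"
  proof -
    have "(2::real) \<le> exp 1" using exp_ge_add_one_self[of 1] by simp
    have "1 + 5/4 + (5/4)\<^sup>2/2 \<le> exp (5/4::real)" using exp_lower_Taylor_quadratic[of "5/4"] by simp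
    then have "3 \<le> exp (5/4::real)" by (simp add: power2_eq_square)
    then have "3 * 3 \<le> exp (5/4::real) * exp (5/4)" by (intro mult_mono) auto
    then have "9 \<le> exp (2.5::real)" by (simp flip: exp_add)
    from ln_mono[OF this] show ?thesis by simp
  qed
  have r2: "1 - \<rho>\<^sup>2 \<le> 5 / real d"
  proof -
    have "\<rho>\<^sup>2 = exp (- (2 * ln 9 / real d))" by (simp add: \<rho>_def flip: exp_double)
    moreover have "1 + (- (2 * ln 9 / real d)) \<le> exp (- (2 * ln 9 / real d))" by (rule exp_ge_add_one_self)
    moreover have "2 * ln 9 / real d \<le> 5 / real d" using l9 d by (intro divide_right_mono) auto
    ultimately show ?thesis by linarith
  qed
  define S where "S = (\<Sum>j<n. (cmod (f j))\<^sup>2)"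
  define g where "g = (\<lambda>j. complex_of_real \<rho> ^ j * f j)"
  have g2: "(cmod (g j))\<^sup>2 = (cmod (f j))\<^sup>2 * \<rho> ^ (2 * j)" for j
    using \<rho> by (simp add: g_def norm_mult norm_power power_mult_distrib power_mult[symmetric] mult.commute)
  have gk: "rec_killed (map (\<lambda>w. complex_of_real \<rho> * w) ws) g"
    unfolding g_def by (intro rec_killed_geometric k)
  have F1: "summable (\<lambda>j. (cmod (g j))\<^sup>2)"
    "(cmod (g 0))\<^sup>2 \<le> real s * (1 - \<rho>\<^sup>2) * (\<Sum>j. (cmod (g j))\<^sup>2)"
  proof -
    have "cmod a = \<rho>" if "a \<in> set (map (\<lambda>w. complex_of_real \<rho> * w) ws)" for a
      using that k(2) \<rho> by (auto simp: norm_mult)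
    from rec_killed_head_bound[OF gk this less_imp_le[OF \<rho>(1)] \<rho>(2)]
    show "summable (\<lambda>j. (cmod (g j))\<^sup>2)"
      "(cmod (g 0))\<^sup>2 \<le> real s * (1 - \<rho>\<^sup>2) * (\<Sum>j. (cmod (g j))\<^sup>2)" by (auto simp: s)
  qed
  have "(\<Sum>j. (cmod (g j))\<^sup>2) \<le> 2 * S"
  proof (rule suminf_le_const[OF F1(1)])
    fix N
    have "(\<Sum>j<N. (cmod (g j))\<^sup>2) \<le> 2 * (\<Sum>j<4 * s * d. (cmod (f j))\<^sup>2 * \<rho> ^ (2 * j))"
      unfolding g2 by (intro rec_killed_tail[OF k d \<beta> \<rho> s]) auto
    also have "(\<Sum>j<4 * s * d. (cmod (f j))\<^sup>2 * \<rho> ^ (2 * j)) \<le> (\<Sum>j<4 * s * d. (cmod (f j))\<^sup>2 * 1)"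
      using \<rho> by (intro sum_mono mult_left_mono power_le_one) auto
    also have "\<dots> \<le> S" unfolding S_def using dn by (simp, intro sum_mono2) auto
    finally show "(\<Sum>j<N. (cmod (g j))\<^sup>2) \<le> 2 * S" by simp
  qed
  moreover have "0 \<le> real s * (1 - \<rho>\<^sup>2)" using \<rho> by (simp add: power_le_one)
  ultimately have "(cmod (g 0))\<^sup>2 \<le> real s * (1 - \<rho>\<^sup>2) * (2 * S)"
    using F1(2) by (meson mult_left_mono order_trans)
  also have "\<dots> \<le> real s * (5 / real d) * (2 * S)"
    using r2 by (intro mult_right_mono mult_left_mono) (auto simp: S_def sum_nonneg)
  also have "\<dots> = (10 * real s / real d) * S" by simp
  also have "\<dots> \<le> (80 * (real s)\<^sup>2 / real n) * S"
  proof (intro mult_right_mono)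
    have "10 * real s * real n \<le> 10 * real s * (8 * real s * real d)" using dn2 by (intro mult_left_mono) auto
    then show "10 * real s / real d \<le> 80 * (real s)\<^sup>2 / real n"
      using d n s by (simp add: divide_simps power2_eq_square mult_ac)
  qed (simp add: S_def sum_nonneg)
  finally show ?thesis by (simp add: g_def S_def)
qed

section \<open>Reproducing kernels of oscillations\<close>

text \<open>The two-sided counterpart of \<open>rec_killed\<close>, with factors
  \<open>1 - w \<Delta>\<close> as in \<open>char_poly\<close>. A list of roots treats repeated
  frequencies like distinct ones and allows induction over first-order factors.\<close>

fun seq_killed :: "complex list \<Rightarrow> seq \<Rightarrow> bool" where
  "seq_killed [] x \<longleftrightarrow> (\<forall>t. x t = 0)"
| "seq_killed (w # ws) x \<longleftrightarrow> seq_killed ws (\<lambda>t. x t - w * x (t - 1))"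

lemma poly_lag_eq_sum:
  assumes "degree p \<le> n"
  shows "poly_lag p x t = (\<Sum>j\<le>n. coeff p j * x (t - int j))"
  unfolding poly_lag_def lag_def using assms
  by (intro sum.mono_neutral_left) (auto simp: coeff_eq_0)

lemma poly_lag_linear_factor:
  "poly_lag ([:1, - w:] * p) x = poly_lag p (\<lambda>t. x t - w * x (t - 1))"
proof
  fix t
  define n where "n = Suc (degree p)"
  have eq: "[:1, - w:] * p = p + pCons 0 (smult (- w) p)" by simp
  have deg: "degree ([:1, - w:] * p) \<le> Suc n"
  proof -
    have "degree (pCons 0 (smult (- w) p)) \<le> n"
      using degree_pCons_le[of 0 "smult (- w) p"] degree_smult_le[of "- w" p] unfolding n_def by linarith
    then show ?thesis unfolding eq by (intro degree_add_le) (auto simp: n_def)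
  qed
  have "poly_lag ([:1, - w:] * p) x t
      = (\<Sum>j\<le>Suc n. coeff p j * x (t - int j)) + (\<Sum>j\<le>Suc n. coeff (pCons 0 (smult (- w) p)) j * x (t - int j))"
    unfolding poly_lag_eq_sum[OF deg] unfolding eq by (simp add: distrib_right sum.distrib)
  also have "(\<Sum>j\<le>Suc n. coeff (pCons 0 (smult (- w) p)) j * x (t - int j)) = (\<Sum>j\<le>n. - w * coeff p j * x (t - 1 - int j))"
    by (subst sum.atMost_Suc_shift) (simp add: algebra_simps)
  also have "(\<Sum>j\<le>Suc n. coeff p j * x (t - int j)) = (\<Sum>j\<le>n. coeff p j * x (t - int j))"
    by (simp add: n_def coeff_eq_0)
  also have "(\<Sum>j\<le>n. coeff p j * x (t - int j)) + (\<Sum>j\<le>n. - w * coeff p j * x (t - 1 - int j))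
      = (\<Sum>j\<le>n. coeff p j * (x (t - int j) - w * x (t - int j - 1)))"
    by (simp add: sum.distrib[symmetric] algebra_simps)
  also have "\<dots> = poly_lag p (\<lambda>t. x t - w * x (t - 1)) t"
    by (subst poly_lag_eq_sum[of p n]) (auto simp: n_def)
  finally show "poly_lag ([:1, - w:] * p) x t = poly_lag p (\<lambda>t. x t - w * x (t - 1)) t" .
qed

lemma poly_lag_prod_list:
  "(\<forall>t. poly_lag (\<Prod>w\<leftarrow>ws. [:1, - w:]) x t = 0) \<longleftrightarrow> seq_killed ws x"
proof (induction ws arbitrary: x)
  case Nil then show ?case by (simp add: poly_lag_def lag_def)
next
  case (Cons w ws) then show ?case by (simp add: poly_lag_linear_factor del: mult_pCons_left)
qed

definition roots :: "nat \<Rightarrow> (nat \<Rightarrow> real) \<Rightarrow> complex list" where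
  "roots s \<omega> = map (\<lambda>k. exp (\<i> * complex_of_real (\<omega> k))) [1..<Suc s]"

lemma length_roots [simp]: "length (roots s \<omega>) = s"
  by (simp add: roots_def)

lemma norm_roots: "w \<in> set (roots s \<omega>) \<Longrightarrow> cmod w = 1"
  by (auto simp: roots_def)

lemma oscillations_at_eq: "oscillations_at s \<omega> = {x. seq_killed (roots s \<omega>) x}"
proof -
  have "char_poly s \<omega> = (\<Prod>w\<leftarrow>roots s \<omega>. [:1, - w:])"
    by (simp add: char_poly_def roots_def comp_def prod.distinct_set_conv_list[symmetric] atLeastLessThanSuc_atLeastAtMost
        del: upt_Suc)
  then show ?thesis by (simp add: oscillations_at_def poly_lag_prod_list)
qed

lemma seq_killed_lincomb:
  assumes "finite I" "\<And>i. i \<in> I \<Longrightarrow> seq_killed ws (f i)"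
  shows "seq_killed ws (\<lambda>t. \<Sum>i\<in>I. c i * f i t)"
  using assms
proof (induction ws arbitrary: f)
  case (Cons w ws)
  have "seq_killed ws (\<lambda>t. \<Sum>i\<in>I. c i * (f i t - w * f i (t - 1)))"
    using Cons.prems by (intro Cons.IH) auto
  then show ?case
    by (simp add: sum_subtractf sum_distrib_left algebra_simps)
qed simp

lemma seq_killed_add_scale:
  assumes "seq_killed ws f" "seq_killed ws g"
  shows "seq_killed ws (\<lambda>t. f t + c * g t)"
  using seq_killed_lincomb[of "UNIV :: bool set" ws "\<lambda>b. if b then f else g" "\<lambda>b. if b then 1 else c"] assms
  by (simp add: UNIV_bool add.commute)

lemma seq_killed_shift: "seq_killed ws x \<Longrightarrow> seq_killed ws (\<lambda>t. x (t - a))"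
proof (induction ws arbitrary: x)
  case (Cons w ws)
  then have "seq_killed ws (\<lambda>t. x (t - a) - w * x (t - a - 1))" by simp
  then show ?case by (simp add: algebra_simps)
qed simp

lemma seq_killed_Cons: "seq_killed ws x \<Longrightarrow> seq_killed (w # ws) x"
  using seq_killed_add_scale[OF _ seq_killed_shift[of ws x 1], of x "- w"] by simp

lemma seq_killed_forward: "seq_killed ws x \<Longrightarrow> rec_killed ws (\<lambda>j. x (t + int j))"
proof (induction ws arbitrary: x t)
  case (Cons w ws)
  then have "rec_killed ws (\<lambda>j. x (t + 1 + int j) - w * x (t + 1 + int j - 1))"
    by (intro Cons.IH[of "\<lambda>t. x t - w * x (t - 1)"]) simp
  then show ?case by (simp add: algebra_simps)
qed simp

text \<open>Time reversal replaces a root by its inverse, which is \<open>cnj w\<close> on the unit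
  circle. It makes the right end of a window accessible to the estimate at a left end.\<close>

lemma seq_killed_backward:
  assumes "\<And>w. w \<in> set ws \<Longrightarrow> cmod w = 1"
  shows "seq_killed ws x \<Longrightarrow> rec_killed (map cnj ws) (\<lambda>j. x (t - int j))"
  using assms
proof (induction ws arbitrary: x)
  case (Cons w ws)
  then have "rec_killed (map cnj ws) (\<lambda>j. x (t - int j) - w * x (t - int j - 1))"
    by (intro Cons.IH[of "\<lambda>t. x t - w * x (t - 1)"]) auto
  note rec_killed_scale[OF this, of "- cnj w"]
  moreover have "cnj w * w = 1" using Cons.prems(2)[of w] complex_norm_square[of w] by (simp add: mult.commute)
  then have "- cnj w * (x (t - int j) - w * x (t - int j - 1)) = x (t - int (Suc j)) - cnj w * x (t - int j)" for j
    by (simp add: algebra_simps)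
  ultimately show ?case by simp
qed simp

text \<open>The solution space of the recurrence gains at most one dimension per factor: the images of
  two solutions under the other factors are multiples of the same exponential.\<close>

lemma seq_killed_codim_1:
  assumes w: "w \<noteq> 0" and b: "seq_killed (w # ws) b" "\<not> seq_killed ws b" and x: "seq_killed (w # ws) x"
  shows "\<exists>c. seq_killed ws (\<lambda>t. x t + c * b t)"
proof -
  define P where "P = (\<Prod>w\<leftarrow>ws. [:1, - w:])"
  have lin: "poly_lag P (\<lambda>t. u t + c * v t) t = poly_lag P u t + c * poly_lag P v t" for u v c t
    by (simp add: poly_lag_def lag_def sum.distrib sum_distrib_left algebra_simps)
  have shift: "poly_lag P (\<lambda>t. u (t - 1)) t = poly_lag P u (t - 1)" for u t
    by (simp add: poly_lag_def lag_def algebra_simps)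
  have killed: "seq_killed ws u \<longleftrightarrow> (\<forall>t. poly_lag P u t = 0)" for u
    by (simp add: P_def poly_lag_prod_list)
  have geo: "poly_lag P u t = w * poly_lag P u (t - 1)" if "seq_killed (w # ws) u" for u t
    using that lin[of u "- w" "\<lambda>t. u (t - 1)" t] by (simp add: killed shift)
  have ratio: "poly_lag P u t * poly_lag P b 0 = poly_lag P u 0 * poly_lag P b t"
    if u: "seq_killed (w # ws) u" for u t
  proof (induction t rule: int_induct[where k = 0])
    case (step1 t)
    then show ?case using geo[OF u, of "t + 1"] geo[OF b(1), of "t + 1"] by simp
  next
    case (step2 t)
    then show ?case using geo[OF u, of t] geo[OF b(1), of t] w by simp
  qed simp
  \<comment> \<open>By \<open>geo\<close> and \<open>w \<noteq> 0\<close> a zero at one point would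
    spread in both directions, and \<open>b\<close> would be killed by \<open>ws\<close>.\<close>
  have nz: "poly_lag P b 0 \<noteq> 0"
  proof
    assume z: "poly_lag P b 0 = 0"
    have "poly_lag P b t = 0" for t
    proof (induction t rule: int_induct[where k = 0])
      case (step1 t)
      then show ?case using geo[OF b(1), of "t + 1"] by simp
    next
      case (step2 t)
      then show ?case using geo[OF b(1), of t] w by simp
    qed (simp add: z)
    then show False using b(2) by (simp add: killed)
  qed
  have "poly_lag P (\<lambda>t. x t + (- poly_lag P x 0 / poly_lag P b 0) * b t) t = 0" for t
    unfolding lin using ratio[OF x, of t] nz by (simp add: field_simps)
  then show ?thesis unfolding killed by blast
qed

text \<open>The matrix of the orthogonal projection onto the restrictions to \<open>I\<close> of
  sequences in \<open>V\<close>; its trace is the dimension. Columns must lie in \<open>V\<close> as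
  two-sided sequences, so that estimates for solutions apply to them.\<close>

definition repr_kernel :: "int set \<Rightarrow> seq set \<Rightarrow> nat \<Rightarrow> (int \<Rightarrow> int \<Rightarrow> complex) \<Rightarrow> bool" where
  "repr_kernel I V s k \<longleftrightarrow>
     (\<forall>i\<in>I. \<forall>j\<in>I. k j i = cnj (k i j)) \<and>
     (\<forall>x\<in>V. \<forall>i\<in>I. x i = (\<Sum>j\<in>I. k i j * x j)) \<and>
     (\<forall>j\<in>I. (\<lambda>i. k i j) \<in> V) \<and>
     (\<Sum>i\<in>I. Re (k i i)) \<le> real s"

lemma repr_kernelD:
  assumes "repr_kernel I V s k"
  shows repr_kernel_hermitian: "\<And>i j. i \<in> I \<Longrightarrow> j \<in> I \<Longrightarrow> k j i = cnj (k i j)"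
    and repr_kernel_reproduces: "\<And>x i. x \<in> V \<Longrightarrow> i \<in> I \<Longrightarrow> x i = (\<Sum>j\<in>I. k i j * x j)"
    and repr_kernel_column: "\<And>j. j \<in> I \<Longrightarrow> (\<lambda>i. k i j) \<in> V"
    and repr_kernel_trace: "(\<Sum>i\<in>I. Re (k i i)) \<le> real s"
proof -
  have 1: "\<forall>i\<in>I. \<forall>j\<in>I. k j i = cnj (k i j)"
    and 2: "\<forall>x\<in>V. \<forall>i\<in>I. x i = (\<Sum>j\<in>I. k i j * x j)"
    and 3: "\<forall>j\<in>I. (\<lambda>i. k i j) \<in> V" and 4: "(\<Sum>i\<in>I. Re (k i i)) \<le> real s"
    using assms unfolding repr_kernel_def by - (elim conjE, assumption)+
  show "\<And>i j. i \<in> I \<Longrightarrow> j \<in> I \<Longrightarrow> k j i = cnj (k i j)" by (rule 1[rule_format])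
  show "\<And>x i. x \<in> V \<Longrightarrow> i \<in> I \<Longrightarrow> x i = (\<Sum>j\<in>I. k i j * x j)" by (rule 2[rule_format])
  show "\<And>j. j \<in> I \<Longrightarrow> (\<lambda>i. k i j) \<in> V" by (rule 3[rule_format])
  show "(\<Sum>i\<in>I. Re (k i i)) \<le> real s" by (rule 4)
qed

text \<open>Reproducing the column at \<open>i\<close> at the point \<open>i\<close> itself gives
  \<open>k i i\<close> as the sum of \<open>k i j * k j i\<close>, a sum of squared moduli by
  symmetry. So bounding the diagonal bounds the norm of a row used as a filter.\<close>

lemma repr_kernel_diag:
  assumes "repr_kernel I V s k" "i \<in> I"
  shows "(\<Sum>j\<in>I. (cmod (k i j))\<^sup>2) = Re (k i i)" "(\<Sum>j\<in>I. (cmod (k j i))\<^sup>2) = Re (k i i)" "k i i = of_real (Re (k i i))"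
    "0 \<le> Re (k i i)"
proof -
  note h = repr_kernel_hermitian[OF assms(1)] and r = repr_kernel_reproduces[OF assms(1)]
    and v = repr_kernel_column[OF assms(1)]
  have "k i i = (\<Sum>j\<in>I. k i j * k j i)" using r[OF v[OF assms(2)] assms(2)] .
  also have "\<dots> = (\<Sum>j\<in>I. of_real ((cmod (k i j))\<^sup>2))"
    by (rule sum.cong[OF refl]) (simp add: h[OF assms(2)] complex_norm_square del: of_real_power)
  finally have e: "k i i = of_real (\<Sum>j\<in>I. (cmod (k i j))\<^sup>2)" by simp
  from arg_cong[OF this, of Re] show 1: "(\<Sum>j\<in>I. (cmod (k i j))\<^sup>2) = Re (k i i)" by simp
  show "k i i = of_real (Re (k i i))" unfolding 1[symmetric] by (rule e)
  show "0 \<le> Re (k i i)" unfolding 1[symmetric] by (intro sum_nonneg) auto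
  have "(\<Sum>j\<in>I. (cmod (k j i))\<^sup>2) = (\<Sum>j\<in>I. (cmod (k i j))\<^sup>2)"
    by (rule sum.cong[OF refl]) (simp add: h[OF assms(2)])
  then show "(\<Sum>j\<in>I. (cmod (k j i))\<^sup>2) = Re (k i i)" using 1 by simp
qed

text \<open>Gram-Schmidt over the factors: a further root adds at most one solution \<open>b\<close>
  modulo the old ones. Its residual \<open>q\<close> is orthogonal to the old space on
  \<open>I\<close>, and the rank-one term built from \<open>q\<close> has trace
  \<open>1\<close>.\<close>

lemma repr_kernel_exists:
  assumes I: "finite I" and w: "\<And>w. w \<in> set ws \<Longrightarrow> w \<noteq> 0"
  shows "\<exists>k. repr_kernel I {x. seq_killed ws x} (length ws) k"
  using w
proof (induction ws)
  case Nil
  then show ?case by (intro exI[of _ "\<lambda>_ _. 0"]) (simp add: repr_kernel_def)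
next
  case (Cons w ws)
  let ?H = "{x. seq_killed ws x}" and ?H' = "{x. seq_killed (w # ws) x}"
  obtain k where k: "repr_kernel I ?H (length ws) k" using Cons by auto
  note h = repr_kernel_hermitian[OF k] and r = repr_kernel_reproduces[OF k, OF CollectI]
    and v = repr_kernel_column[OF k, THEN CollectD] and tr = repr_kernel_trace[OF k]
  have v': "\<And>j. j \<in> I \<Longrightarrow> seq_killed (w # ws) (\<lambda>i. k i j)" using v seq_killed_Cons by blast
  have keep: ?case if "\<And>x i. seq_killed (w # ws) x \<Longrightarrow> i \<in> I \<Longrightarrow> x i = (\<Sum>j\<in>I. k i j * x j)"
    unfolding repr_kernel_def
  proof (intro exI[of _ k] conjI ballI)
    fix i j assume ij: "i \<in> I" "j \<in> I"
    show "k j i = cnj (k i j)" by (rule h[OF ij])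
  next
    fix x i assume "x \<in> ?H'" "i \<in> I"
    then show "x i = (\<Sum>j\<in>I. k i j * x j)" by (intro that) auto
  qed (use v' tr in auto)
  show ?case
  proof (cases "\<exists>b. seq_killed (w # ws) b \<and> \<not> seq_killed ws b")
    case False
    show ?thesis
    proof (rule keep)
      fix x i assume "seq_killed (w # ws) x" "i \<in> I"
      then show "x i = (\<Sum>j\<in>I. k i j * x j)" using False by (intro r) blast+
    qed
  next
    case True
    then obtain b where b: "seq_killed (w # ws) b" "\<not> seq_killed ws b" by blast
    have dec: "\<exists>c. seq_killed ws (\<lambda>t. x t + c * b t)" if "seq_killed (w # ws) x" for x
      using seq_killed_codim_1[OF _ b that] Cons.prems by simp
    define q where "q = (\<lambda>i. b i - (\<Sum>j\<in>I. k i j * b j))"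
    have kb: "seq_killed ws (\<lambda>i. \<Sum>j\<in>I. k i j * b j)"
      using seq_killed_lincomb[OF I, of ws "\<lambda>j i. k i j" b] v by (simp add: mult.commute)
    have q: "seq_killed (w # ws) q"
      using seq_killed_add_scale[OF b(1) seq_killed_Cons[OF kb], of "-1"] by (simp add: q_def del: seq_killed.simps)
    have orth: "(\<Sum>j\<in>I. cnj (q j) * x j) = 0" if x: "seq_killed ws x" for x
    proof -
      have "(\<Sum>j\<in>I. cnj (\<Sum>l\<in>I. k j l * b l) * x j) = (\<Sum>j\<in>I. \<Sum>l\<in>I. cnj (b l) * (k l j * x j))"
        unfolding cnj_sum sum_distrib_right
      proof (intro sum.cong refl)
        fix j l assume "j \<in> I" "l \<in> I"
        then show "cnj (k j l * b l) * x j = cnj (b l) * (k l j * x j)"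
          by (simp add: h[of j l])
      qed
      also have "\<dots> = (\<Sum>l\<in>I. cnj (b l) * x l)"
      proof (subst sum.swap, rule sum.cong[OF refl])
        fix l assume l: "l \<in> I"
        show "(\<Sum>j\<in>I. cnj (b l) * (k l j * x j)) = cnj (b l) * x l"
          unfolding sum_distrib_left[symmetric] r[OF x l, symmetric] ..
      qed
      finally show ?thesis by (simp add: q_def algebra_simps sum_subtractf del: cnj_sum)
    qed
    define N where "N = (\<Sum>j\<in>I. (cmod (q j))\<^sup>2)"
    have qb: "(\<Sum>j\<in>I. cnj (q j) * b j) = of_real N"
    proof -
      have "(\<Sum>j\<in>I. cnj (q j) * b j) = (\<Sum>j\<in>I. cnj (q j) * q j) + (\<Sum>j\<in>I. cnj (q j) * (\<Sum>l\<in>I. k j l * b l))"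
        by (simp add: q_def algebra_simps sum.distrib[symmetric])
      also have "(\<Sum>j\<in>I. cnj (q j) * (\<Sum>l\<in>I. k j l * b l)) = 0" by (rule orth[OF kb])
      also have "(\<Sum>j\<in>I. cnj (q j) * q j) = of_real N"
        unfolding N_def of_real_sum by (intro sum.cong refl) (metis complex_norm_square mult.commute)
      finally show ?thesis by simp
    qed
    show ?thesis
    proof (cases "N = 0")
      case True
      \<comment> \<open>On \<open>I\<close> the new solution coincides with one from the old space,
        as happens when the window is too short to tell them apart; the old kernel stays
        valid.\<close>
      then have q0: "i \<in> I \<Longrightarrow> q i = 0" for i using I by (simp add: N_def sum_nonneg_eq_0_iff)
      show ?thesis
      proof (rule keep)
        fix x i assume x: "seq_killed (w # ws) x" and i: "i \<in> I"
        obtain c where c: "seq_killed ws (\<lambda>t. x t + c * b t)" using dec[OF x] ..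
        have "b i = (\<Sum>j\<in>I. k i j * b j)" using q0[OF i] by (simp add: q_def)
        moreover have "x i + c * b i = (\<Sum>j\<in>I. k i j * x j) + c * (\<Sum>j\<in>I. k i j * b j)"
          using r[OF c i] by (simp add: sum_distrib_left algebra_simps sum.distrib)
        ultimately show "x i = (\<Sum>j\<in>I. k i j * x j)" by simp
      qed
    next
      case False
      then have N: "N > 0" by (simp add: N_def order_less_le sum_nonneg)
      define k' where "k' = (\<lambda>i j. k i j + cnj (q j) / of_real N * q i)"
      have app: "(\<Sum>j\<in>I. k' i j * x j) = (\<Sum>j\<in>I. k i j * x j) + q i / of_real N * (\<Sum>j\<in>I. cnj (q j) * x j)" for x i
        by (simp add: k'_def sum.distrib sum_distrib_left algebra_simps sum_divide_distrib)
      have rb: "b i = (\<Sum>j\<in>I. k' i j * b j)" for i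
        unfolding app qb using N by (simp add: q_def)
      have rx: "x i = (\<Sum>j\<in>I. k' i j * x j)" if x: "seq_killed (w # ws) x" and i: "i \<in> I" for x i
      proof -
        obtain c where c: "seq_killed ws (\<lambda>t. x t + c * b t)" using dec[OF x] ..
        have "x i + c * b i = (\<Sum>j\<in>I. k' i j * (x j + c * b j))"
          unfolding app orth[OF c] using r[OF c i] by simp
        also have "\<dots> = (\<Sum>j\<in>I. k' i j * x j) + c * (\<Sum>j\<in>I. k' i j * b j)"
          by (simp add: sum_distrib_left algebra_simps sum.distrib)
        finally show ?thesis using rb[of i] by simp
      qed
      have herm: "k' j i = cnj (k' i j)" if "i \<in> I" "j \<in> I" for i j
        by (simp add: k'_def h[OF that])
      have mem: "seq_killed (w # ws) (\<lambda>i. k' i j)" if "j \<in> I" for j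
        unfolding k'_def by (intro seq_killed_add_scale v' q that)
      have "(\<Sum>i\<in>I. Re (k' i i)) = (\<Sum>i\<in>I. Re (k i i)) + (\<Sum>i\<in>I. (cmod (q i))\<^sup>2 / N)"
      proof -
        have "Re (k' i i) = Re (k i i) + (cmod (q i))\<^sup>2 / N" for i
        proof -
          have "cnj (q i) / of_real N * q i = of_real ((cmod (q i))\<^sup>2 / N)"
            using complex_norm_square[of "q i"] by (simp add: mult.commute)
          then show ?thesis by (simp only: k'_def plus_complex.simps Re_complex_of_real)
        qed
        then show ?thesis by (simp add: sum.distrib)
      qed
      also have "(\<Sum>i\<in>I. (cmod (q i))\<^sup>2 / N) = 1" using N by (simp add: sum_divide_distrib[symmetric] N_def)
      finally have trace': "(\<Sum>i\<in>I. Re (k' i i)) \<le> real (length (w # ws))" using tr by simp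
      have "repr_kernel I ?H' (length (w # ws)) k'"
        unfolding repr_kernel_def
      proof (intro conjI ballI)
        fix i j assume ij: "i \<in> I" "j \<in> I"
        show "k' j i = cnj (k' i j)" by (rule herm[OF ij])
      next
        fix x i assume "x \<in> ?H'" "i \<in> I"
        then show "x i = (\<Sum>j\<in>I. k' i j * x j)" by (intro rx) auto
      qed (use mem trace' in \<open>auto simp del: seq_killed.simps\<close>)
      then show ?thesis by (intro exI[of _ k'])
    qed
  qed
qed

section \<open>Filters with small spectrum\<close>

lemma conv_eq_sum:
  assumes "\<phi> \<in> seqs_upto m"
  shows "conv \<phi> y t = (\<Sum>\<tau>\<in>{- int m..int m}. \<phi> \<tau> * y (t - \<tau>))"
proof -
  have "conv \<phi> y t = (\<Sum>\<^sub>\<infinity>\<tau>\<in>{- int m..int m}. \<phi> \<tau> * y (t - \<tau>))"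
    unfolding conv_def using assms by (intro infsum_cong_neutral) (auto simp: seqs_upto_def)
  then show ?thesis by simp
qed

section \<open>Characters and Parseval's identity\<close>

definition dft_char :: "nat \<Rightarrow> nat \<Rightarrow> int \<Rightarrow> complex" where
  "dft_char m k t = exp (- (2 * complex_of_real pi * \<i> * of_nat k * of_int t / (2 * of_nat m + 1)))"

lemma dft_char_add: "dft_char m k (a + b) = dft_char m k a * dft_char m k b"
  by (simp add: dft_char_def exp_add[symmetric] algebra_simps add_divide_distrib)

lemma dft_char_cis: "dft_char m k t = cis (- (2 * pi * real k * of_int t / (2 * real m + 1)))"
  by (simp add: dft_char_def cis_conv_exp mult_ac)

lemma norm_dft_char [simp]: "cmod (dft_char m k t) = 1"
  by (simp add: dft_char_cis)

lemma cnj_dft_char: "cnj (dft_char m k t) = dft_char m k (- t)"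
  by (simp add: dft_char_cis cis_cnj)

lemma dft_char_power: "dft_char m k t = dft_char m 1 t ^ k"
  by (simp add: dft_char_def exp_of_nat_mult[symmetric] mult_ac)

lemma dft_char_orthogonal:
  assumes "\<bar>d\<bar> < 2 * int m + 1"
  shows "(\<Sum>k = 1..2 * m + 1. dft_char m k d) = (if d = 0 then of_nat (2 * m + 1) else 0)"
proof (cases "d = 0")
  case True then show ?thesis by (simp add: dft_char_def)
next
  case False
  define z where "z = dft_char m 1 d"
  have "z ^ (2 * m + 1) = dft_char m (2 * m + 1) d" unfolding z_def by (rule dft_char_power[symmetric])
  also have "\<dots> = cis (2 * pi * of_int (- d))"
  proof -
    have "2 * pi * real (2 * m + 1) * of_int d / (2 * real m + 1) = 2 * pi * of_int d"
      by (simp add: field_simps)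
    then show ?thesis unfolding dft_char_cis by simp
  qed
  also have "\<dots> = 1" by (rule cis_multiple_2pi) auto
  finally have z1: "z ^ (2 * m + 1) = 1" .
  have z: "z \<noteq> 1"
  proof
    assume "z = 1"
    then have "cos (- (2 * pi * of_int d / (2 * real m + 1))) = 1"
      by (simp add: z_def dft_char_cis complex_eq_iff)
    then obtain n :: int where "- (2 * pi * of_int d / (2 * real m + 1)) = real_of_int n * 2 * pi"
      unfolding cos_one_2pi_int by auto
    then have "(2 * pi) * (- (real_of_int d / (2 * real m + 1))) = (2 * pi) * real_of_int n"
      by (simp add: mult_ac)
    then have "- (real_of_int d / (2 * real m + 1)) = real_of_int n"
      by (subst (asm) mult_left_cancel) auto
    then have "real_of_int d = real_of_int (- n * (2 * int m + 1))" by (simp add: field_simps)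
    then have "d = - n * (2 * int m + 1)" by (simp only: of_int_eq_iff)
    then have "\<bar>d\<bar> = \<bar>n\<bar> * (2 * int m + 1)" by (simp add: abs_mult)
    moreover have "n \<noteq> 0" using False \<open>d = - n * (2 * int m + 1)\<close> by auto
    then have "1 * (2 * int m + 1) \<le> \<bar>n\<bar> * (2 * int m + 1)" by (intro mult_right_mono) auto
    ultimately have "2 * int m + 1 \<le> \<bar>d\<bar>" by simp
    then show False using assms by simp
  qed
  have "(\<Sum>k = 1..2 * m + 1. dft_char m k d) = (\<Sum>k = 1..2 * m + 1. z ^ k)"
    unfolding z_def by (intro sum.cong refl dft_char_power)
  also have "\<dots> = (\<Sum>k<2 * m + 1. z ^ Suc k)"
    by (simp only: One_nat_def sum.atLeast1_atMost_eq)
  also have "\<dots> = z * ((z ^ (2 * m + 1) - 1) / (z - 1))"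
    unfolding power_Suc sum_distrib_left[symmetric] geometric_sum[OF z] ..
  finally show ?thesis using False z1 by simp
qed

text \<open>Formulated for any index set with differences below \<open>2 m + 1\<close>, because the
  filter that gets squared lives on a window \<open>{i..i + m}\<close> that is not centered.\<close>

lemma dft_parseval:
  assumes J: "finite J" "\<And>i j. i \<in> J \<Longrightarrow> j \<in> J \<Longrightarrow> \<bar>i - j\<bar> < 2 * int m + 1"
  shows "(\<Sum>k = 1..2 * m + 1. (cmod (\<Sum>j\<in>J. dft_char m k j * q j))\<^sup>2) = real (2 * m + 1) * (\<Sum>j\<in>J. (cmod (q j))\<^sup>2)"
proof -
  have "complex_of_real (\<Sum>k = 1..2 * m + 1. (cmod (\<Sum>j\<in>J. dft_char m k j * q j))\<^sup>2)
      = (\<Sum>k = 1..2 * m + 1. \<Sum>i\<in>J. \<Sum>j\<in>J. dft_char m k (i - j) * (q i * cnj (q j)))"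
    unfolding of_real_sum complex_norm_square cnj_sum sum_product
    by (intro sum.cong refl) (simp add: cnj_dft_char dft_char_add diff_conv_add_uminus del: add_uminus_conv_diff)
  also have "\<dots> = (\<Sum>i\<in>J. \<Sum>j\<in>J. (\<Sum>k = 1..2 * m + 1. dft_char m k (i - j)) * (q i * cnj (q j)))"
    unfolding sum_distrib_right by (subst sum.swap, intro sum.cong refl, rule sum.swap)
  also have "\<dots> = (\<Sum>i\<in>J. \<Sum>j\<in>J. if i = j then of_nat (2 * m + 1) * (q i * cnj (q j)) else 0)"
    using J(2) by (intro sum.cong refl) (subst dft_char_orthogonal, auto)
  also have "\<dots> = (\<Sum>i\<in>J. of_nat (2 * m + 1) * (q i * cnj (q i)))"
    using J(1) by (simp add: sum.delta)
  also have "\<dots> = complex_of_real (real (2 * m + 1) * (\<Sum>j\<in>J. (cmod (q j))\<^sup>2))"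
    by (simp add: sum_distrib_left complex_norm_square del: of_real_power)
  finally show ?thesis by (simp only: of_real_eq_iff)
qed

lemma dft_inverse:
  assumes "\<phi> \<in> seqs_upto m"
  shows "\<phi> t = (\<Sum>k = 1..2 * m + 1. dft m \<phi> k *
    (if t \<in> {- int m..int m} then cnj (dft_char m k t) / complex_of_real (sqrt (2 * real m + 1)) else 0))"
proof (cases "t \<in> {- int m..int m}")
  case True
  define R where "R = complex_of_real (sqrt (2 * real m + 1))"
  have R: "R * R = of_nat (2 * m + 1)" "R \<noteq> 0"
    by (auto simp: R_def complex_eq_iff simp flip: of_real_mult)
  have "(\<Sum>k = 1..2 * m + 1. dft m \<phi> k * (cnj (dft_char m k t) / R))
      = (\<Sum>k = 1..2 * m + 1. \<Sum>j\<in>{- int m..int m}. dft_char m k (j - t) * (\<phi> j / (R * R)))"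
    unfolding dft_def dft_char_def[symmetric] R_def[symmetric] sum_distrib_left sum_distrib_right
    by (intro sum.cong refl)
      (simp add: cnj_dft_char dft_char_add diff_conv_add_uminus del: add_uminus_conv_diff)
  also have "\<dots> = (\<Sum>j\<in>{- int m..int m}. (\<Sum>k = 1..2 * m + 1. dft_char m k (j - t)) * (\<phi> j / (R * R)))"
    unfolding sum_distrib_right by (rule sum.swap)
  also have "\<dots> = (\<Sum>j\<in>{- int m..int m}. if j = t then R * R * (\<phi> j / (R * R)) else 0)"
    using True unfolding R(1) by (intro sum.cong refl) (subst dft_char_orthogonal, auto)
  also have "\<dots> = \<phi> t" using True R(2) by (simp add: sum.delta)
  finally show ?thesis using True by (simp add: R_def)
next
  case False
  then have "\<phi> t = 0" using assms unfolding seqs_upto_def by blast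
  with False show ?thesis by (simp only: if_False mult_zero_right sum.neutral_const)
qed

text \<open>Parseval's identity and the domination of the l2-norm by the l1-norm. It turns
  feasibility into a bound on the variance of filtered noise.\<close>

lemma norm2_le_l1_dft:
  assumes "l1_norm m (dft m \<phi>) \<le> r"
  shows "(\<Sum>t\<in>{- int m..int m}. (cmod (\<phi> t))\<^sup>2) \<le> r\<^sup>2"
proof -
  define M where "M = 2 * real m + 1"
  have M: "M > 0" by (simp add: M_def)
  have "(\<Sum>k = 1..2 * m + 1. (cmod (dft m \<phi> k))\<^sup>2)
      = (\<Sum>k = 1..2 * m + 1. (cmod (\<Sum>j\<in>{- int m..int m}. dft_char m k j * \<phi> j))\<^sup>2) / M"
    unfolding dft_def dft_char_def[symmetric] M_def[symmetric] sum_divide_distrib using M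
    by (intro sum.cong refl) (simp add: norm_mult norm_divide power_divide del: sum_divide_distrib)
  also have "\<dots> = (\<Sum>t\<in>{- int m..int m}. (cmod (\<phi> t))\<^sup>2)"
    using M by (subst dft_parseval) (auto simp: M_def add.commute)
  finally have "(\<Sum>t\<in>{- int m..int m}. (cmod (\<phi> t))\<^sup>2) = (\<Sum>k = 1..2 * m + 1. (cmod (dft m \<phi> k))\<^sup>2)" ..
  also have "\<dots> \<le> (\<Sum>k = 1..2 * m + 1. cmod (dft m \<phi> k))\<^sup>2"
  proof -
    have "(L2_set (\<lambda>k. cmod (dft m \<phi> k)) {1..2 * m + 1})\<^sup>2 \<le> (\<Sum>k = 1..2 * m + 1. cmod (dft m \<phi> k))\<^sup>2"
      by (intro power_mono L2_set_le_sum L2_set_nonneg) auto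
    then show ?thesis unfolding L2_set_def by (simp add: sum_nonneg del: sum.cl_ivl_Suc)
  qed
  also have "\<dots> \<le> r\<^sup>2" using assms by (intro power_mono) (auto simp: l1_norm_def sum_nonneg)
  finally show ?thesis .
qed

section \<open>Reproducing filters from rows of the kernel\<close>

lemma sum_shifted_support:
  fixes g :: "int \<Rightarrow> 'a::comm_monoid_add"
  assumes "\<And>l. l \<notin> {i..j} \<Longrightarrow> g l = 0" "{i..j} \<subseteq> {a + b..c + b}"
  shows "(\<Sum>t\<in>{a..c}. g (t + b)) = (\<Sum>l\<in>{i..j}. g l)"
proof -
  have "(\<Sum>t\<in>{a..c}. g (t + b)) = (\<Sum>l\<in>{a + b..c + b}. g l)"
    by (rule sum.reindex_bij_witness[of _ "\<lambda>l. l - b" "\<lambda>t. t + b"]) auto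
  also have "\<dots> = (\<Sum>l\<in>{i..j}. g l)" using assms by (intro sum.mono_neutral_right) auto
  finally show ?thesis .
qed

text \<open>Squaring a reproducing filter turns an \<open>\<ell>\<^sub>2\<close> bound into an \<open>\<ell>\<^sub>1\<close> bound on the spectrum.\<close>

lemma squared_filter:
  fixes q :: seq and i :: int and m :: nat
  defines "J \<equiv> {i..i + int m}"
  assumes rep: "\<And>x t. x \<in> V \<Longrightarrow> x t = (\<Sum>j\<in>J. q j * x (t - j))"
    and norm: "(\<Sum>j\<in>J. (cmod (q j))\<^sup>2) \<le> v"
  shows "\<exists>\<phi>\<in>seqs_upto m. (\<forall>x\<in>V. x = conv \<phi> (lag (2 * i + int m) x)) \<and>
    l1_norm m (dft m \<phi>) \<le> sqrt (2 * real m + 1) * v"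
proof -
  \<comment> \<open>The self-convolution of \<open>q\<close> lives on
    \<open>{2 i..2 i + 2 m}\<close>. Its midpoint \<open>a\<close> is split off as a lag, which
    leaves a filter in \<open>seqs_upto m\<close>.\<close>
  define a where "a = 2 * i + int m"
  define q' where "q' = (\<lambda>l. if l \<in> J then q l else 0)"
  define \<phi> where "\<phi> = (\<lambda>\<tau>. \<Sum>j\<in>J. q j * q' (\<tau> + (a - j)))"
  have sum_\<phi>: "(\<Sum>\<tau>\<in>{- int m..int m}. \<phi> \<tau> * h (\<tau> + a)) = (\<Sum>j\<in>J. \<Sum>l\<in>J. q j * q l * h (l + j))"
    for h :: "int \<Rightarrow> complex"
  proof -
    have "(\<Sum>\<tau>\<in>{- int m..int m}. \<phi> \<tau> * h (\<tau> + a))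
        = (\<Sum>j\<in>J. \<Sum>\<tau>\<in>{- int m..int m}. q j * q' (\<tau> + (a - j)) * h (\<tau> + (a - j) + j))"
      unfolding \<phi>_def sum_distrib_right by (subst sum.swap) simp
    also have "\<dots> = (\<Sum>j\<in>J. \<Sum>l\<in>J. q j * q l * h (l + j))"
    proof (rule sum.cong[OF refl])
      fix j assume j: "j \<in> J"
      have "(\<Sum>\<tau>\<in>{- int m..int m}. q j * q' (\<tau> + (a - j)) * h (\<tau> + (a - j) + j)) = (\<Sum>l\<in>J. q j * q' l * h (l + j))"
        unfolding J_def using j
        by (rule_tac sum_shifted_support[where g = "\<lambda>l. q j * q' l * h (l + j)"]) (auto simp: q'_def J_def a_def)
      then show "(\<Sum>\<tau>\<in>{- int m..int m}. q j * q' (\<tau> + (a - j)) * h (\<tau> + (a - j) + j)) = (\<Sum>l\<in>J. q j * q l * h (l + j))"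
        by (simp add: q'_def)
    qed
    finally show ?thesis .
  qed
  have mem: "\<phi> \<in> seqs_upto m"
    unfolding seqs_upto_def \<phi>_def by (auto intro!: sum.neutral simp: q'_def J_def a_def)
  moreover have "x = conv \<phi> (lag a x)" if x: "x \<in> V" for x
  proof
    fix t
    have "conv \<phi> (lag a x) t = (\<Sum>\<tau>\<in>{- int m..int m}. \<phi> \<tau> * x (t - (\<tau> + a)))"
      unfolding conv_eq_sum[OF mem] lag_def by (simp add: algebra_simps)
    also have "\<dots> = (\<Sum>j\<in>J. q j * (\<Sum>l\<in>J. q l * x (t - j - l)))"
      unfolding sum_\<phi>[of "\<lambda>u. x (t - u)"] sum_distrib_left by (intro sum.cong refl) (simp add: algebra_simps)
    also have "\<dots> = x t" unfolding rep[OF x, symmetric] ..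
    finally show "x t = conv \<phi> (lag a x) t" ..
  qed
  moreover have "l1_norm m (dft m \<phi>) \<le> sqrt (2 * real m + 1) * v"
  proof -
    define M where "M = 2 * real m + 1"
    have M: "M > 0" by (simp add: M_def)
    \<comment> \<open>Convolution becomes multiplication and the shift by \<open>a\<close> only a
      phase, so the spectrum of \<open>\<phi>\<close> is the squared spectrum of \<open>q\<close> in
      modulus, and its l1-norm is an energy.\<close>
    have "cmod (dft m \<phi> k) = (cmod (\<Sum>j\<in>J. dft_char m k j * q j))\<^sup>2 / sqrt M" for k
    proof -
      have "(\<Sum>\<tau>\<in>{- int m..int m}. dft_char m k \<tau> * \<phi> \<tau>)
          = (\<Sum>\<tau>\<in>{- int m..int m}. \<phi> \<tau> * dft_char m k (\<tau> + a)) * dft_char m k (- a)"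
        unfolding sum_distrib_right by (intro sum.cong refl) (simp add: dft_char_add[symmetric] mult_ac)
      also have "(\<Sum>\<tau>\<in>{- int m..int m}. \<phi> \<tau> * dft_char m k (\<tau> + a)) = (\<Sum>j\<in>J. dft_char m k j * q j)\<^sup>2"
        unfolding sum_\<phi> power2_eq_square sum_product
        by (intro sum.cong refl) (simp add: dft_char_add mult_ac)
      finally show ?thesis unfolding dft_def dft_char_def[symmetric] M_def[symmetric] using M
        by (simp add: norm_mult norm_divide norm_power)
    qed
    then have "l1_norm m (dft m \<phi>) = (\<Sum>k = 1..2 * m + 1. (cmod (\<Sum>j\<in>J. dft_char m k j * q j))\<^sup>2) / sqrt M"
      unfolding l1_norm_def sum_divide_distrib by simp
    also have "\<dots> = M * (\<Sum>j\<in>J. (cmod (q j))\<^sup>2) / sqrt M"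
      by (subst dft_parseval) (auto simp: J_def M_def)
    also have "\<dots> = sqrt M * (\<Sum>j\<in>J. (cmod (q j))\<^sup>2)"
      using M by (simp add: divide_simps)
    also have "\<dots> \<le> sqrt M * v" using norm M by (intro mult_left_mono) auto
    finally show ?thesis by (simp add: M_def)
  qed
  ultimately show ?thesis unfolding a_def by blast
qed

text \<open>The solution space is shift invariant, so moving \<open>t\<close> to position
  \<open>i\<close> turns reproduction at the single point \<open>i\<close> into a convolution valid
  at every \<open>t\<close>.\<close>

lemma kernel_row_filter:
  assumes k: "repr_kernel {0..int m} {x. seq_killed ws x} s k" and i: "i \<in> {0..int m}"
    and x: "seq_killed ws x"
  shows "x t = (\<Sum>j\<in>{i - int m..i}. k i (i - j) * x (t - j))"
proof -
  have "seq_killed ws (\<lambda>l. x (l - (i - t)))" by (rule seq_killed_shift[OF x])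
  from repr_kernel_reproduces[OF k _ i, OF CollectI, OF this]
  have "x t = (\<Sum>l\<in>{0..int m}. k i l * x (t + l - i))" by (simp add: algebra_simps)
  also have "\<dots> = (\<Sum>j\<in>{i - int m..i}. k i (i - j) * x (t - j))"
    by (rule sum.reindex_bij_witness[of _ "\<lambda>j. i - j" "\<lambda>l. i - l"]) (auto simp: algebra_simps)
  finally show ?thesis .
qed

text \<open>The lag \<open>2 i - m\<close> is \<open>- m\<close> for \<open>i = 0\<close> and
  \<open>m\<close> for \<open>i = m\<close>: the two endpoints of the window give the filters of the
  two ends.\<close>

lemma kernel_row_squared_filter:
  assumes k: "repr_kernel {0..int m} {x. seq_killed ws x} s k" and i: "i \<in> {0..int m}"
    and v: "Re (k i i) \<le> v"
  shows "\<exists>\<phi>\<in>seqs_upto m. (\<forall>x. seq_killed ws x \<longrightarrow> x = conv \<phi> (lag (2 * i - int m) x)) \<and>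
    l1_norm m (dft m \<phi>) \<le> sqrt (2 * real m + 1) * v"
proof -
  have "(\<Sum>j\<in>{i - int m..i}. (cmod (k i (i - j)))\<^sup>2) = (\<Sum>l\<in>{0..int m}. (cmod (k i l))\<^sup>2)"
    by (rule sum.reindex_bij_witness[of _ "\<lambda>l. i - l" "\<lambda>j. i - j"]) auto
  also have "\<dots> \<le> v" using repr_kernel_diag(1)[OF k i] v by simp
  finally have "(\<Sum>j\<in>{i - int m..i - int m + int m}. (cmod (k i (i - j)))\<^sup>2) \<le> v" by simp
  from squared_filter[of "{x. seq_killed ws x}", OF _ this] kernel_row_filter[OF k i]
  show ?thesis by (simp add: algebra_simps)
qed

text \<open>With \<open>m = 2 n\<close>, the trace bound yields some \<open>i\<close> in
  \<open>{0..n}\<close> with diagonal value at most \<open>s / (n + 1)\<close>. Its row lives in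
  \<open>{i - n..i}\<close>, hence in \<open>{- n..n}\<close>, so the square has no lag and fits
  into \<open>seqs_upto m\<close>. The constant comes from
  \<open>2 m + 1 = 4 n + 1 \<le> 4 (n + 1)\<close>.\<close>

lemma center_filter:
  assumes w: "\<And>w. w \<in> set ws \<Longrightarrow> cmod w = 1" and "even m"
  shows "\<exists>\<phi>\<in>seqs_upto m. (\<forall>x. seq_killed ws x \<longrightarrow> x = conv \<phi> (lag 0 x)) \<and>
    l1_norm m (dft m \<phi>) \<le> 4 * real (length ws) / sqrt (2 * real m + 1)"
proof -
  obtain n where n: "m = 2 * n" using \<open>even m\<close> by (auto elim: evenE)
  define s where "s = length ws"
  have "\<exists>k. repr_kernel {0..int n} {x. seq_killed ws x} (length ws) k"
    using w by (intro repr_kernel_exists) fastforce+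
  then obtain k where k: "repr_kernel {0..int n} {x. seq_killed ws x} (length ws) k" ..
  have "\<exists>i\<in>{0..int n}. Re (k i i) \<le> real s / real (Suc n)"
  proof (rule ccontr)
    assume "\<not> ?thesis"
    then have "(\<Sum>i\<in>{0..int n}. real s / real (Suc n)) < (\<Sum>i\<in>{0..int n}. Re (k i i))"
      by (intro sum_strict_mono) (auto simp: not_le)
    also have "(\<Sum>i\<in>{0..int n}. real s / real (Suc n)) = real s"
      by (simp add: field_simps)
    finally show False using repr_kernel_trace[OF k] by (simp add: s_def)
  qed
  then obtain i where i: "i \<in> {0..int n}" "Re (k i i) \<le> real s / real (Suc n)" ..
  define q where "q = (\<lambda>j. if j \<in> {i - int n..i} then k i (i - j) else 0)"
  have sub: "{i - int n..i} \<subseteq> {- int n..- int n + int m}" using i(1) n by auto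
  have "x t = (\<Sum>j\<in>{- int n..- int n + int m}. q j * x (t - j))" if "seq_killed ws x" for x t
  proof -
    have "x t = (\<Sum>j\<in>{i - int n..i}. q j * x (t - j))"
      using kernel_row_filter[OF k i(1) that, of t] by (simp add: q_def)
    also have "\<dots> = (\<Sum>j\<in>{- int n..- int n + int m}. q j * x (t - j))"
      using sub by (intro sum.mono_neutral_left) (auto simp: q_def)
    finally show ?thesis .
  qed
  moreover have "(\<Sum>j\<in>{- int n..- int n + int m}. (cmod (q j))\<^sup>2) \<le> real s / real (Suc n)"
  proof -
    have "(\<Sum>j\<in>{- int n..- int n + int m}. (cmod (q j))\<^sup>2) = (\<Sum>j\<in>{i - int n..i}. (cmod (k i (i - j)))\<^sup>2)"
      using sub by (intro sum.mono_neutral_cong_right) (auto simp: q_def)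
    also have "\<dots> = (\<Sum>l\<in>{0..int n}. (cmod (k i l))\<^sup>2)"
      by (rule sum.reindex_bij_witness[of _ "\<lambda>l. i - l" "\<lambda>j. i - j"]) auto
    finally show ?thesis using repr_kernel_diag(1)[OF k i(1)] i(2) by simp
  qed
  ultimately have "\<exists>\<phi>\<in>seqs_upto m. (\<forall>x\<in>{x. seq_killed ws x}. x = conv \<phi> (lag (2 * - int n + int m) x)) \<and>
      l1_norm m (dft m \<phi>) \<le> sqrt (2 * real m + 1) * (real s / real (Suc n))"
    by (intro squared_filter[where q = q]) auto
  moreover have "2 * - int n + int m = 0" using n by simp
  ultimately obtain \<phi> where \<phi>: "\<phi> \<in> seqs_upto m" "\<forall>x. seq_killed ws x \<longrightarrow> x = conv \<phi> (lag 0 x)"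
    "l1_norm m (dft m \<phi>) \<le> sqrt (2 * real m + 1) * (real s / real (Suc n))"
    unfolding mem_Collect_eq Ball_def by metis
  note \<phi>(3)
  also have "sqrt (2 * real m + 1) * (real s / real (Suc n)) \<le> 4 * real s / sqrt (2 * real m + 1)"
  proof -
    have "sqrt (2 * real m + 1) * (real s / real (Suc n)) * sqrt (2 * real m + 1) = (2 * real m + 1) * (real s / real (Suc n))"
      by simp
    also have "\<dots> \<le> (4 * real (Suc n)) * (real s / real (Suc n))"
      by (intro mult_right_mono) (auto simp: n)
    also have "\<dots> = 4 * real s" by (simp del: of_nat_Suc)
    finally show ?thesis by (simp add: pos_le_divide_eq)
  qed
  finally show ?thesis using \<phi> s_def by blast
qed

text \<open>The kernel column of an endpoint is itself a solution, and its energy on the window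
  equals its endpoint value. The window bound applied to it is therefore a quadratic inequality for
  that value. The constant \<open>160\<close> is \<open>2 * 80\<close>, from
  \<open>2 m + 1 \<le> 2 (m + 1)\<close>.\<close>

lemma end_filter:
  assumes w: "\<And>w. w \<in> set ws \<Longrightarrow> cmod w = 1" and s: "s = length ws" "s \<ge> 1" "4 * s \<le> Suc m"
    and a: "a = int m \<or> a = - int m"
  shows "\<exists>\<phi>\<in>seqs_upto m. (\<forall>x. seq_killed ws x \<longrightarrow> x = conv \<phi> (lag a x)) \<and>
    l1_norm m (dft m \<phi>) \<le> 160 * (real s)\<^sup>2 / sqrt (2 * real m + 1)"
proof -
  have "\<exists>k. repr_kernel {0..int m} {x. seq_killed ws x} (length ws) k"
    using w by (intro repr_kernel_exists) fastforce+
  then obtain k where k: "repr_kernel {0..int m} {x. seq_killed ws x} (length ws) k" ..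
  define i where "i = (if a = int m then int m else 0)"
  have i: "i \<in> {0..int m}" "2 * i - int m = a" using a by (auto simp: i_def)
  define \<kappa> where "\<kappa> = Re (k i i)"
  define c where "c = 80 * (real s)\<^sup>2 / real (Suc m)"
  have col: "seq_killed ws (\<lambda>l. k l i)" using repr_kernel_column[OF k i(1)] by simp
  \<comment> \<open>The left endpoint is read forward, the right endpoint backward with conjugated
    roots.\<close>
  have "(cmod (k i i))\<^sup>2 \<le> c * (\<Sum>l\<in>{0..int m}. (cmod (k l i))\<^sup>2)"
  proof (cases "i = 0")
    case True
    from rec_killed_window_bound[OF seq_killed_forward[OF col, of i] w s]
    have "(cmod (k i i))\<^sup>2 \<le> c * (\<Sum>j<Suc m. (cmod (k (i + int j) i))\<^sup>2)" by (simp add: c_def)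
    also have "(\<Sum>j<Suc m. (cmod (k (i + int j) i))\<^sup>2) = (\<Sum>l\<in>{0..int m}. (cmod (k l i))\<^sup>2)"
      by (rule sum.reindex_bij_witness[of _ "\<lambda>l. nat l" "\<lambda>j. int j"]) (use True in auto)
    finally show ?thesis .
  next
    case False
    then have im: "i = int m" by (simp add: i_def split: if_splits)
    have "cmod w = 1" if "w \<in> set (map cnj ws)" for w using that w by auto
    from rec_killed_window_bound[OF seq_killed_backward[OF w col, of i] this _ s(2,3)] s(1)
    have "(cmod (k i i))\<^sup>2 \<le> c * (\<Sum>j<Suc m. (cmod (k (i - int j) i))\<^sup>2)" by (simp add: c_def)
    also have "(\<Sum>j<Suc m. (cmod (k (i - int j) i))\<^sup>2) = (\<Sum>l\<in>{0..int m}. (cmod (k l i))\<^sup>2)"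
      by (rule sum.reindex_bij_witness[of _ "\<lambda>l. nat (int m - l)" "\<lambda>j. int m - int j"]) (use im in auto)
    finally show ?thesis .
  qed
  moreover have "cmod (k i i) = \<kappa>" and pos: "\<kappa> \<ge> 0"
    using repr_kernel_diag(3,4)[OF k i(1)] unfolding \<kappa>_def by (metis norm_of_real abs_of_nonneg, blast)
  ultimately have "\<kappa>\<^sup>2 \<le> c * \<kappa>" using repr_kernel_diag(2)[OF k i(1)] by (simp add: \<kappa>_def)
  then have "\<kappa> * \<kappa> \<le> c * \<kappa>" by (simp add: power2_eq_square)
  moreover have "0 \<le> c" by (simp add: c_def)
  ultimately have "\<kappa> \<le> c" using pos by (metis mult_right_le_imp_le order_le_less)
  then have "Re (k i i) \<le> c" by (simp add: \<kappa>_def)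
  from kernel_row_squared_filter[OF k i(1) this]
  obtain \<phi> where \<phi>: "\<phi> \<in> seqs_upto m" "\<forall>x. seq_killed ws x \<longrightarrow> x = conv \<phi> (lag a x)"
    "l1_norm m (dft m \<phi>) \<le> sqrt (2 * real m + 1) * c" unfolding i(2) by blast
  note \<phi>(3)
  also have "sqrt (2 * real m + 1) * c \<le> 160 * (real s)\<^sup>2 / sqrt (2 * real m + 1)"
  proof -
    have "sqrt (2 * real m + 1) * c * sqrt (2 * real m + 1) = (2 * real m + 1) * c" by simp
    also have "\<dots> \<le> 160 * (real s)\<^sup>2" by (simp add: c_def divide_simps algebra_simps)
    finally show ?thesis by (simp add: pos_le_divide_eq)
  qed
  finally show ?thesis using \<phi> by blast
qed

section \<open>Exponential moments of complex Gaussian forms\<close>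

lemma sets_std_complex_normal [measurable_cong, simp]: "sets std_complex_normal = sets borel"
  by (simp add: std_complex_normal_def)

lemma space_std_complex_normal [simp]: "space std_complex_normal = UNIV"
  by (simp add: std_complex_normal_def)

lemma measurable_Complex [measurable]:
  assumes [measurable]: "f \<in> borel_measurable M" "g \<in> borel_measurable M"
  shows "(\<lambda>x. Complex (f x) (g x)) \<in> borel_measurable M"
  unfolding Complex_eq by measurable

lemma prob_space_std_complex_normal: "prob_space std_complex_normal"
proof -
  interpret N: prob_space "density lborel std_normal_density"
    by (rule prob_space_normal_density) simp
  interpret pair_prob_space "density lborel std_normal_density" "density lborel std_normal_density" ..
  show ?thesis unfolding std_complex_normal_def
    by (rule prob_space_distr) measurable
qed

lemma nn_integral_std_complex_normal_prod:
  assumes [measurable]: "f \<in> borel_measurable borel" "g \<in> borel_measurable borel"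
  shows "(\<integral>\<^sup>+z. f (Re z) * g (Im z) \<partial>std_complex_normal)
    = (\<integral>\<^sup>+u. f u \<partial>density lborel std_normal_density) * (\<integral>\<^sup>+u. g u \<partial>density lborel std_normal_density)"
proof -
  let ?D = "density lborel (\<lambda>x. ennreal (std_normal_density x))"
  interpret N: prob_space ?D
    by (rule prob_space_normal_density) simp
  have "(\<integral>\<^sup>+z. f (Re z) * g (Im z) \<partial>std_complex_normal) = (\<integral>\<^sup>+w. f (fst w) * g (snd w) \<partial>(?D \<Otimes>\<^sub>M ?D))"
    unfolding std_complex_normal_def by (subst nn_integral_distr) (auto simp: case_prod_beta)
  also have "\<dots> = (\<integral>\<^sup>+u. \<integral>\<^sup>+v. f u * g v \<partial>?D \<partial>?D)"
    by (subst N.nn_integral_fst[symmetric]) auto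
  also have "\<dots> = (\<integral>\<^sup>+u. f u * (\<integral>\<^sup>+v. g v \<partial>?D) \<partial>?D)"
    by (intro nn_integral_cong nn_integral_cmult) auto
  also have "\<dots> = (\<integral>\<^sup>+u. f u \<partial>?D) * (\<integral>\<^sup>+u. g u \<partial>?D)"
    by (subst nn_integral_multc) auto
  finally show ?thesis .
qed

lemma nn_integral_normal_density:
  "0 < \<sigma> \<Longrightarrow> (\<integral>\<^sup>+x. ennreal (normal_density \<mu> \<sigma> x) \<partial>lborel) = 1"
  using prob_space.emeasure_space_1[OF prob_space_normal_density[of \<sigma> \<mu>]]
  by (simp add: emeasure_density)

lemma std_normal_exp_linear:
  "(\<integral>\<^sup>+u. ennreal (exp (p * u)) \<partial>density lborel std_normal_density) = ennreal (exp (p\<^sup>2 / 2))"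
proof -
  have "(\<integral>\<^sup>+u. ennreal (exp (p * u)) \<partial>density lborel std_normal_density)
      = (\<integral>\<^sup>+u. ennreal (exp (p\<^sup>2 / 2)) * ennreal (normal_density p 1 u) \<partial>lborel)"
    by (subst nn_integral_density)
      (auto intro!: nn_integral_cong simp: ennreal_mult[symmetric] normal_density_def mult_exp_exp
        power2_diff field_simps)
  also have "\<dots> = ennreal (exp (p\<^sup>2 / 2))"
    by (subst nn_integral_cmult) (auto simp: nn_integral_normal_density)
  finally show ?thesis .
qed

text \<open>The integrand is \<open>sqrt 2\<close> times a normal density of variance
  \<open>2\<close>. With the exponent \<open>1 / 4\<close> the complex version has the value
  \<open>2\<close>, the bound that all later moment estimates reproduce.\<close>

lemma std_normal_exp_square:
  "(\<integral>\<^sup>+u. ennreal (exp (u\<^sup>2 / 4)) \<partial>density lborel std_normal_density) = ennreal (sqrt 2)"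
proof -
  have "(\<integral>\<^sup>+u. ennreal (exp (u\<^sup>2 / 4)) \<partial>density lborel std_normal_density)
      = (\<integral>\<^sup>+u. ennreal (sqrt 2) * ennreal (normal_density 0 (sqrt 2) u) \<partial>lborel)"
    by (subst nn_integral_density)
      (auto intro!: nn_integral_cong simp: ennreal_mult[symmetric] normal_density_def mult_exp_exp
        real_sqrt_mult field_simps)
  also have "\<dots> = ennreal (sqrt 2)"
    by (subst nn_integral_cmult) (auto simp: nn_integral_normal_density)
  finally show ?thesis .
qed

lemma std_complex_normal_exp_linear:
  "(\<integral>\<^sup>+z. ennreal (exp (Re (c * z))) \<partial>std_complex_normal) = ennreal (exp ((cmod c)\<^sup>2 / 2))"
proof -
  have "(\<integral>\<^sup>+z. ennreal (exp (Re (c * z))) \<partial>std_complex_normal)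
      = (\<integral>\<^sup>+z. ennreal (exp (Re c * Re z)) * ennreal (exp (- Im c * Im z)) \<partial>std_complex_normal)"
    by (intro nn_integral_cong) (simp add: ennreal_mult[symmetric] mult_exp_exp)
  also have "\<dots> = ennreal (exp ((Re c)\<^sup>2 / 2)) * ennreal (exp ((- Im c)\<^sup>2 / 2))"
    by (subst nn_integral_std_complex_normal_prod)
      (use std_normal_exp_linear[of "- Im c"] in \<open>auto simp: std_normal_exp_linear\<close>)
  also have "\<dots> = ennreal (exp ((cmod c)\<^sup>2 / 2))"
    by (simp add: ennreal_mult[symmetric] mult_exp_exp cmod_power2 add_divide_distrib)
  finally show ?thesis .
qed

lemma std_complex_normal_exp_square:
  "(\<integral>\<^sup>+z. ennreal (exp ((cmod z)\<^sup>2 / 4)) \<partial>std_complex_normal) = 2"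
proof -
  have "(\<integral>\<^sup>+z. ennreal (exp ((cmod z)\<^sup>2 / 4)) \<partial>std_complex_normal)
      = (\<integral>\<^sup>+z. ennreal (exp ((Re z)\<^sup>2 / 4)) * ennreal (exp ((Im z)\<^sup>2 / 4)) \<partial>std_complex_normal)"
    by (intro nn_integral_cong) (simp add: ennreal_mult[symmetric] mult_exp_exp cmod_power2 add_divide_distrib)
  also have "\<dots> = ennreal (sqrt 2) * ennreal (sqrt 2)"
    by (subst nn_integral_std_complex_normal_prod) (auto simp: std_normal_exp_square)
  also have "\<dots> = 2" by (simp add: ennreal_mult[symmetric])
  finally show ?thesis .
qed

abbreviation cgauss :: "'i set \<Rightarrow> ('i \<Rightarrow> complex) measure" where
  "cgauss I \<equiv> \<Pi>\<^sub>M i\<in>I. std_complex_normal"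

interpretation cgauss: product_prob_space "\<lambda>_. std_complex_normal" I for I
  by (intro product_prob_spaceI prob_space_std_complex_normal)

lemma prob_space_cgauss: "prob_space (cgauss I)"
  by (rule cgauss.prob_space_axioms)

lemma measurable_coordinate:
  assumes "t \<in> I"
  shows "(\<lambda>\<zeta>. \<zeta> t) \<in> borel_measurable (cgauss I)"
    and "(\<lambda>\<zeta>. cnj (\<zeta> t)) \<in> borel_measurable (cgauss I)"
proof -
  have "(\<lambda>\<zeta>. \<zeta> t) \<in> measurable (cgauss I) std_complex_normal"
    by (rule measurable_component_singleton[OF assms])
  then show 1: "(\<lambda>\<zeta>. \<zeta> t) \<in> borel_measurable (cgauss I)"
    by (simp add: measurable_cong_sets[OF refl sets_std_complex_normal])
  have "cnj \<in> borel_measurable borel"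
    by (intro borel_measurable_continuous_onI continuous_intros)
  from measurable_compose[OF 1 this] show "(\<lambda>\<zeta>. cnj (\<zeta> t)) \<in> borel_measurable (cgauss I)" .
qed

lemma measurable_quadratic_form:
  assumes "S \<subseteq> I" "\<And>t. T t \<subseteq> I"
  shows "(\<lambda>\<zeta>. Re (\<Sum>t\<in>S. \<Sum>u\<in>T t. A t u * (cnj (\<zeta> t) * \<zeta> u))) \<in> borel_measurable (cgauss I)"
proof -
  have "Re \<in> borel_measurable borel"
    by (intro borel_measurable_continuous_onI continuous_intros)
  moreover have "(\<lambda>\<zeta>. \<Sum>t\<in>S. \<Sum>u\<in>T t. A t u * (cnj (\<zeta> t) * \<zeta> u)) \<in> borel_measurable (cgauss I)"
    using assms by (intro borel_measurable_sum borel_measurable_times borel_measurable_const measurable_coordinate) auto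
  ultimately show ?thesis by (rule measurable_compose[rotated])
qed

lemma measurable_linear_form [measurable]:
  "J \<subseteq> I \<Longrightarrow> (\<lambda>\<zeta>. \<Sum>u\<in>J. c u * \<zeta> u) \<in> borel_measurable (cgauss I)"
  by (intro borel_measurable_sum borel_measurable_times borel_measurable_const
      measurable_compose[OF measurable_component_singleton]) (auto intro: measurable_ident_sets)

lemma cgauss_exp_linear:
  assumes "finite I"
  shows "(\<integral>\<^sup>+\<zeta>. ennreal (exp (Re (\<Sum>u\<in>I. c u * \<zeta> u))) \<partial>cgauss I) = ennreal (exp ((\<Sum>u\<in>I. (cmod (c u))\<^sup>2) / 2))"
proof -
  have "(\<integral>\<^sup>+\<zeta>. ennreal (exp (Re (\<Sum>u\<in>I. c u * \<zeta> u))) \<partial>cgauss I)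
      = (\<integral>\<^sup>+\<zeta>. (\<Prod>u\<in>I. ennreal (exp (Re (c u * \<zeta> u)))) \<partial>cgauss I)"
    using assms by (intro nn_integral_cong) (simp only: Re_sum exp_sum prod_ennreal exp_ge_zero)
  also have "\<dots> = (\<Prod>u\<in>I. ennreal (exp ((cmod (c u))\<^sup>2 / 2)))"
    using assms by (subst cgauss.product_nn_integral_prod) (auto simp only: std_complex_normal_exp_linear, measurable)
  also have "\<dots> = ennreal (exp ((\<Sum>u\<in>I. (cmod (c u))\<^sup>2) / 2))"
    using assms by (simp add: prod_ennreal exp_sum[symmetric] sum_divide_distrib)
  finally show ?thesis .
qed

text \<open>Writing \<open>exp (|w|\<^sup>2)\<close> as a Gaussian average of exponentials linear in \<open>w\<close> reduces this to the
  previous lemma.\<close>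

lemma cgauss_exp_square:
  assumes I: "finite I" and v: "(\<Sum>u\<in>I. (cmod (c u))\<^sup>2) \<le> v" "0 < v"
  shows "(\<integral>\<^sup>+\<zeta>. ennreal (exp ((cmod (\<Sum>u\<in>I. c u * \<zeta> u))\<^sup>2 / (4 * v))) \<partial>cgauss I) \<le> 2"
proof -
  \<comment> \<open>Scaled so that averaging \<open>exp (Re (r * w * z))\<close> over
    \<open>z\<close> gives exactly \<open>exp ((cmod w)^2 / (4 v))\<close>.\<close>
  define r where "r = complex_of_real (1 / sqrt (2 * v))"
  have r: "(cmod r)\<^sup>2 = 1 / (2 * v)" using v by (simp add: r_def power_divide norm_divide)
  interpret N: prob_space std_complex_normal by (rule prob_space_std_complex_normal)
  interpret G: prob_space "cgauss I" by (rule prob_space_cgauss)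
  interpret P: pair_sigma_finite "cgauss I" std_complex_normal ..
  have lin [measurable]: "(\<lambda>\<zeta>. \<Sum>u\<in>I. c u * \<zeta> u) \<in> borel_measurable (cgauss I)" by (rule measurable_linear_form) simp
  have "(\<integral>\<^sup>+\<zeta>. ennreal (exp ((cmod (\<Sum>u\<in>I. c u * \<zeta> u))\<^sup>2 / (4 * v))) \<partial>cgauss I)
      = (\<integral>\<^sup>+\<zeta>. \<integral>\<^sup>+z. ennreal (exp (Re ((r * (\<Sum>u\<in>I. c u * \<zeta> u)) * z))) \<partial>std_complex_normal \<partial>cgauss I)"
    unfolding std_complex_normal_exp_linear norm_mult power_mult_distrib r by simp
  also have "\<dots> = (\<integral>\<^sup>+z. \<integral>\<^sup>+\<zeta>. ennreal (exp (Re ((r * (\<Sum>u\<in>I. c u * \<zeta> u)) * z))) \<partial>cgauss I \<partial>std_complex_normal)"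
    by (rule P.Fubini'[symmetric]) measurable
  also have "\<dots> = (\<integral>\<^sup>+z. \<integral>\<^sup>+\<zeta>. ennreal (exp (Re (\<Sum>u\<in>I. (r * z * c u) * \<zeta> u))) \<partial>cgauss I \<partial>std_complex_normal)"
    by (simp add: sum_distrib_left mult_ac)
  also have "\<dots> = (\<integral>\<^sup>+z. ennreal (exp ((\<Sum>u\<in>I. (cmod (c u))\<^sup>2) * (cmod z)\<^sup>2 / (4 * v))) \<partial>std_complex_normal)"
    unfolding cgauss_exp_linear[OF I] norm_mult power_mult_distrib r
    by (intro nn_integral_cong) (simp add: sum_distrib_left sum_divide_distrib mult_ac)
  also have "\<dots> \<le> (\<integral>\<^sup>+z. ennreal (exp ((cmod z)\<^sup>2 / 4)) \<partial>std_complex_normal)"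
  proof (intro nn_integral_mono ennreal_leI, subst exp_le_cancel_iff)
    fix z
    have "(\<Sum>u\<in>I. (cmod (c u))\<^sup>2) * (cmod z)\<^sup>2 \<le> v * (cmod z)\<^sup>2" using v by (intro mult_right_mono) auto
    then show "(\<Sum>u\<in>I. (cmod (c u))\<^sup>2) * (cmod z)\<^sup>2 / (4 * v) \<le> (cmod z)\<^sup>2 / 4"
      using v by (simp add: field_simps)
  qed
  finally show ?thesis by (simp add: std_complex_normal_exp_square)
qed

lemma exp_convex_combination:
  assumes "finite T" "\<And>t. t \<in> T \<Longrightarrow> 0 \<le> p t" "(\<Sum>t\<in>T. p t) = 1"
  shows "exp (\<Sum>t\<in>T. p t * x t) \<le> (\<Sum>t\<in>T. p t * exp (x t :: real))"
proof -
  have "convex_on UNIV (exp :: real \<Rightarrow> real)"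
    by (rule convex_on_realI[where f' = exp]) (auto intro: DERIV_exp)
  then show ?thesis
    using convex_on_sum[of T UNIV exp p x] assms by (cases "T = {}") auto
qed

text \<open>Jensen's inequality with weights proportional to the variances \<open>v t\<close>
  reduces the sum to single squares, whatever the correlations between the rows.\<close>

lemma cgauss_exp_sum_square:
  assumes I: "finite I" and T: "finite T" and V: "(\<Sum>t\<in>T. \<Sum>u\<in>I. (cmod (c t u))\<^sup>2) \<le> V" "0 < V"
  shows "(\<integral>\<^sup>+\<zeta>. ennreal (exp ((\<Sum>t\<in>T. (cmod (\<Sum>u\<in>I. c t u * \<zeta> u))\<^sup>2) / (4 * V))) \<partial>cgauss I) \<le> 2"
proof -
  define v where "v = (\<lambda>t. \<Sum>u\<in>I. (cmod (c t u))\<^sup>2)"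
  define V' where "V' = (\<Sum>t\<in>T. v t)"
  define X where "X = (\<lambda>t \<zeta>. (cmod (\<Sum>u\<in>I. c t u * \<zeta> u))\<^sup>2)"
  have v0: "v t \<ge> 0" for t by (simp add: v_def sum_nonneg)
  have X0: "X t \<zeta> \<ge> 0" for t \<zeta> by (simp add: X_def)
  have Xv: "X t \<zeta> = 0" if "v t = 0" for t \<zeta>
    using that I by (simp add: v_def X_def sum_nonneg_eq_0_iff)
  have V': "0 \<le> V'" "V' \<le> V" using V v0 by (auto simp: V'_def v_def sum_nonneg)
  show ?thesis
  proof (cases "V' = 0")
    case True
    then have "\<And>t. t \<in> T \<Longrightarrow> v t = 0" using T v0 by (simp add: V'_def sum_nonneg_eq_0_iff)
    then have "(\<Sum>t\<in>T. (cmod (\<Sum>u\<in>I. c t u * \<zeta> u))\<^sup>2) = 0" for \<zeta>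
      using Xv by (intro sum.neutral) (auto simp: X_def)
    then show ?thesis by (simp add: prob_space.emeasure_space_1[OF prob_space_cgauss])
  next
    case False
    then have pos: "V' > 0" using V' by simp
    define p where "p = (\<lambda>t. v t / V')"
    have p: "(\<Sum>t\<in>T. p t) = 1" "\<And>t. p t \<ge> 0"
      using pos v0 by (auto simp: p_def V'_def[symmetric] sum_divide_distrib[symmetric])
    have m [measurable]: "X t \<in> borel_measurable (cgauss I)" for t
      unfolding X_def by (intro borel_measurable_power borel_measurable_norm measurable_compose[OF measurable_linear_form borel_measurable_norm]) auto
    have le: "exp ((\<Sum>t\<in>T. X t \<zeta>) / (4 * V)) \<le> (\<Sum>t\<in>T. p t * exp (X t \<zeta> / (4 * v t)))" for \<zeta>
    proof -
      have "(\<Sum>t\<in>T. X t \<zeta>) / (4 * V) \<le> (\<Sum>t\<in>T. X t \<zeta>) / (4 * V')"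
        using V' pos X0 by (intro divide_left_mono) (auto simp: sum_nonneg)
      also have "\<dots> = (\<Sum>t\<in>T. p t * (X t \<zeta> / (4 * v t)))"
        unfolding sum_divide_distrib p_def by (intro sum.cong refl) (use Xv in \<open>auto simp: divide_simps\<close>)
      finally have "exp ((\<Sum>t\<in>T. X t \<zeta>) / (4 * V)) \<le> exp (\<Sum>t\<in>T. p t * (X t \<zeta> / (4 * v t)))" by simp
      also have "\<dots> \<le> (\<Sum>t\<in>T. p t * exp (X t \<zeta> / (4 * v t)))"
        by (rule exp_convex_combination) (use T p in auto)
      finally show ?thesis .
    qed
    have "(\<integral>\<^sup>+\<zeta>. ennreal (exp ((\<Sum>t\<in>T. X t \<zeta>) / (4 * V))) \<partial>cgauss I)
        \<le> (\<integral>\<^sup>+\<zeta>. (\<Sum>t\<in>T. ennreal (p t) * ennreal (exp (X t \<zeta> / (4 * v t)))) \<partial>cgauss I)"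
    proof (rule nn_integral_mono)
      fix \<zeta>
      have "(\<Sum>t\<in>T. ennreal (p t) * ennreal (exp (X t \<zeta> / (4 * v t)))) = ennreal (\<Sum>t\<in>T. p t * exp (X t \<zeta> / (4 * v t)))"
        using p by (simp add: ennreal_mult[symmetric])
      then show "ennreal (exp ((\<Sum>t\<in>T. X t \<zeta>) / (4 * V))) \<le> (\<Sum>t\<in>T. ennreal (p t) * ennreal (exp (X t \<zeta> / (4 * v t))))"
        using le[of \<zeta>] by (simp add: ennreal_leI)
    qed
    also have "\<dots> = (\<Sum>t\<in>T. ennreal (p t) * (\<integral>\<^sup>+\<zeta>. ennreal (exp (X t \<zeta> / (4 * v t))) \<partial>cgauss I))"
      by (subst nn_integral_sum) (auto intro!: sum.cong nn_integral_cmult)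
    also have "\<dots> \<le> (\<Sum>t\<in>T. ennreal (p t) * 2)"
    proof (intro sum_mono mult_left_mono)
      fix t
      show "(\<integral>\<^sup>+\<zeta>. ennreal (exp (X t \<zeta> / (4 * v t))) \<partial>cgauss I) \<le> 2"
      proof (cases "v t = 0")
        \<comment> \<open>The exponent is divided by \<open>v t = 0\<close> and hence equals
          \<open>0\<close>; the integrand is the constant \<open>1\<close>.\<close>
        case True then show ?thesis by (simp add: prob_space.emeasure_space_1[OF prob_space_cgauss])
      next
        case False
        then show ?thesis unfolding X_def using v0[of t] by (intro cgauss_exp_square I) (auto simp: v_def)
      qed
    qed auto
    also have "\<dots> = ennreal (\<Sum>t\<in>T. p t) * 2"
      using p by (simp add: sum_distrib_right[symmetric])
    finally show ?thesis using p by (simp add: X_def)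
  qed
qed

lemma card_separating_subsets:
  assumes "finite I" "t \<in> I" "u \<in> I" "t \<noteq> u"
  shows "4 * card {S \<in> Pow I. t \<in> S \<and> u \<notin> S} = 2 ^ card I"
proof -
  have "bij_betw (insert t) (Pow (I - {t, u})) {S \<in> Pow I. t \<in> S \<and> u \<notin> S}"
    using assms by (intro bij_betw_byWitness[where f' = "\<lambda>S. S - {t}"]) auto
  from bij_betw_same_card[OF this] have "card {S \<in> Pow I. t \<in> S \<and> u \<notin> S} = 2 ^ card (I - {t, u})"
    unfolding card_Pow[OF finite_Diff[OF assms(1)]] by (rule sym)
  moreover have "card I = card (I - {t, u}) + 2"
    using assms card_Diff_subset[of "{t, u}" I] card_mono[of I "{t, u}"] by auto
  ultimately show ?thesis by (simp add: power_add)
qed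

text \<open>Decoupling: the off-diagonal form is four times the average, over all splittings of the index
  set into \<open>S\<close> and its complement, of the part linear in both halves.\<close>

lemma quadratic_form_decouple:
  fixes b :: "'i \<Rightarrow> 'i \<Rightarrow> complex"
  assumes I: "finite I" and diag: "\<And>t. t \<in> I \<Longrightarrow> b t t = 0"
  shows "(\<Sum>S\<in>Pow I. \<Sum>t\<in>S. \<Sum>u\<in>I - S. b t u) = of_nat (2 ^ card I) / 4 * (\<Sum>t\<in>I. \<Sum>u\<in>I. b t u)"
proof -
  have "(\<Sum>t\<in>S. \<Sum>u\<in>I - S. b t u) = (\<Sum>t\<in>I. \<Sum>u\<in>I. if t \<in> S \<and> u \<notin> S then b t u else 0)" if "S \<in> Pow I" for S
  proof -
    have "(\<Sum>t\<in>S. \<Sum>u\<in>I - S. b t u) = (\<Sum>t\<in>I. if t \<in> S then \<Sum>u\<in>I - S. b t u else 0)"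
      using that I by (intro sum.mono_neutral_cong_left) auto
    also have "\<dots> = (\<Sum>t\<in>I. \<Sum>u\<in>I. if t \<in> S \<and> u \<notin> S then b t u else 0)"
      using that I by (intro sum.cong refl) (auto intro!: sum.mono_neutral_cong_left)
    finally show ?thesis .
  qed
  then have "(\<Sum>S\<in>Pow I. \<Sum>t\<in>S. \<Sum>u\<in>I - S. b t u)
      = (\<Sum>S\<in>Pow I. \<Sum>t\<in>I. \<Sum>u\<in>I. if t \<in> S \<and> u \<notin> S then b t u else 0)"
    by (rule sum.cong[OF refl])
  also have "\<dots> = (\<Sum>t\<in>I. \<Sum>u\<in>I. \<Sum>S\<in>Pow I. if t \<in> S \<and> u \<notin> S then b t u else 0)"
    by (subst sum.swap, rule sum.cong[OF refl], rule sum.swap)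
  also have "\<dots> = (\<Sum>t\<in>I. \<Sum>u\<in>I. of_nat (2 ^ card I) / 4 * b t u)"
  proof (rule sum.cong[OF refl], rule sum.cong[OF refl])
    fix t u assume tu: "t \<in> I" "u \<in> I"
    have "(\<Sum>S\<in>Pow I. if t \<in> S \<and> u \<notin> S then b t u else 0) = of_nat (card {S \<in> Pow I. t \<in> S \<and> u \<notin> S}) * b t u"
      using I by (simp add: sum.If_cases Int_def)
    also have "\<dots> = of_nat (2 ^ card I) / 4 * b t u"
    proof (cases "t = u")
      case False
      have "(of_nat (2 ^ card I) :: complex) = 4 * of_nat (card {S \<in> Pow I. t \<in> S \<and> u \<notin> S})"
        unfolding card_separating_subsets[OF I tu False, symmetric] by simp
      then show ?thesis by simp
    qed (use diag tu in auto)
    finally show "(\<Sum>S\<in>Pow I. if t \<in> S \<and> u \<notin> S then b t u else 0) = of_nat (2 ^ card I) / 4 * b t u" .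
  qed
  also have "\<dots> = of_nat (2 ^ card I) / 4 * (\<Sum>t\<in>I. \<Sum>u\<in>I. b t u)"
    by (simp add: sum_distrib_left)
  finally show ?thesis .
qed

text \<open>With the coordinates outside \<open>S\<close> fixed, the exponent is linear in those of
  \<open>S\<close>. Integrating these out leaves a sum of squares with factor
  \<open>(4 \<theta>)^2 / 2 = 8 \<theta>^2\<close>, which the condition on \<open>\<theta>\<close>
  brings within reach of \<open>cgauss_exp_sum_square\<close>.\<close>

lemma cgauss_exp_bilinear:
  assumes I: "finite I" and S: "S \<subseteq> I" and V: "(\<Sum>t\<in>I. \<Sum>u\<in>I. (cmod (A t u))\<^sup>2) \<le> V" "0 < V"
    and \<theta>: "8 * \<theta>\<^sup>2 \<le> 1 / (4 * V)"
  shows "(\<integral>\<^sup>+\<zeta>. ennreal (exp (4 * \<theta> * Re (\<Sum>t\<in>S. \<Sum>u\<in>I - S. A t u * (cnj (\<zeta> t) * \<zeta> u)))) \<partial>cgauss I) \<le> 2"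
proof -
  let ?J = "I - S"
  have fin: "finite S" "finite ?J" using I S finite_subset by auto
  have IJ: "I = ?J \<union> S" using S by auto
  have [measurable]: "(\<lambda>\<zeta>. Re (\<Sum>t\<in>S. \<Sum>u\<in>I - S. A t u * (cnj (\<zeta> t) * \<zeta> u))) \<in> borel_measurable (cgauss I)"
    using S by (intro measurable_quadratic_form) auto
  have m: "(\<lambda>\<zeta>. ennreal (exp (4 * \<theta> * Re (\<Sum>t\<in>S. \<Sum>u\<in>I - S. A t u * (cnj (\<zeta> t) * \<zeta> u))))) \<in> borel_measurable (cgauss I)"
    by measurable
  have "(\<integral>\<^sup>+\<zeta>. ennreal (exp (4 * \<theta> * Re (\<Sum>t\<in>S. \<Sum>u\<in>I - S. A t u * (cnj (\<zeta> t) * \<zeta> u)))) \<partial>cgauss I)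
      = (\<integral>\<^sup>+x. \<integral>\<^sup>+y. ennreal (exp (4 * \<theta> * Re (\<Sum>t\<in>S. \<Sum>u\<in>I - S. A t u * (cnj (merge ?J S (x, y) t) * merge ?J S (x, y) u))))
          \<partial>cgauss S \<partial>cgauss ?J)"
    using cgauss.product_nn_integral_fold[of ?J S "\<lambda>\<zeta>. ennreal (exp (4 * \<theta> * Re (\<Sum>t\<in>S. \<Sum>u\<in>I - S. A t u * (cnj (\<zeta> t) * \<zeta> u))))"]
      fin m unfolding IJ[symmetric] by auto
  also have "\<dots> = (\<integral>\<^sup>+x. \<integral>\<^sup>+y. ennreal (exp (Re (\<Sum>t\<in>S. (4 * \<theta> * cnj (\<Sum>u\<in>?J. A t u * x u)) * y t))) \<partial>cgauss S \<partial>cgauss ?J)"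
  proof (intro nn_integral_cong, rule arg_cong[where f = "\<lambda>z. ennreal (exp z)"])
    fix x y
    have "(\<Sum>t\<in>S. \<Sum>u\<in>I - S. A t u * (cnj (merge ?J S (x, y) t) * merge ?J S (x, y) u))
        = (\<Sum>t\<in>S. cnj (y t) * (\<Sum>u\<in>?J. A t u * x u))"
      unfolding sum_distrib_left by (intro sum.cong refl) (auto simp: merge_def)
    also have "\<dots> = cnj (\<Sum>t\<in>S. cnj (\<Sum>u\<in>?J. A t u * x u) * y t)"
      by (simp add: mult.commute)
    finally show "4 * \<theta> * Re (\<Sum>t\<in>S. \<Sum>u\<in>I - S. A t u * (cnj (merge ?J S (x, y) t) * merge ?J S (x, y) u))
        = Re (\<Sum>t\<in>S. (4 * \<theta> * cnj (\<Sum>u\<in>?J. A t u * x u)) * y t)"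
      by (simp add: sum_distrib_left mult.assoc del: cnj_sum complex_cnj_mult)
  qed
  also have "\<dots> = (\<integral>\<^sup>+x. ennreal (exp (8 * \<theta>\<^sup>2 * (\<Sum>t\<in>S. (cmod (\<Sum>u\<in>?J. A t u * x u))\<^sup>2))) \<partial>cgauss ?J)"
    unfolding cgauss_exp_linear[OF fin(1)] norm_mult complex_mod_cnj power_mult_distrib
    by (simp add: sum_distrib_left[symmetric] mult.assoc)
  also have "\<dots> \<le> (\<integral>\<^sup>+x. ennreal (exp ((\<Sum>t\<in>S. (cmod (\<Sum>u\<in>?J. A t u * x u))\<^sup>2) / (4 * V))) \<partial>cgauss ?J)"
  proof (intro nn_integral_mono ennreal_leI, subst exp_le_cancel_iff)
    fix x
    show "8 * \<theta>\<^sup>2 * (\<Sum>t\<in>S. (cmod (\<Sum>u\<in>?J. A t u * x u))\<^sup>2) \<le> (\<Sum>t\<in>S. (cmod (\<Sum>u\<in>?J. A t u * x u))\<^sup>2) / (4 * V)"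
      using mult_right_mono[OF \<theta>, of "\<Sum>t\<in>S. (cmod (\<Sum>u\<in>?J. A t u * x u))\<^sup>2"] by (simp add: sum_nonneg)
  qed
  also have "\<dots> \<le> 2"
  proof (rule cgauss_exp_sum_square[OF fin(2,1) _ V(2)])
    have "(\<Sum>t\<in>S. \<Sum>u\<in>?J. (cmod (A t u))\<^sup>2) \<le> (\<Sum>t\<in>S. \<Sum>u\<in>I. (cmod (A t u))\<^sup>2)"
      using I by (intro sum_mono sum_mono2) auto
    also have "\<dots> \<le> (\<Sum>t\<in>I. \<Sum>u\<in>I. (cmod (A t u))\<^sup>2)"
      using I S by (intro sum_mono2) (auto simp: sum_nonneg)
    finally show "(\<Sum>t\<in>S. \<Sum>u\<in>?J. (cmod (A t u))\<^sup>2) \<le> V" using V(1) by linarith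
  qed
  finally show ?thesis .
qed

text \<open>Jensen's inequality over the \<open>2 ^ card I\<close> splittings of the index set
  reduces the form to bilinear ones. The constant \<open>6\<close> is admissible because
  \<open>8 / 36 \<le> 1 / 4\<close>.\<close>

lemma cgauss_exp_quadratic:
  assumes I: "finite I" and V: "(\<Sum>t\<in>I. \<Sum>u\<in>I. (cmod (A t u))\<^sup>2) \<le> V" "0 < V"
    and diag: "\<And>t. t \<in> I \<Longrightarrow> A t t = 0"
  shows "(\<integral>\<^sup>+\<zeta>. ennreal (exp (Re (\<Sum>t\<in>I. \<Sum>u\<in>I. A t u * (cnj (\<zeta> t) * \<zeta> u)) / (6 * sqrt V))) \<partial>cgauss I) \<le> 2"
proof -
  define \<theta> where "\<theta> = 1 / (6 * sqrt V)"
  have \<theta>: "8 * \<theta>\<^sup>2 \<le> 1 / (4 * V)" using V by (simp add: \<theta>_def power_divide power_mult_distrib field_simps)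
  define N where "N = (2::real) ^ card I"
  have N: "N > 0" "(\<Sum>S\<in>Pow I. 1 / N) = 1" using I by (auto simp: N_def card_Pow)
  define Q where "Q = (\<lambda>S \<zeta>. 4 * \<theta> * Re (\<Sum>t\<in>S. \<Sum>u\<in>I - S. A t u * (cnj (\<zeta> t) * \<zeta> u)))"
  have m [measurable]: "Q S \<in> borel_measurable (cgauss I)" if "S \<in> Pow I" for S
    unfolding Q_def using that by (intro borel_measurable_times borel_measurable_const measurable_quadratic_form) auto
  have le: "exp (Re (\<Sum>t\<in>I. \<Sum>u\<in>I. A t u * (cnj (\<zeta> t) * \<zeta> u)) / (6 * sqrt V)) \<le> (\<Sum>S\<in>Pow I. 1 / N * exp (Q S \<zeta>))" for \<zeta>
  proof -
    have "(\<Sum>S\<in>Pow I. 1 / N * Q S \<zeta>)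
        = 4 * \<theta> / N * Re (\<Sum>S\<in>Pow I. \<Sum>t\<in>S. \<Sum>u\<in>I - S. A t u * (cnj (\<zeta> t) * \<zeta> u))"
      unfolding Q_def Re_sum[of _ "Pow I"] sum_distrib_left by (intro sum.cong refl) simp
    also have "\<dots> = 4 * \<theta> / N * (N / 4 * Re (\<Sum>t\<in>I. \<Sum>u\<in>I. A t u * (cnj (\<zeta> t) * \<zeta> u)))"
    proof -
      have "of_nat (2 ^ card I) / 4 = complex_of_real (N / 4)" by (simp add: N_def)
      then show ?thesis by (subst quadratic_form_decouple[OF I]) (use diag in \<open>auto simp del: of_real_divide\<close>)
    qed
    also have "\<dots> = Re (\<Sum>t\<in>I. \<Sum>u\<in>I. A t u * (cnj (\<zeta> t) * \<zeta> u)) / (6 * sqrt V)"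
      using N by (simp add: \<theta>_def)
    finally show ?thesis
      using exp_convex_combination[of "Pow I" "\<lambda>_. 1 / N" "\<lambda>S. Q S \<zeta>"] I N by simp
  qed
  have "(\<integral>\<^sup>+\<zeta>. ennreal (exp (Re (\<Sum>t\<in>I. \<Sum>u\<in>I. A t u * (cnj (\<zeta> t) * \<zeta> u)) / (6 * sqrt V))) \<partial>cgauss I)
      \<le> (\<integral>\<^sup>+\<zeta>. (\<Sum>S\<in>Pow I. ennreal (1 / N) * ennreal (exp (Q S \<zeta>))) \<partial>cgauss I)"
  proof (rule nn_integral_mono)
    fix \<zeta>
    have "(\<Sum>S\<in>Pow I. ennreal (1 / N) * ennreal (exp (Q S \<zeta>))) = ennreal (\<Sum>S\<in>Pow I. 1 / N * exp (Q S \<zeta>))"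
      using N by (simp only: ennreal_mult[symmetric] sum_ennreal less_imp_le exp_ge_zero divide_nonneg_pos zero_le_one mult_nonneg_nonneg)
    then show "ennreal (exp (Re (\<Sum>t\<in>I. \<Sum>u\<in>I. A t u * (cnj (\<zeta> t) * \<zeta> u)) / (6 * sqrt V)))
        \<le> (\<Sum>S\<in>Pow I. ennreal (1 / N) * ennreal (exp (Q S \<zeta>)))"
      using le[of \<zeta>] by (simp add: ennreal_leI)
  qed
  also have "\<dots> = (\<Sum>S\<in>Pow I. ennreal (1 / N) * (\<integral>\<^sup>+\<zeta>. ennreal (exp (Q S \<zeta>)) \<partial>cgauss I))"
    by (subst nn_integral_sum) (auto intro!: sum.cong nn_integral_cmult)
  also have "\<dots> \<le> (\<Sum>S\<in>Pow I. ennreal (1 / N) * 2)"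
    unfolding Q_def by (intro sum_mono mult_left_mono cgauss_exp_bilinear[OF I _ V \<theta>]) auto
  also have "\<dots> = ennreal (\<Sum>S\<in>Pow I. 1 / N) * 2"
    using N by (simp add: sum_distrib_right[symmetric] del: sum_constant)
  finally show ?thesis using N by simp
qed

section \<open>The oracle inequality\<close>

text \<open>Expanding both sides of \<open>opt\<close> cancels the noise energy. Here
  \<open>x0\<close> is the estimate of the reproducing filter, with error
  \<open>\<sigma> * f0\<close>, and \<open>u\<close> and \<open>f\<close> are the optimal filter
  applied to signal and noise. The error itself reappears in the cross term through the norm of
  \<open>x - u\<close>.\<close>

lemma oracle_inequality:
  fixes x z xh x0 u f f0 :: "'i \<Rightarrow> complex" and \<sigma> :: real
  assumes \<sigma>: "0 < \<sigma>"
    and opt: "(\<Sum>t\<in>W. (cmod (x t + \<sigma> * z t - xh t))\<^sup>2) \<le> (\<Sum>t\<in>W. (cmod (x t + \<sigma> * z t - x0 t))\<^sup>2)"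
    and x0: "\<And>t. t \<in> W \<Longrightarrow> x0 t = x t + \<sigma> * f0 t"
    and xh: "\<And>t. t \<in> W \<Longrightarrow> xh t = u t + \<sigma> * f t"
    and cross: "cmod (\<Sum>t\<in>W. cnj (z t) * (x t - u t)) \<le> P * sqrt (\<Sum>t\<in>W. (cmod (x t - u t))\<^sup>2)"
    and P: "0 \<le> P"
    and F0: "(\<Sum>t\<in>W. (cmod (f0 t))\<^sup>2) \<le> F0" and F: "sqrt (\<Sum>t\<in>W. (cmod (f t))\<^sup>2) \<le> F"
    and Q0: "cmod (\<Sum>t\<in>W. cnj (z t) * f0 t) \<le> Q" and Q: "cmod (\<Sum>t\<in>W. cnj (z t) * f t) \<le> Q"
  shows "(\<Sum>t\<in>W. (cmod (x t - xh t))\<^sup>2) \<le> \<sigma>\<^sup>2 * (2 * F0 + 8 * Q + 4 * P\<^sup>2 + 4 * P * F)"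
proof -
  define d where "d = (\<lambda>t. x t - xh t)"
  define S where "S = (\<Sum>t\<in>W. (cmod (d t))\<^sup>2)"
  define Z where "Z = (\<Sum>t\<in>W. (cmod (z t))\<^sup>2)"
  have expand: "(\<Sum>t\<in>W. (cmod (v t + \<sigma> * z t))\<^sup>2)
      = (\<Sum>t\<in>W. (cmod (v t))\<^sup>2) + 2 * \<sigma> * Re (\<Sum>t\<in>W. cnj (z t) * v t) + \<sigma>\<^sup>2 * Z" for v :: "'i \<Rightarrow> complex"
    unfolding Z_def sum_distrib_left Re_sum sum.distrib[symmetric]
    unfolding cmod_power2 by (intro sum.cong refl) (simp add: power2_eq_square algebra_simps)
  have "(\<Sum>t\<in>W. (cmod (x t + \<sigma> * z t - xh t))\<^sup>2) = S + 2 * \<sigma> * Re (\<Sum>t\<in>W. cnj (z t) * d t) + \<sigma>\<^sup>2 * Z"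
    unfolding S_def expand[symmetric] d_def by (simp add: algebra_simps)
  moreover have "(\<Sum>t\<in>W. (cmod (x t + \<sigma> * z t - x0 t))\<^sup>2)
      = (\<Sum>t\<in>W. (cmod (- \<sigma> * f0 t + \<sigma> * z t))\<^sup>2)"
    by (intro sum.cong refl) (simp add: x0)
  then have "(\<Sum>t\<in>W. (cmod (x t + \<sigma> * z t - x0 t))\<^sup>2)
      = \<sigma>\<^sup>2 * (\<Sum>t\<in>W. (cmod (f0 t))\<^sup>2) - 2 * \<sigma>\<^sup>2 * Re (\<Sum>t\<in>W. cnj (z t) * f0 t) + \<sigma>\<^sup>2 * Z"
    unfolding expand using \<sigma>
    by (simp add: norm_mult power_mult_distrib sum_distrib_left power2_eq_square sum_negf mult_ac)
  ultimately have 1: "S \<le> \<sigma>\<^sup>2 * (\<Sum>t\<in>W. (cmod (f0 t))\<^sup>2) - 2 * \<sigma>\<^sup>2 * Re (\<Sum>t\<in>W. cnj (z t) * f0 t)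
      - 2 * \<sigma> * Re (\<Sum>t\<in>W. cnj (z t) * d t)"
    using opt by linarith
  define A where "A = (\<Sum>t\<in>W. cnj (z t) * (x t - u t))"
  define B where "B = (\<Sum>t\<in>W. cnj (z t) * f t)"
  have "(\<Sum>t\<in>W. cnj (z t) * d t) = (\<Sum>t\<in>W. cnj (z t) * (x t - u t) - of_real \<sigma> * (cnj (z t) * f t))"
    by (intro sum.cong refl) (simp add: d_def xh algebra_simps)
  also have "\<dots> = A - of_real \<sigma> * B"
    by (simp only: A_def B_def sum_subtractf sum_distrib_left)
  finally have zd: "(\<Sum>t\<in>W. cnj (z t) * d t) = A - of_real \<sigma> * B" .
  define N where "N = sqrt (\<Sum>t\<in>W. (cmod (x t - u t))\<^sup>2)"
  have N: "N \<le> sqrt S + \<sigma> * F"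
  proof -
    have "N = L2_set (\<lambda>t. cmod (d t + \<sigma> * f t)) W"
      unfolding N_def L2_set_def by (intro arg_cong[where f = sqrt] sum.cong refl) (simp add: d_def xh)
    also have "\<dots> \<le> L2_set (\<lambda>t. cmod (d t) + \<sigma> * cmod (f t)) W"
    proof (rule L2_set_mono)
      fix t show "cmod (d t + \<sigma> * f t) \<le> cmod (d t) + \<sigma> * cmod (f t)"
        using norm_triangle_ineq[of "d t" "\<sigma> * f t"] \<sigma> by (simp add: norm_mult)
    qed auto
    also have "\<dots> \<le> L2_set (\<lambda>t. cmod (d t)) W + L2_set (\<lambda>t. \<sigma> * cmod (f t)) W"
      by (rule L2_set_triangle_ineq)
    also have "L2_set (\<lambda>t. \<sigma> * cmod (f t)) W = \<sigma> * L2_set (\<lambda>t. cmod (f t)) W"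
      using \<sigma> by (simp add: L2_set_right_distrib)
    finally have "N \<le> sqrt S + \<sigma> * sqrt (\<Sum>t\<in>W. (cmod (f t))\<^sup>2)" by (simp add: S_def L2_set_def)
    moreover have "\<sigma> * sqrt (\<Sum>t\<in>W. (cmod (f t))\<^sup>2) \<le> \<sigma> * F" using F \<sigma> by (intro mult_left_mono) auto
    ultimately show ?thesis by linarith
  qed
  have S0: "S \<ge> 0" by (simp add: S_def sum_nonneg)
  note cross' = cross[folded A_def N_def] and Q' = Q[folded B_def]
  define B0 where "B0 = (\<Sum>t\<in>W. cnj (z t) * f0 t)"
  note Q0' = Q0[folded B0_def]
  have "- Re A \<le> P * (sqrt S + \<sigma> * F)"
    using cross' abs_Re_le_cmod[of A] mult_left_mono[OF N P] by linarith
  from mult_left_mono[OF this, of "2 * \<sigma>"]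
  have 2: "- (2 * \<sigma> * Re A) \<le> 2 * \<sigma> * (P * (sqrt S + \<sigma> * F))"
    using \<sigma> by simp
  have "- Re B0 \<le> Q" using Q0' abs_Re_le_cmod[of B0] by linarith
  then have 3: "- (2 * \<sigma>\<^sup>2 * Re B0) \<le> 2 * \<sigma>\<^sup>2 * Q"
    unfolding mult_minus_right[symmetric] by (intro mult_left_mono) auto
  have 4: "2 * \<sigma>\<^sup>2 * Re B \<le> 2 * \<sigma>\<^sup>2 * Q"
    using Q' abs_Re_le_cmod[of B] by (intro mult_left_mono) auto
  have 5: "\<sigma>\<^sup>2 * (\<Sum>t\<in>W. (cmod (f0 t))\<^sup>2) \<le> \<sigma>\<^sup>2 * F0" using F0 by (intro mult_left_mono) auto
  \<comment> \<open>Absorbing half of \<open>S\<close> into the left-hand side doubles all remaining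
    terms in the final bound.\<close>
  have 6: "2 * \<sigma> * P * sqrt S \<le> S / 2 + 2 * \<sigma>\<^sup>2 * P\<^sup>2"
  proof -
    have "0 \<le> (sqrt S - 2 * \<sigma> * P)\<^sup>2" by simp
    also have "\<dots> = S + 4 * \<sigma>\<^sup>2 * P\<^sup>2 - 4 * \<sigma> * P * sqrt S"
      using S0 by (simp add: power2_diff power_mult_distrib)
    finally show ?thesis by linarith
  qed
  note 7 = 1[unfolded zd, folded B0_def]
  have "2 * \<sigma> * Re (A - of_real \<sigma> * B) = 2 * \<sigma> * Re A - 2 * \<sigma>\<^sup>2 * Re B"
    by (simp add: algebra_simps power2_eq_square)
  moreover have "2 * \<sigma> * (P * (sqrt S + \<sigma> * F)) = 2 * \<sigma> * P * sqrt S + 2 * \<sigma>\<^sup>2 * P * F"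
    by (simp add: algebra_simps power2_eq_square)
  moreover have "\<sigma>\<^sup>2 * (2 * F0 + 8 * Q + 4 * P\<^sup>2 + 4 * P * F)
     = 2 * (\<sigma>\<^sup>2 * F0) + 8 * (\<sigma>\<^sup>2 * Q) + 4 * (\<sigma>\<^sup>2 * P\<^sup>2) + 4 * (\<sigma>\<^sup>2 * P * F)"
    by (simp add: algebra_simps)
  ultimately have "S \<le> \<sigma>\<^sup>2 * (2 * F0 + 8 * Q + 4 * P\<^sup>2 + 4 * P * F)"
    using 7 2 3 4 5 6 by linarith
  then show ?thesis by (simp add: S_def d_def)
qed

section \<open>Simultaneous control of the noise on a window\<close>

lemma exp_moment_event:
  assumes K: "finite K" "K \<noteq> {}" and \<beta>: "0 < \<beta>"
    and m: "\<And>k. k \<in> K \<Longrightarrow> X k \<in> borel_measurable M"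
    and E: "\<And>k. k \<in> K \<Longrightarrow> (\<integral>\<^sup>+z. ennreal (exp (X k z)) \<partial>M) \<le> 2"
  shows "\<exists>U\<in>sets M. emeasure M U \<le> ennreal \<beta> \<and>
    (\<forall>z\<in>space M - U. \<forall>k\<in>K. X k z \<le> ln (2 * real (card K) / \<beta>))"
proof -
  \<comment> \<open>Markov's inequality for the sum of all exponentials treats every
    \<open>k\<close> at once, so the number of forms enters through its logarithm.\<close>
  define c where "c = 2 * real (card K) / \<beta>"
  have c: "c > 0" using K \<beta> by (simp add: c_def card_gt_0_iff)
  define Z where "Z = (\<lambda>z. \<Sum>k\<in>K. exp (X k z))"
  have [measurable]: "Z \<in> borel_measurable M"
    unfolding Z_def using m by (intro borel_measurable_sum borel_measurable_exp) auto
  define U where "U = {z \<in> space M. c \<le> Z z}"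
  have U: "U \<in> sets M" unfolding U_def by measurable
  have Z0: "Z z \<ge> 0" for z by (simp add: Z_def sum_nonneg)
  have "(\<integral>\<^sup>+z. ennreal (Z z) \<partial>M) = (\<integral>\<^sup>+z. (\<Sum>k\<in>K. ennreal (exp (X k z))) \<partial>M)"
    by (simp add: Z_def)
  also have "\<dots> = (\<Sum>k\<in>K. \<integral>\<^sup>+z. ennreal (exp (X k z)) \<partial>M)"
    using m by (intro nn_integral_sum) (auto intro: measurable_compose[OF _ measurable_ennreal] borel_measurable_exp)
  also have "\<dots> \<le> (\<Sum>k\<in>K. 2)" by (intro sum_mono E)
  also have "\<dots> = ennreal (2 * real (card K))" by (simp add: ennreal_mult ennreal_of_nat_eq_real_of_nat mult.commute)
  finally have EZ: "(\<integral>\<^sup>+z. ennreal (Z z) \<partial>M) \<le> ennreal (2 * real (card K))" .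
  have "emeasure M U \<le> emeasure M ({z \<in> space M. 1 \<le> ennreal (1 / c) * ennreal (Z z)} \<inter> space M)"
  proof (rule emeasure_mono)
    show "U \<subseteq> {z \<in> space M. 1 \<le> ennreal (1 / c) * ennreal (Z z)} \<inter> space M"
    proof
      fix z assume "z \<in> U"
      then have "z \<in> space M" "1 \<le> 1 / c * Z z" using c by (auto simp: U_def)
      then show "z \<in> {z \<in> space M. 1 \<le> ennreal (1 / c) * ennreal (Z z)} \<inter> space M"
        using c Z0 by (simp add: ennreal_mult[symmetric] ennreal_1[symmetric] ennreal_leI del: ennreal_1)
    qed
  qed measurable
  also have "\<dots> \<le> ennreal (1 / c) * (\<integral>\<^sup>+z. ennreal (Z z) * indicator (space M) z \<partial>M)"
    using nn_integral_Markov_inequality[of "\<lambda>z. ennreal (Z z)" "space M" M "ennreal (1 / c)"]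
    by (simp add: Int_absorb2 Collect_conj_eq Int_commute Int_left_commute)
  also have "(\<integral>\<^sup>+z. ennreal (Z z) * indicator (space M) z \<partial>M) = (\<integral>\<^sup>+z. ennreal (Z z) \<partial>M)"
    by (intro nn_integral_cong) simp
  also have "ennreal (1 / c) * (\<integral>\<^sup>+z. ennreal (Z z) \<partial>M) \<le> ennreal (1 / c) * ennreal (2 * real (card K))"
    by (intro mult_left_mono EZ) auto
  also have "\<dots> = ennreal \<beta>"
    using c K \<beta> by (simp add: ennreal_mult[symmetric] c_def card_gt_0_iff)
  finally have "emeasure M U \<le> ennreal \<beta>" .
  moreover have "X k z \<le> ln c" if "z \<in> space M - U" "k \<in> K" for z k
  proof -
    have "exp (X k z) \<le> Z z" unfolding Z_def using K that(2) by (intro member_le_sum) auto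
    also have "\<dots> \<le> c" using that(1) by (auto simp: U_def)
    finally show ?thesis using c by (simp add: ln_ge_iff)
  qed
  ultimately show ?thesis using U unfolding c_def by blast
qed

text \<open>The filters whose transforms are the unit vectors. Up to phases and scaling they are the
  extreme points of the feasible set, so bounds for them extend to all feasible filters.\<close>

definition dft_basis :: "nat \<Rightarrow> nat \<Rightarrow> seq" where
  "dft_basis m k t = (if t \<in> {- int m..int m} then cnj (dft_char m k t) / complex_of_real (sqrt (2 * real m + 1)) else 0)"

lemma dft_basis_in_seqs: "dft_basis m k \<in> seqs_upto m"
  unfolding seqs_upto_def dft_basis_def by auto

lemma norm_dft_basis_le: "cmod (dft_basis m k t) \<le> 1 / sqrt (2 * real m + 1)"
  by (simp add: dft_basis_def norm_divide)

lemma sum_norm_dft_basis: "(\<Sum>t\<in>{- int m..int m}. (cmod (dft_basis m k t))\<^sup>2) = 1"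
  by (simp add: dft_basis_def norm_divide power_divide)

lemma dft_expansion: "\<phi> \<in> seqs_upto m \<Longrightarrow> \<phi> t = (\<Sum>k = 1..2 * m + 1. dft m \<phi> k * dft_basis m k t)"
  using dft_inverse[of \<phi> m t] unfolding dft_basis_def .

text \<open>For \<open>t\<close> within distance \<open>n\<close> of \<open>a\<close> the filter
  reaches only arguments of modulus at most \<open>m + n = L\<close>. Each output becomes a linear
  form in the coordinates on \<open>{- L..L}\<close>.\<close>

lemma sum_filter_window:
  fixes h :: "int \<Rightarrow> int \<Rightarrow> 'a::comm_monoid_add" and L m n :: nat
  assumes "t \<in> {a - int n..a + int n}" "m + n = L"
    and "\<And>\<tau> u. \<tau> \<notin> {- int m..int m} \<Longrightarrow> h \<tau> u = 0"
  shows "(\<Sum>\<tau>\<in>{- int m..int m}. h \<tau> (t - a - \<tau>)) = (\<Sum>u\<in>{- int L..int L}. h (t - a - u) u)"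
proof -
  have "(\<Sum>\<tau>\<in>{- int m..int m}. h \<tau> (t - a - \<tau>)) = (\<Sum>u\<in>{t - a - int m..t - a + int m}. h (t - a - u) u)"
    by (rule sum.reindex_bij_witness[of _ "\<lambda>u. t - a - u" "\<lambda>\<tau>. t - a - \<tau>"]) auto
  also have "\<dots> = (\<Sum>u\<in>{- int L..int L}. h (t - a - u) u)"
    using assms by (intro sum.mono_neutral_left) auto
  finally show ?thesis .
qed

lemma conv_lag_window:
  assumes "t \<in> {a - int n..a + int n}" "m + n = L" "\<phi> \<in> seqs_upto m"
  shows "conv \<phi> (lag a y) t = (\<Sum>u\<in>{- int L..int L}. \<phi> (t - a - u) * y u)"
proof -
  have "conv \<phi> (lag a y) t = (\<Sum>\<tau>\<in>{- int m..int m}. \<phi> \<tau> * y (t - a - \<tau>))"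
    unfolding conv_eq_sum[OF assms(3)] lag_def by (simp add: algebra_simps)
  also have "\<dots> = (\<Sum>u\<in>{- int L..int L}. \<phi> (t - a - u) * y u)"
    using assms by (intro sum_filter_window[where h = "\<lambda>\<tau> u. \<phi> \<tau> * y u" and n = n]) (auto simp: seqs_upto_def)
  finally show ?thesis .
qed

lemma filter_window_frobenius:
  assumes "m + n = L" "\<phi> \<in> seqs_upto m"
  shows "(\<Sum>t\<in>{a - int n..a + int n}. \<Sum>u\<in>{- int L..int L}. (cmod (\<phi> (t - a - u)))\<^sup>2)
    = (2 * real n + 1) * (\<Sum>t\<in>{- int m..int m}. (cmod (\<phi> t))\<^sup>2)"
proof -
  have "(\<Sum>u\<in>{- int L..int L}. (cmod (\<phi> (t - a - u)))\<^sup>2) = (\<Sum>t\<in>{- int m..int m}. (cmod (\<phi> t))\<^sup>2)"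
    if "t \<in> {a - int n..a + int n}" for t
    using sum_filter_window[OF that assms(1), of "\<lambda>\<tau> u. (cmod (\<phi> \<tau>))\<^sup>2"] assms(2)
    by (simp add: seqs_upto_def)
  then show ?thesis by simp
qed

text \<open>Five events of probability at most \<open>\<alpha> / 15\<close>, one per bound. The
  Toeplitz form has a diagonal with nonzero mean: the constant \<open>dft_basis m j (- a)\<close>,
  of modulus at most \<open>1 / sqrt M\<close>, times the noise energy. It is split off, and the
  off-diagonal rest is covered by \<open>cgauss_exp_quadratic\<close>.\<close>

lemma gaussian_piece_event:
  fixes L m n s :: nat and a :: int and \<alpha> \<rho> :: real
  defines "W \<equiv> {a - int n..a + int n}" and "M \<equiv> 2 * real m + 1"
  assumes mn: "m + n = L" and W: "W \<subseteq> {- int L..int L}" and s: "s \<ge> 1" and \<alpha>: "0 < \<alpha>" and \<rho>: "0 < \<rho>"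
    and \<phi>0: "\<phi>0 \<in> seqs_upto m" "l1_norm m (dft m \<phi>0) \<le> \<rho> / sqrt M"
    and k: "repr_kernel W V s k"
  shows "\<exists>U\<in>sets (noise_law L). emeasure (noise_law L) U \<le> ennreal (\<alpha> / 3) \<and>
    (\<forall>\<zeta>\<in>space (noise_law L) - U.
      (\<Sum>t\<in>W. (cmod (conv \<phi>0 (lag a \<zeta>) t))\<^sup>2) \<le> 4 * ((2 * real n + 1) * (\<rho> / sqrt M)\<^sup>2) * ln (30 / \<alpha>) \<and>
      (\<Sum>t\<in>W. (cmod (\<zeta> t))\<^sup>2) \<le> 4 * (2 * real n + 1) * ln (30 / \<alpha>) \<and>
      (\<Sum>t\<in>W. (cmod (\<Sum>u\<in>W. k t u * \<zeta> u))\<^sup>2) \<le> 4 * real s * ln (30 / \<alpha>) \<and>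
      (\<forall>j\<in>{1..2 * m + 1}. (\<Sum>t\<in>W. (cmod (conv (dft_basis m j) (lag a \<zeta>) t))\<^sup>2)
          \<le> 4 * (2 * real n + 1) * ln (120 * M / \<alpha>)) \<and>
      (\<forall>j\<in>{1..2 * m + 1}. cmod (\<Sum>t\<in>W. cnj (\<zeta> t) * conv (dft_basis m j) (lag a \<zeta>) t)
          \<le> 1 / sqrt M * (\<Sum>t\<in>W. (cmod (\<zeta> t))\<^sup>2) + 12 * sqrt (2 * real n + 1) * ln (120 * M / \<alpha>)))"
proof -
  let ?I = "{- int L..int L}"
  define n1 where "n1 = 2 * real n + 1"
  have n1: "n1 > 0" by (simp add: n1_def)
  have M: "M > 0" by (simp add: M_def)
  have cardW: "real (card W) = n1" by (simp add: W_def n1_def)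
  have finW: "finite W" by (simp add: W_def)
  have cv: "conv \<phi> (lag a \<zeta>) t = (\<Sum>u\<in>?I. \<phi> (t - a - u) * \<zeta> u)" if "\<phi> \<in> seqs_upto m" "t \<in> W" for \<phi> \<zeta> t
    using conv_lag_window[OF _ mn that(1)] that(2) by (simp add: W_def)
  have frob: "(\<Sum>t\<in>W. \<Sum>u\<in>?I. (cmod (\<phi> (t - a - u)))\<^sup>2) = n1 * (\<Sum>t\<in>{- int m..int m}. (cmod (\<phi> t))\<^sup>2)"
    if "\<phi> \<in> seqs_upto m" for \<phi>
    unfolding W_def n1_def by (rule filter_window_frobenius[OF mn that])
  have sq_event: "\<exists>U\<in>sets (noise_law L). emeasure (noise_law L) U \<le> ennreal (\<alpha> / 15) \<and>
      (\<forall>\<zeta>\<in>space (noise_law L) - U. \<forall>j\<in>K. (\<Sum>t\<in>W. (cmod (\<Sum>u\<in>?I. c j t u * \<zeta> u))\<^sup>2) \<le> 4 * v * ln (30 * real (card K) / \<alpha>))"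
    if K: "finite K" "K \<noteq> {}" and v: "0 < v" and c: "\<And>j. j \<in> K \<Longrightarrow> (\<Sum>t\<in>W. \<Sum>u\<in>?I. (cmod (c j t u))\<^sup>2) \<le> v"
    for K :: "nat set" and c v
  proof -
    have m: "(\<lambda>\<zeta>. (\<Sum>t\<in>W. (cmod (\<Sum>u\<in>?I. c j t u * \<zeta> u))\<^sup>2) / (4 * v)) \<in> borel_measurable (noise_law L)" for j
      unfolding noise_law_def
      by (intro borel_measurable_divide borel_measurable_sum borel_measurable_power borel_measurable_const
          measurable_compose[OF measurable_linear_form borel_measurable_norm]) auto
    have "\<exists>U\<in>sets (noise_law L). emeasure (noise_law L) U \<le> ennreal (\<alpha> / 15) \<and>
      (\<forall>\<zeta>\<in>space (noise_law L) - U. \<forall>j\<in>K. (\<Sum>t\<in>W. (cmod (\<Sum>u\<in>?I. c j t u * \<zeta> u))\<^sup>2) / (4 * v) \<le> ln (2 * real (card K) / (\<alpha> / 15)))"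
      using \<alpha> c unfolding noise_law_def
      by (intro exp_moment_event K m[unfolded noise_law_def] cgauss_exp_sum_square finW v) auto
    then show ?thesis using v by (simp add: pos_divide_le_eq mult_ac)
  qed
  obtain U1 where U1: "U1 \<in> sets (noise_law L)" "emeasure (noise_law L) U1 \<le> ennreal (\<alpha> / 15)"
    "\<And>\<zeta>. \<zeta> \<in> space (noise_law L) - U1 \<Longrightarrow>
      (\<Sum>t\<in>W. (cmod (\<Sum>u\<in>?I. \<phi>0 (t - a - u) * \<zeta> u))\<^sup>2) \<le> 4 * (n1 * (\<rho> / sqrt M)\<^sup>2) * ln (30 / \<alpha>)"
  proof -
    have "(\<Sum>t\<in>W. \<Sum>u\<in>?I. (cmod (\<phi>0 (t - a - u)))\<^sup>2) \<le> n1 * (\<rho> / sqrt M)\<^sup>2"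
      unfolding frob[OF \<phi>0(1)] using n1 by (intro mult_left_mono norm2_le_l1_dft \<phi>0(2)) auto
    moreover have "0 < n1 * (\<rho> / sqrt M)\<^sup>2" using n1 M \<rho> by simp
    ultimately show ?thesis
      using that sq_event[of "{0}" "n1 * (\<rho> / sqrt M)\<^sup>2" "\<lambda>_ t u. \<phi>0 (t - a - u)"] by auto
  qed
  obtain U2 where U2: "U2 \<in> sets (noise_law L)" "emeasure (noise_law L) U2 \<le> ennreal (\<alpha> / 15)"
    "\<And>\<zeta>. \<zeta> \<in> space (noise_law L) - U2 \<Longrightarrow> (\<Sum>t\<in>W. (cmod (\<zeta> t))\<^sup>2) \<le> 4 * n1 * ln (30 / \<alpha>)"
  proof -
    \<comment> \<open>Writes the noise itself as linear forms, so that \<open>sq_event\<close> also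
      bounds its energy.\<close>
    define \<delta> where "\<delta> = (\<lambda>t u :: int. if u = t then 1 else (0 :: complex))"
    have "(\<Sum>u\<in>?I. (cmod (\<delta> t u))\<^sup>2) = 1" "(\<Sum>u\<in>?I. \<delta> t u * \<zeta> u) = \<zeta> t" if "t \<in> W" for t \<zeta>
      using that W by (auto simp: \<delta>_def if_distrib if_distribR sum.delta cong: if_cong)
    then have "(\<Sum>t\<in>W. \<Sum>u\<in>?I. (cmod (\<delta> t u))\<^sup>2) \<le> n1"
      "\<And>\<zeta>. (\<Sum>t\<in>W. (cmod (\<Sum>u\<in>?I. \<delta> t u * \<zeta> u))\<^sup>2) = (\<Sum>t\<in>W. (cmod (\<zeta> t))\<^sup>2)" using cardW by auto
    then show ?thesis
      using that sq_event[of "{0}" n1 "\<lambda>_. \<delta>"] n1 by auto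
  qed
  obtain U3 where U3: "U3 \<in> sets (noise_law L)" "emeasure (noise_law L) U3 \<le> ennreal (\<alpha> / 15)"
    "\<And>\<zeta>. \<zeta> \<in> space (noise_law L) - U3 \<Longrightarrow>
      (\<Sum>t\<in>W. (cmod (\<Sum>u\<in>W. k t u * \<zeta> u))\<^sup>2) \<le> 4 * real s * ln (30 / \<alpha>)"
  proof -
    define c where "c = (\<lambda>t u. if u \<in> W then k t u else 0)"
    have "(\<Sum>u\<in>?I. (cmod (c t u))\<^sup>2) = (\<Sum>u\<in>W. (cmod (k t u))\<^sup>2)" for t
      using W by (intro sum.mono_neutral_cong_right) (auto simp: c_def)
    moreover have lin: "(\<Sum>u\<in>?I. c t u * \<zeta> u) = (\<Sum>u\<in>W. k t u * \<zeta> u)" for t \<zeta>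
      using W by (intro sum.mono_neutral_cong_right) (auto simp: c_def)
    ultimately have "(\<Sum>t\<in>W. \<Sum>u\<in>?I. (cmod (c t u))\<^sup>2) = (\<Sum>t\<in>W. Re (k t t))"
      using repr_kernel_diag(1)[OF k] by simp
    also have "\<dots> \<le> real s" by (rule repr_kernel_trace[OF k])
    finally show ?thesis
      using that sq_event[of "{0}" "real s" "\<lambda>_. c"] s by (auto simp: lin)
  qed
  obtain U4 where U4: "U4 \<in> sets (noise_law L)" "emeasure (noise_law L) U4 \<le> ennreal (\<alpha> / 15)"
    "\<And>\<zeta> j. \<zeta> \<in> space (noise_law L) - U4 \<Longrightarrow> j \<in> {1..2 * m + 1} \<Longrightarrow>
      (\<Sum>t\<in>W. (cmod (\<Sum>u\<in>?I. dft_basis m j (t - a - u) * \<zeta> u))\<^sup>2) \<le> 4 * n1 * ln (30 * M / \<alpha>)"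
  proof -
    have "(\<Sum>t\<in>W. \<Sum>u\<in>?I. (cmod (dft_basis m j (t - a - u)))\<^sup>2) \<le> n1" for j
      unfolding frob[OF dft_basis_in_seqs] sum_norm_dft_basis by simp
    moreover have "real (card {1..2 * m + 1}) = M" by (simp add: M_def)
    ultimately show ?thesis
      using that sq_event[of "{1..2 * m + 1}" n1 "\<lambda>j t u. dft_basis m j (t - a - u)"] n1 by auto
  qed
  define A where "A = (\<lambda>j t u. if t \<in> W \<and> u \<noteq> t then dft_basis m j (t - a - u) else 0)"
  define Q where "Q = (\<lambda>j \<zeta>. \<Sum>t\<in>?I. \<Sum>u\<in>?I. A j t u * (cnj (\<zeta> t) * \<zeta> u))"
  have A: "(\<Sum>t\<in>?I. \<Sum>u\<in>?I. (cmod (A j t u))\<^sup>2) \<le> n1" for j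
  proof -
    have "(\<Sum>t\<in>?I. \<Sum>u\<in>?I. (cmod (A j t u))\<^sup>2) = (\<Sum>t\<in>W. \<Sum>u\<in>?I. (cmod (A j t u))\<^sup>2)"
      using W by (intro sum.mono_neutral_right) (auto simp: A_def)
    also have "\<dots> \<le> (\<Sum>t\<in>W. \<Sum>u\<in>?I. (cmod (dft_basis m j (t - a - u)))\<^sup>2)"
      by (intro sum_mono) (auto simp: A_def)
    also have "\<dots> = n1" unfolding frob[OF dft_basis_in_seqs] sum_norm_dft_basis by simp
    finally show ?thesis .
  qed
  \<comment> \<open>Real parts after rotation by four phases control \<open>Re\<close> and
    \<open>Im\<close> in absolute value, whence \<open>12 = 2 * 6\<close>. There are
    \<open>4 M\<close> forms at level \<open>\<alpha> / 15\<close>, which gives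
    \<open>2 * 4 * 15 = 120\<close> under the logarithm.\<close>
  define Ph where "Ph = {1, - 1, \<i>, - \<i> :: complex}"
  have Ph: "finite Ph" "card Ph = 4"
    by (auto simp: Ph_def complex_eq_iff)
  have norm_Ph: "cmod p = 1" if "p \<in> Ph" for p using that by (auto simp: Ph_def)
  obtain U5 where U5: "U5 \<in> sets (noise_law L)" "emeasure (noise_law L) U5 \<le> ennreal (\<alpha> / 15)"
    "\<And>\<zeta> j p. \<zeta> \<in> space (noise_law L) - U5 \<Longrightarrow> j \<in> {1..2 * m + 1} \<Longrightarrow> p \<in> Ph \<Longrightarrow>
      Re (p * Q j \<zeta>) / (6 * sqrt n1) \<le> ln (120 * M / \<alpha>)"
  proof -
    define K where "K = {1..2 * m + 1} \<times> Ph"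
    have pQ: "p * Q j \<zeta> = (\<Sum>t\<in>?I. \<Sum>u\<in>?I. (p * A j t u) * (cnj (\<zeta> t) * \<zeta> u))" for p j \<zeta>
      by (simp add: Q_def sum_distrib_left mult.assoc)
    have E: "(\<integral>\<^sup>+\<zeta>. ennreal (exp (case e of (j, p) \<Rightarrow> Re (p * Q j \<zeta>) / (6 * sqrt n1))) \<partial>noise_law L) \<le> 2" if "e \<in> K" for e
    proof -
      obtain j p where e: "e = (j, p)" "p \<in> Ph" using \<open>e \<in> K\<close> by (auto simp: K_def)
      have "(\<Sum>t\<in>?I. \<Sum>u\<in>?I. (cmod (p * A j t u))\<^sup>2) \<le> n1"
        using A[of j] norm_Ph[OF e(2)] by (simp add: norm_mult)
      then show ?thesis unfolding e prod.case pQ noise_law_def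
        by (intro cgauss_exp_quadratic n1) (auto simp: A_def)
    qed
    have m: "(\<lambda>\<zeta>. case e of (j, p) \<Rightarrow> Re (p * Q j \<zeta>) / (6 * sqrt n1)) \<in> borel_measurable (noise_law L)" for e
      unfolding noise_law_def pQ by (cases e) (auto intro!: borel_measurable_divide measurable_quadratic_form simp del: Re_sum)
    have "\<exists>U\<in>sets (noise_law L). emeasure (noise_law L) U \<le> ennreal (\<alpha> / 15) \<and>
      (\<forall>\<zeta>\<in>space (noise_law L) - U. \<forall>e\<in>K. (case e of (j, p) \<Rightarrow> Re (p * Q j \<zeta>) / (6 * sqrt n1)) \<le> ln (2 * real (card K) / (\<alpha> / 15)))"
      using Ph(1) \<alpha> by (intro exp_moment_event m E) (auto simp: K_def Ph_def)
    moreover have "2 * real (card K) / (\<alpha> / 15) = 120 * M / \<alpha>"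
      by (simp add: K_def card_cartesian_product Ph(2) M_def)
    ultimately show ?thesis using that unfolding K_def by fastforce
  qed
  define U where "U = U1 \<union> U2 \<union> U3 \<union> U4 \<union> U5"
  have "U \<in> sets (noise_law L)" using U1 U2 U3 U4 U5 by (simp add: U_def)
  moreover have "emeasure (noise_law L) U \<le> ennreal (\<alpha> / 3)"
  proof -
    have un: "emeasure (noise_law L) (X \<union> Y) \<le> x + y"
      if "X \<in> sets (noise_law L)" "Y \<in> sets (noise_law L)" "emeasure (noise_law L) X \<le> x" "emeasure (noise_law L) Y \<le> y"
      for X Y x y
      using emeasure_subadditive[OF that(1,2)] add_mono[OF that(3,4)] by (rule order_trans)
    have "emeasure (noise_law L) U \<le> ennreal (\<alpha> / 15) + ennreal (\<alpha> / 15) + ennreal (\<alpha> / 15) + ennreal (\<alpha> / 15) + ennreal (\<alpha> / 15)"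
      unfolding U_def by (intro un sets.Un U1(1,2) U2(1,2) U3(1,2) U4(1,2) U5(1,2))
    also have "\<dots> = ennreal (\<alpha> / 3)" using \<alpha> by (simp add: ennreal_plus[symmetric] del: ennreal_plus)
    finally show ?thesis .
  qed
  moreover have "(\<Sum>t\<in>W. (cmod (conv \<phi>0 (lag a \<zeta>) t))\<^sup>2) \<le> 4 * (n1 * (\<rho> / sqrt M)\<^sup>2) * ln (30 / \<alpha>) \<and>
      (\<Sum>t\<in>W. (cmod (\<zeta> t))\<^sup>2) \<le> 4 * n1 * ln (30 / \<alpha>) \<and>
      (\<Sum>t\<in>W. (cmod (\<Sum>u\<in>W. k t u * \<zeta> u))\<^sup>2) \<le> 4 * real s * ln (30 / \<alpha>) \<and>
      (\<forall>j\<in>{1..2 * m + 1}. (\<Sum>t\<in>W. (cmod (conv (dft_basis m j) (lag a \<zeta>) t))\<^sup>2) \<le> 4 * n1 * ln (120 * M / \<alpha>)) \<and>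
      (\<forall>j\<in>{1..2 * m + 1}. cmod (\<Sum>t\<in>W. cnj (\<zeta> t) * conv (dft_basis m j) (lag a \<zeta>) t)
          \<le> 1 / sqrt M * (\<Sum>t\<in>W. (cmod (\<zeta> t))\<^sup>2) + 12 * sqrt n1 * ln (120 * M / \<alpha>))"
    if \<zeta>: "\<zeta> \<in> space (noise_law L) - U" for \<zeta>
  proof (intro conjI ballI)
    show "(\<Sum>t\<in>W. (cmod (conv \<phi>0 (lag a \<zeta>) t))\<^sup>2) \<le> 4 * (n1 * (\<rho> / sqrt M)\<^sup>2) * ln (30 / \<alpha>)"
      using U1(3)[of \<zeta>] \<zeta> cv[OF \<phi>0(1)] by (simp add: U_def)
    show "(\<Sum>t\<in>W. (cmod (\<zeta> t))\<^sup>2) \<le> 4 * n1 * ln (30 / \<alpha>)" using U2(3)[of \<zeta>] \<zeta> by (simp add: U_def)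
    show "(\<Sum>t\<in>W. (cmod (\<Sum>u\<in>W. k t u * \<zeta> u))\<^sup>2) \<le> 4 * real s * ln (30 / \<alpha>)"
      using U3(3)[of \<zeta>] \<zeta> by (simp add: U_def)
    fix j assume j: "j \<in> {1..2 * m + 1}"
    have "(\<Sum>t\<in>W. (cmod (conv (dft_basis m j) (lag a \<zeta>) t))\<^sup>2) \<le> 4 * n1 * ln (30 * M / \<alpha>)"
      using U4(3)[of \<zeta>, OF _ j] \<zeta> cv[OF dft_basis_in_seqs] by (simp add: U_def)
    also have "\<dots> \<le> 4 * n1 * ln (120 * M / \<alpha>)"
      using M \<alpha> n1 by (intro mult_left_mono ln_mono divide_right_mono) auto
    finally show "(\<Sum>t\<in>W. (cmod (conv (dft_basis m j) (lag a \<zeta>) t))\<^sup>2) \<le> 4 * n1 * ln (120 * M / \<alpha>)" .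
    define D where "D = dft_basis m j (- a) * of_real (\<Sum>t\<in>W. (cmod (\<zeta> t))\<^sup>2)"
    have "(\<Sum>t\<in>W. cnj (\<zeta> t) * conv (dft_basis m j) (lag a \<zeta>) t) = D + Q j \<zeta>"
    proof -
      have "cnj (\<zeta> t) * conv (dft_basis m j) (lag a \<zeta>) t
          = dft_basis m j (- a) * of_real ((cmod (\<zeta> t))\<^sup>2) + (\<Sum>u\<in>?I. A j t u * (cnj (\<zeta> t) * \<zeta> u))" if t: "t \<in> W" for t
      proof -
        have tI: "t \<in> ?I" using t W by auto
        have "cnj (\<zeta> t) * conv (dft_basis m j) (lag a \<zeta>) t = (\<Sum>u\<in>?I. dft_basis m j (t - a - u) * (cnj (\<zeta> t) * \<zeta> u))"
          unfolding cv[OF dft_basis_in_seqs t] sum_distrib_left by (simp add: mult_ac)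
        also have "\<dots> = (\<Sum>u\<in>?I. (if u = t then dft_basis m j (- a) * (cnj (\<zeta> t) * \<zeta> t) else 0) + A j t u * (cnj (\<zeta> t) * \<zeta> u))"
          by (intro sum.cong refl) (auto simp: A_def t)
        also have "\<dots> = dft_basis m j (- a) * (cnj (\<zeta> t) * \<zeta> t) + (\<Sum>u\<in>?I. A j t u * (cnj (\<zeta> t) * \<zeta> u))"
          using tI by (simp add: sum.distrib sum.delta)
        finally show ?thesis by (simp only: complex_norm_square mult.commute[of "cnj (\<zeta> t)" "\<zeta> t"])
      qed
      then have "(\<Sum>t\<in>W. cnj (\<zeta> t) * conv (dft_basis m j) (lag a \<zeta>) t)
          = D + (\<Sum>t\<in>W. \<Sum>u\<in>?I. A j t u * (cnj (\<zeta> t) * \<zeta> u))"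
        by (simp add: sum.distrib D_def sum_distrib_left of_real_sum)
      also have "(\<Sum>t\<in>W. \<Sum>u\<in>?I. A j t u * (cnj (\<zeta> t) * \<zeta> u)) = Q j \<zeta>"
        unfolding Q_def using W by (intro sum.mono_neutral_left) (auto simp: A_def)
      finally show ?thesis .
    qed
    then have "cmod (\<Sum>t\<in>W. cnj (\<zeta> t) * conv (dft_basis m j) (lag a \<zeta>) t) \<le> cmod D + cmod (Q j \<zeta>)"
      by (simp add: norm_triangle_ineq)
    also have "cmod D \<le> 1 / sqrt M * (\<Sum>t\<in>W. (cmod (\<zeta> t))\<^sup>2)"
      unfolding D_def norm_mult norm_of_real using norm_dft_basis_le[of m j "- a"]
      by (intro mult_mono) (auto simp: M_def sum_nonneg)
    also have "cmod (Q j \<zeta>) \<le> 12 * sqrt n1 * ln (120 * M / \<alpha>)"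
    proof -
      have b: "Re (p * Q j \<zeta>) \<le> 6 * sqrt n1 * ln (120 * M / \<alpha>)" if "p \<in> Ph" for p
        using U5(3)[of \<zeta> j p, OF _ j that] \<zeta> n1 by (simp add: U_def pos_divide_le_eq mult_ac)
      have "\<bar>Re (Q j \<zeta>)\<bar> \<le> 6 * sqrt n1 * ln (120 * M / \<alpha>)" "\<bar>Im (Q j \<zeta>)\<bar> \<le> 6 * sqrt n1 * ln (120 * M / \<alpha>)"
        using b[of 1] b[of "- 1"] b[of \<i>] b[of "- \<i>"] by (auto simp: Ph_def abs_le_iff)
      then show ?thesis using cmod_le[of "Q j \<zeta>"] by linarith
    qed
    finally show "cmod (\<Sum>t\<in>W. cnj (\<zeta> t) * conv (dft_basis m j) (lag a \<zeta>) t)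
          \<le> 1 / sqrt M * (\<Sum>t\<in>W. (cmod (\<zeta> t))\<^sup>2) + 12 * sqrt n1 * ln (120 * M / \<alpha>)" by simp
  qed
  ultimately show ?thesis unfolding n1_def[symmetric] by blast
qed

section \<open>Risk on one window\<close>

lemma conv_dft_expansion:
  assumes "t \<in> {a - int n..a + int n}" "m + n = L" "\<phi> \<in> seqs_upto m"
  shows "conv \<phi> (lag a y) t = (\<Sum>j = 1..2 * m + 1. dft m \<phi> j * conv (dft_basis m j) (lag a y) t)"
proof -
  have "conv \<phi> (lag a y) t = (\<Sum>u\<in>{- int L..int L}. \<Sum>j = 1..2 * m + 1. dft m \<phi> j * (dft_basis m j (t - a - u) * y u))"
    unfolding conv_lag_window[OF assms]
    by (subst dft_expansion[OF assms(3)], intro sum.cong refl) (simp only: sum_distrib_right mult.assoc)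
  also have "\<dots> = (\<Sum>j = 1..2 * m + 1. dft m \<phi> j * conv (dft_basis m j) (lag a y) t)"
    unfolding conv_lag_window[OF assms(1,2) dft_basis_in_seqs] sum_distrib_left by (rule sum.swap)
  finally show ?thesis .
qed

lemma L2_set_sum_le:
  fixes g :: "'j \<Rightarrow> 'i \<Rightarrow> 'a::real_normed_vector"
  assumes "finite J"
  shows "L2_set (\<lambda>t. norm (\<Sum>j\<in>J. g j t)) W \<le> (\<Sum>j\<in>J. L2_set (\<lambda>t. norm (g j t)) W)"
  using assms
proof (induction J rule: finite_induct)
  case empty then show ?case by (simp add: L2_set_def)
next
  case (insert i J)
  have "L2_set (\<lambda>t. norm (\<Sum>j\<in>insert i J. g j t)) W \<le> L2_set (\<lambda>t. norm (g i t) + norm (\<Sum>j\<in>J. g j t)) W"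
    using insert.hyps by (intro L2_set_mono) (auto simp: norm_triangle_ineq)
  also have "\<dots> \<le> L2_set (\<lambda>t. norm (g i t)) W + L2_set (\<lambda>t. norm (\<Sum>j\<in>J. g j t)) W"
    by (rule L2_set_triangle_ineq)
  finally show ?case using insert by simp
qed

text \<open>Everything is compared with \<open>X = \<rho> * \<kappa> * sqrt \<Lambda>\<close>: the
  lower bound on \<open>\<Lambda>\<close> gives \<open>\<rho> * \<kappa> \<le> 5 / 4 * X\<close>,
  and \<open>l\<close>, \<open>sqrt s * l\<close> are at most \<open>Y\<close>. The coefficients are
  \<open>240 = (8 + 32) * 6\<close>, \<open>1360 = 96 * 25 / 2 + 16 * 10\<close> and
  \<open>96 = 4 * 24\<close>.\<close>

lemma piece_numeric:
  fixes s l \<Lambda> \<rho> \<kappa> D Y l1 l2 :: real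
  assumes s: "1 \<le> s" and l: "1 \<le> l" and \<Lambda>: "16 / 25 \<le> \<Lambda>" "\<Lambda> \<le> l"
    and \<rho>: "1 \<le> \<rho>" and \<kappa>: "0 \<le> \<kappa>" and Y: "Y = s * sqrt s * l" and D: "0 \<le> D"
    and X: "\<rho> * \<kappa> * sqrt \<Lambda> \<le> D * Y" and l1: "0 \<le> l1" "l1 \<le> 6 * \<Lambda>" and l2: "0 \<le> l2" "l2 \<le> 10 * l"
  shows "2 * (4 * (\<rho> * \<kappa>)\<^sup>2 * l1) + 8 * (4 * (\<rho> * \<kappa>\<^sup>2) * l1 + 12 * (\<rho> * \<kappa>) * l2)
    + 4 * (2 * sqrt (s * l1))\<^sup>2 + 4 * (2 * sqrt (s * l1)) * (2 * (\<rho> * \<kappa>) * sqrt l2)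
    \<le> (240 * D\<^sup>2 + 1360 * D + 96) * Y\<^sup>2"
proof -
  define w where "w = \<rho> * \<kappa>"
  define X where "X = w * sqrt \<Lambda>"
  have w0: "w \<ge> 0" using \<rho> \<kappa> by (simp add: w_def)
  have XD: "X \<le> D * Y" using X by (simp add: X_def w_def)
  have sq: "4 / 5 \<le> sqrt \<Lambda>" using \<Lambda> by (intro real_le_rsqrt) (simp add: power2_eq_square)
  have X0: "0 \<le> X" using w0 \<Lambda> by (simp add: X_def)
  have wX: "w \<le> 5 / 4 * X" using mult_left_mono[OF sq w0] by (simp add: X_def)
  have X2: "w\<^sup>2 * \<Lambda> = X\<^sup>2" using \<Lambda> by (simp add: X_def power_mult_distrib)
  have ss: "1 \<le> sqrt s" using s by simp
  have Y1: "sqrt s * l \<le> Y" unfolding Y using s l ss by (simp add: mult_right_mono)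
  have "1 * l \<le> sqrt s * l" using ss l by (intro mult_right_mono) auto
  then have Y2: "l \<le> Y" using Y1 by linarith
  have Y0: "0 \<le> Y" using Y2 l by simp
  have YY: "s * l \<le> Y\<^sup>2"
  proof -
    have "s * l \<le> s * l * l" using s l by (simp add: mult_left_le)
    also have "\<dots> = (sqrt s * l) * (sqrt s * l)" using s by (simp add: mult_ac)
    also have "\<dots> \<le> Y * Y" using Y1 s l Y0 by (intro mult_mono) auto
    finally show ?thesis by (simp add: power2_eq_square)
  qed
  have XX: "X\<^sup>2 \<le> D\<^sup>2 * Y\<^sup>2" using power_mono[OF XD X0, of 2] by (simp add: power_mult_distrib)
  have Xl: "X * l \<le> D * Y\<^sup>2"
  proof -
    have "X * l \<le> (D * Y) * Y" using XD Y2 X0 l D Y0 by (intro mult_mono) auto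
    then show ?thesis by (simp add: power2_eq_square)
  qed
  have Xsl: "X * (sqrt s * l) \<le> D * Y\<^sup>2"
  proof -
    have "X * (sqrt s * l) \<le> (D * Y) * Y" using XD Y1 X0 l s D Y0 by (intro mult_mono) auto
    then show ?thesis by (simp add: power2_eq_square)
  qed
  have wl1: "w\<^sup>2 * l1 \<le> 6 * X\<^sup>2"
    using mult_left_mono[OF l1(2), of "w\<^sup>2"] X2 by simp
  have k: "\<rho> * \<kappa>\<^sup>2 \<le> w\<^sup>2"
    using \<rho> \<kappa> mult_right_mono[of 1 \<rho> "\<rho> * \<kappa>\<^sup>2"] by (simp add: w_def power2_eq_square mult_ac)
  have t1: "\<rho> * \<kappa>\<^sup>2 * l1 \<le> 6 * X\<^sup>2" using mult_right_mono[OF k l1(1)] wl1 by linarith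
  have t2: "w * l2 \<le> 25 / 2 * (X * l)"
  proof -
    have "w * l2 \<le> (5 / 4 * X) * (10 * l)" using wX l2 X0 by (intro mult_mono) auto
    then show ?thesis by simp
  qed
  have t3: "(2 * sqrt (s * l1))\<^sup>2 \<le> 24 * (s * l)"
    using s l1 \<Lambda> by (simp add: power_mult_distrib)
  have t4: "sqrt (s * l1) * (w * sqrt l2) \<le> 10 * (X * (sqrt s * l))"
  proof -
    have "sqrt (s * l1) * sqrt l2 \<le> 8 * (sqrt s * l)"
    proof -
      have "sqrt (s * l1) * sqrt l2 = sqrt s * sqrt (l1 * l2)" by (simp add: real_sqrt_mult)
      also have "sqrt (l1 * l2) \<le> 8 * l"
      proof (rule real_le_lsqrt)
        have "l1 * l2 \<le> (6 * l) * (10 * l)" using l1 l2 \<Lambda> by (intro mult_mono) auto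
        also have "\<dots> \<le> (8 * l)\<^sup>2" by (simp add: power2_eq_square)
        finally show "l1 * l2 \<le> (8 * l)\<^sup>2" .
      qed (use l in auto)
      finally show ?thesis using s by (simp add: mult_left_mono)
    qed
    then have "w * (sqrt (s * l1) * sqrt l2) \<le> (5 / 4 * X) * (8 * (sqrt s * l))"
      using X0 s l1 l2 by (intro mult_mono[OF wX]) auto
    then show ?thesis by (simp add: mult_ac)
  qed
  have "2 * (4 * w\<^sup>2 * l1) + 8 * (4 * (\<rho> * \<kappa>\<^sup>2) * l1 + 12 * w * l2)
    + 4 * (2 * sqrt (s * l1))\<^sup>2 + 4 * (2 * sqrt (s * l1)) * (2 * w * sqrt l2)
    = 8 * (w\<^sup>2 * l1) + 32 * (\<rho> * \<kappa>\<^sup>2 * l1) + 96 * (w * l2) + 4 * (2 * sqrt (s * l1))\<^sup>2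
      + 16 * (sqrt (s * l1) * (w * sqrt l2))"
    by (simp add: algebra_simps)
  also have "\<dots> \<le> 240 * (D\<^sup>2 * Y\<^sup>2) + 1360 * (D * Y\<^sup>2) + 96 * Y\<^sup>2"
    using wl1 t1 t2 t3 t4 XX Xl Xsl YY by linarith
  finally show ?thesis by (simp add: w_def algebra_simps)
qed

text \<open>As \<open>\<alpha> \<le> 1 / 2\<close>, numerical factors under the logarithm are
  absorbed as multiples of \<open>ln 2\<close>, using \<open>30 \<le> 2^5\<close> and
  \<open>360 \<le> 2^9\<close>. The value \<open>16 / 25\<close> lies below \<open>ln 2\<close> and
  has the rational root \<open>4 / 5\<close>.\<close>

lemma log_factor_bounds:
  fixes L :: nat and \<alpha> M :: real
  assumes L: "L \<ge> 3" and \<alpha>: "0 < \<alpha>" "\<alpha> \<le> 1 / 2" and M: "0 < M" "M \<le> 3 * real L"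
  shows "16 / 25 \<le> ln (1 / \<alpha>)" "ln (1 / \<alpha>) \<le> ln (real L / \<alpha>)" "1 \<le> ln (real L / \<alpha>)"
    and "ln (30 / \<alpha>) \<le> 6 * ln (1 / \<alpha>)" "ln (120 * M / \<alpha>) \<le> 10 * ln (real L / \<alpha>)"
    and "ln (real L / \<alpha>) = ln (real L) + ln (1 / \<alpha>)"
proof -
  have l2: "ln 2 \<le> ln (1 / \<alpha>)" using \<alpha> by (intro ln_mono) (auto simp: field_simps)
  have l23: "2 / 3 \<le> ln (2 :: real)" using ln2_ge_two_thirds by simp
  show 1: "16 / 25 \<le> ln (1 / \<alpha>)" using l2 l23 by linarith
  show sp: "ln (real L / \<alpha>) = ln (real L) + ln (1 / \<alpha>)"
    using L \<alpha> ln_mult[of "real L" "1 / \<alpha>"] by simp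
  have lL: "ln 2 \<le> ln (real L)" using L by (intro ln_mono) auto
  show 2: "ln (1 / \<alpha>) \<le> ln (real L / \<alpha>)" unfolding sp using lL l23 by linarith
  show "1 \<le> ln (real L / \<alpha>)" unfolding sp using lL l23 l2 by linarith
  have "ln (30 :: real) \<le> ln (2 ^ 5)" by (intro ln_mono) auto
  also have "\<dots> = 5 * ln 2" using ln_realpow[of "2 :: real" 5] by simp
  finally have "ln (30 :: real) \<le> 5 * ln 2" .
  moreover have "ln (30 / \<alpha>) = ln 30 + ln (1 / \<alpha>)" using \<alpha> ln_mult[of 30 "1 / \<alpha>"] by simp
  ultimately show "ln (30 / \<alpha>) \<le> 6 * ln (1 / \<alpha>)" using l2 by linarith
  have "ln (120 * M / \<alpha>) \<le> ln (2 ^ 9 * (real L / \<alpha>))"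
  proof (rule ln_mono)
    have "120 * M \<le> 2 ^ 9 * real L" using M by simp
    then have "120 * M / \<alpha> \<le> 2 ^ 9 * real L / \<alpha>" using \<alpha> by (intro divide_right_mono) auto
    then show "120 * M / \<alpha> \<le> 2 ^ 9 * (real L / \<alpha>)" by simp
  qed (use M \<alpha> in auto)
  also have "\<dots> = 9 * ln 2 + ln (real L / \<alpha>)"
    using L \<alpha> ln_mult[of "2 ^ 9" "real L / \<alpha>"] ln_realpow[of "2 :: real" 9] by simp
  finally show "ln (120 * M / \<alpha>) \<le> 10 * ln (real L / \<alpha>)" using l2 2 by linarith
qed

text \<open>Undoing the lag in the objective moves its window to \<open>{a - n..a + n}\<close>;
  center and ends become one problem on different windows.\<close>

lemma optimal_filter_window:
  assumes "optimal_filter a m n \<rho> y \<phi>" "\<phi>0 \<in> seqs_upto m" "l1_norm m (dft m \<phi>0) \<le> \<rho> / sqrt (2 * real m + 1)"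
  shows "\<phi> \<in> seqs_upto m" "l1_norm m (dft m \<phi>) \<le> \<rho> / sqrt (2 * real m + 1)"
    and "(\<Sum>t\<in>{a - int n..a + int n}. (cmod (y t - conv \<phi> (lag a y) t))\<^sup>2)
      \<le> (\<Sum>t\<in>{a - int n..a + int n}. (cmod (y t - conv \<phi>0 (lag a y) t))\<^sup>2)"
proof -
  have obj: "(seminorm2 n (lag (- a) (\<lambda>t. y t - conv \<phi> (lag a y) t)))\<^sup>2
      = (\<Sum>t\<in>{a - int n..a + int n}. (cmod (y t - conv \<phi> (lag a y) t))\<^sup>2)" for \<phi>
  proof -
    have "(\<Sum>\<tau>\<in>{- int n..int n}. (cmod (y (\<tau> - - a) - conv \<phi> (lag a y) (\<tau> - - a)))\<^sup>2)
        = (\<Sum>t\<in>{a - int n..a + int n}. (cmod (y t - conv \<phi> (lag a y) t))\<^sup>2)"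
      by (rule sum.reindex_bij_witness[of _ "\<lambda>t. t - a" "\<lambda>\<tau>. \<tau> + a"]) auto
    then show ?thesis by (simp add: seminorm2_def lag_def sum_nonneg)
  qed
  show "\<phi> \<in> seqs_upto m" "l1_norm m (dft m \<phi>) \<le> \<rho> / sqrt (2 * real m + 1)"
    using assms(1) unfolding optimal_filter_def is_arg_min_def by blast+
  show "(\<Sum>t\<in>{a - int n..a + int n}. (cmod (y t - conv \<phi> (lag a y) t))\<^sup>2)
      \<le> (\<Sum>t\<in>{a - int n..a + int n}. (cmod (y t - conv \<phi>0 (lag a y) t))\<^sup>2)"
    using assms unfolding optimal_filter_def is_arg_min_def obj by (meson not_less)
qed

text \<open>The exceptional set is chosen before \<open>\<sigma>\<close>, \<open>x\<close> and
  \<open>\<phi>\<close>, from the frequencies, the reproducing filter and the window alone. It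
  therefore stays measurable even if the optimal filter is selected from the data in a nonmeasurable
  way.\<close>

lemma piece_risk:
  fixes L m n s :: nat and a :: int and \<alpha> \<rho> D :: real
  defines "W \<equiv> {a - int n..a + int n}" and "Y \<equiv> real s * sqrt (real s) * ln (real L / \<alpha>)"
  assumes mn: "m + n = L" and W: "W \<subseteq> {- int L..int L}" and L: "L \<ge> 3"
    and s: "s = length ws" "s \<ge> 1" and ws: "\<And>w. w \<in> set ws \<Longrightarrow> cmod w = 1"
    and \<alpha>: "0 < \<alpha>" "\<alpha> \<le> 1 / 2" and \<rho>: "1 \<le> \<rho>" and D: "0 \<le> D"
    and X: "\<rho> * kappa m n * sqrt (ln (1 / \<alpha>)) \<le> D * Y"
    and \<phi>0: "\<phi>0 \<in> seqs_upto m" "\<And>x. seq_killed ws x \<Longrightarrow> x = conv \<phi>0 (lag a x)"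
      "l1_norm m (dft m \<phi>0) \<le> \<rho> / sqrt (2 * real m + 1)"
  shows "\<exists>U\<in>sets (noise_law L). emeasure (noise_law L) U \<le> ennreal (\<alpha> / 3) \<and>
    (\<forall>\<zeta>\<in>space (noise_law L) - U. \<forall>\<sigma> x \<phi>. 0 < \<sigma> \<and> seq_killed ws x \<and> optimal_filter a m n \<rho> (observation \<sigma> L x \<zeta>) \<phi> \<longrightarrow>
      (\<Sum>t\<in>W. (cmod (x t - conv \<phi> (lag a (observation \<sigma> L x \<zeta>)) t))\<^sup>2)
        \<le> \<sigma>\<^sup>2 * ((240 * D\<^sup>2 + 1360 * D + 96) * Y\<^sup>2))"
proof -
  define M where "M = 2 * real m + 1"
  define n1 where "n1 = 2 * real n + 1"
  have M: "M > 0" "M \<le> 3 * real L" and n1: "n1 > 0" using mn L by (auto simp: M_def n1_def)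
  define \<kappa> where "\<kappa> = kappa m n"
  have \<kappa>: "\<kappa> = sqrt n1 / sqrt M"
    by (simp add: \<kappa>_def kappa_def M_def n1_def real_sqrt_divide)
  have \<kappa>0: "\<kappa> \<ge> 0" using n1 M by (simp add: \<kappa>)
  have \<kappa>2: "\<kappa>\<^sup>2 = n1 / M" using n1 M by (simp add: \<kappa> power_divide)
  define l1 where "l1 = ln (30 / \<alpha>)"
  define l2 where "l2 = ln (120 * M / \<alpha>)"
  note logs = log_factor_bounds[OF L \<alpha> M, folded l1_def l2_def]
  have l1: "0 \<le> l1" using \<alpha> by (simp add: l1_def)
  have l2: "0 \<le> l2"
  proof -
    have "1 \<le> 120 * M" by (simp add: M_def)
    then show ?thesis using \<alpha> by (simp add: l2_def)
  qed
  have "\<exists>k. repr_kernel W {x. seq_killed ws x} (length ws) k"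
    using ws by (intro repr_kernel_exists) (fastforce simp: W_def)+
  then obtain k where k: "repr_kernel W {x. seq_killed ws x} s k" using s by blast
  have "0 < \<rho>" using \<rho> by simp
  from gaussian_piece_event[OF mn W[unfolded W_def] s(2) \<alpha>(1) this \<phi>0(1,3) k[unfolded W_def], folded W_def M_def n1_def]
  obtain U where U: "U \<in> sets (noise_law L)" "emeasure (noise_law L) U \<le> ennreal (\<alpha> / 3)" and
    ev: "\<And>\<zeta>. \<zeta> \<in> space (noise_law L) - U \<Longrightarrow>
      (\<Sum>t\<in>W. (cmod (conv \<phi>0 (lag a \<zeta>) t))\<^sup>2) \<le> 4 * (n1 * (\<rho> / sqrt M)\<^sup>2) * l1 \<and>
      (\<Sum>t\<in>W. (cmod (\<zeta> t))\<^sup>2) \<le> 4 * n1 * l1 \<and>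
      (\<Sum>t\<in>W. (cmod (\<Sum>u\<in>W. k t u * \<zeta> u))\<^sup>2) \<le> 4 * real s * l1 \<and>
      (\<forall>j\<in>{1..2 * m + 1}. (\<Sum>t\<in>W. (cmod (conv (dft_basis m j) (lag a \<zeta>) t))\<^sup>2) \<le> 4 * n1 * l2) \<and>
      (\<forall>j\<in>{1..2 * m + 1}. cmod (\<Sum>t\<in>W. cnj (\<zeta> t) * conv (dft_basis m j) (lag a \<zeta>) t)
          \<le> 1 / sqrt M * (\<Sum>t\<in>W. (cmod (\<zeta> t))\<^sup>2) + 12 * sqrt n1 * l2)"
    unfolding l1_def l2_def by blast
  have main: "(\<Sum>t\<in>W. (cmod (x t - conv \<phi> (lag a (observation \<sigma> L x \<zeta>)) t))\<^sup>2)
        \<le> \<sigma>\<^sup>2 * ((240 * D\<^sup>2 + 1360 * D + 96) * Y\<^sup>2)"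
    if \<zeta>: "\<zeta> \<in> space (noise_law L) - U" and \<sigma>: "0 < \<sigma>" and x: "seq_killed ws x"
      and opt: "optimal_filter a m n \<rho> (observation \<sigma> L x \<zeta>) \<phi>" for \<zeta> \<sigma> x \<phi>
  proof -
    define y where "y = observation \<sigma> L x \<zeta>"
    from ev[OF \<zeta>] have e1: "(\<Sum>t\<in>W. (cmod (conv \<phi>0 (lag a \<zeta>) t))\<^sup>2) \<le> 4 * (n1 * (\<rho> / sqrt M)\<^sup>2) * l1"
      and e2: "(\<Sum>t\<in>W. (cmod (\<zeta> t))\<^sup>2) \<le> 4 * n1 * l1"
      and e3: "(\<Sum>t\<in>W. (cmod (\<Sum>u\<in>W. k t u * \<zeta> u))\<^sup>2) \<le> 4 * real s * l1"
      and e4: "\<And>j. j \<in> {1..2 * m + 1} \<Longrightarrow> (\<Sum>t\<in>W. (cmod (conv (dft_basis m j) (lag a \<zeta>) t))\<^sup>2) \<le> 4 * n1 * l2"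
      and e5: "\<And>j. j \<in> {1..2 * m + 1} \<Longrightarrow> cmod (\<Sum>t\<in>W. cnj (\<zeta> t) * conv (dft_basis m j) (lag a \<zeta>) t)
          \<le> 1 / sqrt M * (\<Sum>t\<in>W. (cmod (\<zeta> t))\<^sup>2) + 12 * sqrt n1 * l2"
      by blast+
    note ow = optimal_filter_window[OF opt \<phi>0(1,3), folded y_def W_def M_def]
    have obs: "y u = x u + \<sigma> * \<zeta> u" if "u \<in> {- int L..int L}" for u
      using that by (simp add: y_def observation_def)
    have lin: "conv \<psi> (lag a y) t = conv \<psi> (lag a x) t + \<sigma> * conv \<psi> (lag a \<zeta>) t"
      if "\<psi> \<in> seqs_upto m" "t \<in> W" for \<psi> t
      unfolding conv_lag_window[OF that(2)[unfolded W_def] mn that(1)]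
      by (simp add: obs distrib_left sum.distrib sum_distrib_left mult_ac)
    \<comment> \<open>The form is linear in the filter, so a common bound for the basis filters
      times the l1-radius covers the optimal filter and the reproducing one alike.\<close>
    have Qb: "cmod (\<Sum>t\<in>W. cnj (\<zeta> t) * conv \<psi> (lag a \<zeta>) t) \<le> 4 * (\<rho> * \<kappa>\<^sup>2) * l1 + 12 * (\<rho> * \<kappa>) * l2"
      if \<psi>: "\<psi> \<in> seqs_upto m" "l1_norm m (dft m \<psi>) \<le> \<rho> / sqrt M" for \<psi>
    proof -
      define b where "b = 4 * n1 * l1 / sqrt M + 12 * sqrt n1 * l2"
      have b0: "b \<ge> 0" using n1 M l1 l2 by (simp add: b_def)
      have "(\<Sum>t\<in>W. cnj (\<zeta> t) * conv \<psi> (lag a \<zeta>) t)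
          = (\<Sum>t\<in>W. \<Sum>j = 1..2 * m + 1. dft m \<psi> j * (cnj (\<zeta> t) * conv (dft_basis m j) (lag a \<zeta>) t))"
      proof (rule sum.cong[OF refl])
        fix t assume t: "t \<in> W"
        show "cnj (\<zeta> t) * conv \<psi> (lag a \<zeta>) t = (\<Sum>j = 1..2 * m + 1. dft m \<psi> j * (cnj (\<zeta> t) * conv (dft_basis m j) (lag a \<zeta>) t))"
          unfolding conv_dft_expansion[OF t[unfolded W_def] mn \<psi>(1)] sum_distrib_left by (simp only: mult.left_commute)
      qed
      also have "\<dots> = (\<Sum>j = 1..2 * m + 1. dft m \<psi> j * (\<Sum>t\<in>W. cnj (\<zeta> t) * conv (dft_basis m j) (lag a \<zeta>) t))"
        unfolding sum_distrib_left by (rule sum.swap)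
      finally have "cmod (\<Sum>t\<in>W. cnj (\<zeta> t) * conv \<psi> (lag a \<zeta>) t)
          \<le> (\<Sum>j = 1..2 * m + 1. cmod (dft m \<psi> j) * cmod (\<Sum>t\<in>W. cnj (\<zeta> t) * conv (dft_basis m j) (lag a \<zeta>) t))"
        by (simp only: norm_mult[symmetric] norm_sum)
      also have "\<dots> \<le> (\<Sum>j = 1..2 * m + 1. cmod (dft m \<psi> j) * b)"
      proof (intro sum_mono mult_left_mono)
        fix j assume j: "j \<in> {1..2 * m + 1}"
        have "1 / sqrt M * (\<Sum>t\<in>W. (cmod (\<zeta> t))\<^sup>2) \<le> 1 / sqrt M * (4 * n1 * l1)"
          using M by (intro mult_left_mono e2) auto
        then show "cmod (\<Sum>t\<in>W. cnj (\<zeta> t) * conv (dft_basis m j) (lag a \<zeta>) t) \<le> b"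
          using e5[OF j] by (simp add: b_def)
      qed auto
      also have "\<dots> \<le> \<rho> / sqrt M * b"
        unfolding sum_distrib_right[symmetric] using \<psi>(2) b0 by (intro mult_right_mono) (simp_all add: l1_norm_def)
      also have "\<dots> = 4 * (\<rho> * \<kappa>\<^sup>2) * l1 + 12 * (\<rho> * \<kappa>) * l2"
        using M n1 by (simp add: b_def \<kappa> power_divide field_simps)
      finally show ?thesis .
    qed
    have "(\<Sum>t\<in>W. (cmod (x t - conv \<phi> (lag a y) t))\<^sup>2)
      \<le> \<sigma>\<^sup>2 * (2 * (4 * (\<rho> * \<kappa>)\<^sup>2 * l1) + 8 * (4 * (\<rho> * \<kappa>\<^sup>2) * l1 + 12 * (\<rho> * \<kappa>) * l2)
        + 4 * (2 * sqrt (real s * l1))\<^sup>2 + 4 * (2 * sqrt (real s * l1)) * (2 * (\<rho> * \<kappa>) * sqrt l2))"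
    proof (rule oracle_inequality[OF \<sigma>, where z = \<zeta> and xh = "conv \<phi> (lag a y)" and ?x0.0 = "conv \<phi>0 (lag a y)" and u = "conv \<phi> (lag a x)"
          and f = "conv \<phi> (lag a \<zeta>)" and ?f0.0 = "conv \<phi>0 (lag a \<zeta>)"])
      have "(\<Sum>t\<in>W. (cmod (y t - conv \<psi> (lag a y) t))\<^sup>2) = (\<Sum>t\<in>W. (cmod (x t + \<sigma> * \<zeta> t - conv \<psi> (lag a y) t))\<^sup>2)" for \<psi>
        using W by (intro sum.cong refl) (auto simp: obs)
      then show "(\<Sum>t\<in>W. (cmod (x t + \<sigma> * \<zeta> t - conv \<phi> (lag a y) t))\<^sup>2) \<le> (\<Sum>t\<in>W. (cmod (x t + \<sigma> * \<zeta> t - conv \<phi>0 (lag a y) t))\<^sup>2)"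
        using ow(3) by simp
      show "conv \<phi>0 (lag a y) t = x t + \<sigma> * conv \<phi>0 (lag a \<zeta>) t" if "t \<in> W" for t
        using lin[OF \<phi>0(1) that] fun_cong[OF \<phi>0(2)[OF x], of t] by simp
      show "conv \<phi> (lag a y) t = conv \<phi> (lag a x) t + \<sigma> * conv \<phi> (lag a \<zeta>) t" if "t \<in> W" for t
        by (rule lin[OF ow(1) that])
      show "0 \<le> 2 * sqrt (real s * l1)" using l1 by simp
      have "4 * (n1 * (\<rho> / sqrt M)\<^sup>2) * l1 = 4 * (\<rho> * \<kappa>)\<^sup>2 * l1"
        using M by (simp add: power_mult_distrib \<kappa>2 power_divide)
      then show "(\<Sum>t\<in>W. (cmod (conv \<phi>0 (lag a \<zeta>) t))\<^sup>2) \<le> 4 * (\<rho> * \<kappa>)\<^sup>2 * l1" using e1 by (simp only:)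
      show "cmod (\<Sum>t\<in>W. cnj (\<zeta> t) * conv \<phi>0 (lag a \<zeta>) t) \<le> 4 * (\<rho> * \<kappa>\<^sup>2) * l1 + 12 * (\<rho> * \<kappa>) * l2"
        by (rule Qb[OF \<phi>0(1) \<phi>0(3)[folded M_def]])
      show "cmod (\<Sum>t\<in>W. cnj (\<zeta> t) * conv \<phi> (lag a \<zeta>) t) \<le> 4 * (\<rho> * \<kappa>\<^sup>2) * l1 + 12 * (\<rho> * \<kappa>) * l2"
        by (rule Qb[OF ow(1,2)])
      show "sqrt (\<Sum>t\<in>W. (cmod (conv \<phi> (lag a \<zeta>) t))\<^sup>2) \<le> 2 * (\<rho> * \<kappa>) * sqrt l2"
      proof -
        have "sqrt (\<Sum>t\<in>W. (cmod (conv \<phi> (lag a \<zeta>) t))\<^sup>2)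
            = L2_set (\<lambda>t. cmod (\<Sum>j = 1..2 * m + 1. dft m \<phi> j * conv (dft_basis m j) (lag a \<zeta>) t)) W"
          unfolding L2_set_def
        proof (rule arg_cong[where f = sqrt], rule sum.cong[OF refl])
          fix t assume t: "t \<in> W"
          show "(cmod (conv \<phi> (lag a \<zeta>) t))\<^sup>2 = (cmod (\<Sum>j = 1..2 * m + 1. dft m \<phi> j * conv (dft_basis m j) (lag a \<zeta>) t))\<^sup>2"
            unfolding conv_dft_expansion[OF t[unfolded W_def] mn ow(1), symmetric] ..
        qed
        also have "\<dots> \<le> (\<Sum>j = 1..2 * m + 1. L2_set (\<lambda>t. cmod (dft m \<phi> j * conv (dft_basis m j) (lag a \<zeta>) t)) W)"
          by (rule L2_set_sum_le) simp
        also have "\<dots> \<le> (\<Sum>j = 1..2 * m + 1. cmod (dft m \<phi> j) * (2 * sqrt n1 * sqrt l2))"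
        proof (rule sum_mono)
          fix j assume j: "j \<in> {1..2 * m + 1}"
          have "L2_set (\<lambda>t. cmod (dft m \<phi> j * conv (dft_basis m j) (lag a \<zeta>) t)) W
              = cmod (dft m \<phi> j) * sqrt (\<Sum>t\<in>W. (cmod (conv (dft_basis m j) (lag a \<zeta>) t))\<^sup>2)"
            by (simp add: norm_mult L2_set_right_distrib[symmetric]) (simp add: L2_set_def)
          also have "\<dots> \<le> cmod (dft m \<phi> j) * sqrt (4 * n1 * l2)"
            by (intro mult_left_mono real_sqrt_le_mono e4 j) auto
          finally show "L2_set (\<lambda>t. cmod (dft m \<phi> j * conv (dft_basis m j) (lag a \<zeta>) t)) W \<le> cmod (dft m \<phi> j) * (2 * sqrt n1 * sqrt l2)"
            by (simp add: real_sqrt_mult)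
        qed
        also have "\<dots> \<le> \<rho> / sqrt M * (2 * sqrt n1 * sqrt l2)"
          unfolding sum_distrib_right[symmetric] using ow(2) n1 l2 by (intro mult_right_mono) (simp_all add: l1_norm_def)
        also have "\<dots> = 2 * (\<rho> * \<kappa>) * sqrt l2" by (simp add: \<kappa>)
        finally show ?thesis .
      qed
      \<comment> \<open>\<open>v\<close> solves the recurrence for every filter, so inserting the
        kernel replaces the noise by its projection \<open>p\<close> in the correlation with
        \<open>v\<close>.\<close>
      define v where "v = (\<lambda>t. x t - conv \<phi> (lag a x) t)"
      define p where "p = (\<lambda>t. \<Sum>u\<in>W. k t u * \<zeta> u)"
      have v: "seq_killed ws v"
      proof -
        have "seq_killed ws (\<lambda>t. \<Sum>\<tau>\<in>{- int m..int m}. \<phi> \<tau> * x (t - (\<tau> + a)))"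
          using x by (intro seq_killed_lincomb seq_killed_shift) auto
        then have "seq_killed ws (conv \<phi> (lag a x))"
          unfolding conv_eq_sum[OF ow(1)] lag_def by (simp add: algebra_simps)
        from seq_killed_add_scale[OF x this, of "- 1"] show ?thesis by (simp add: v_def)
      qed
      have "(\<Sum>t\<in>W. cnj (\<zeta> t) * v t) = (\<Sum>t\<in>W. \<Sum>u\<in>W. v u * cnj (k u t * \<zeta> t))"
      proof (rule sum.cong[OF refl])
        fix t assume t: "t \<in> W"
        have "cnj (\<zeta> t) * v t = cnj (\<zeta> t) * (\<Sum>u\<in>W. k t u * v u)"
          using repr_kernel_reproduces[OF k, of v t] v t by simp
        also have "\<dots> = (\<Sum>u\<in>W. v u * cnj (k u t * \<zeta> t))"
          unfolding sum_distrib_left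
        proof (rule sum.cong[OF refl])
          fix u assume u: "u \<in> W"
          show "cnj (\<zeta> t) * (k t u * v u) = v u * cnj (k u t * \<zeta> t)"
            unfolding repr_kernel_hermitian[OF k u t] by (simp add: mult_ac)
        qed
        finally show "cnj (\<zeta> t) * v t = (\<Sum>u\<in>W. v u * cnj (k u t * \<zeta> t))" .
      qed
      also have "\<dots> = (\<Sum>u\<in>W. v u * cnj (p u))"
        unfolding p_def cnj_sum sum_distrib_left by (rule sum.swap)
      finally have "cmod (\<Sum>t\<in>W. cnj (\<zeta> t) * v t) \<le> (\<Sum>u\<in>W. cmod (v u) * cmod (p u))"
        using norm_sum[of "\<lambda>u. v u * cnj (p u)" W] by (simp add: norm_mult)
      also have "\<dots> \<le> L2_set (\<lambda>u. cmod (v u)) W * L2_set (\<lambda>u. cmod (p u)) W"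
        using L2_set_mult_ineq[of "\<lambda>u. cmod (v u)" "\<lambda>u. cmod (p u)" W] by simp
      also have "\<dots> \<le> L2_set (\<lambda>u. cmod (v u)) W * (2 * sqrt (real s * l1))"
      proof (intro mult_left_mono L2_set_nonneg)
        have "L2_set (\<lambda>u. cmod (p u)) W \<le> sqrt (4 * real s * l1)"
          unfolding L2_set_def p_def by (intro real_sqrt_le_mono e3)
        then show "L2_set (\<lambda>u. cmod (p u)) W \<le> 2 * sqrt (real s * l1)" by (simp add: real_sqrt_mult)
      qed
      finally show "cmod (\<Sum>t\<in>W. cnj (\<zeta> t) * (x t - conv \<phi> (lag a x) t))
          \<le> 2 * sqrt (real s * l1) * sqrt (\<Sum>t\<in>W. (cmod (x t - conv \<phi> (lag a x) t))\<^sup>2)"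
        unfolding v_def L2_set_def by (simp only: mult.commute)
    qed
    also have "\<dots> \<le> \<sigma>\<^sup>2 * ((240 * D\<^sup>2 + 1360 * D + 96) * Y\<^sup>2)"
      using s(2) D X logs l1 l2 \<rho> \<kappa>0
      by (intro mult_left_mono piece_numeric[where l = "ln (real L / \<alpha>)" and \<Lambda> = "ln (1 / \<alpha>)"])
        (auto simp: Y_def \<kappa>_def)
    finally show ?thesis by (simp add: y_def)
  qed
  show ?thesis using U main by blast
qed

section \<open>Minimizing the total bound\<close>

lemma ln_le_two_sqrt: "0 < x \<Longrightarrow> ln x \<le> 2 * sqrt x"
  using ln_le_minus_one[of "sqrt x"] by (simp add: ln_sqrt)

lemma powr_three_halves: "0 \<le> s \<Longrightarrow> s powr (3 / 2) = s * sqrt s"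
  using powr_add[of s 1 "1 / 2"] by (simp add: powr_half_sqrt)

text \<open>Lets an upper bound on the total bound be read as one on the first summand, which
  contains the product of radius and \<open>kappa\<close> that \<open>piece_risk\<close> asks
  for.\<close>

lemma center_bound_nonneg:
  assumes "0 < \<sigma>" "0 < \<alpha>" "\<alpha> \<le> 1 / 2" "1 \<le> m + n"
  shows "\<sigma> * real s * kappa m n * sqrt (ln (1 / \<alpha>)) \<le> center_bound \<sigma> s \<alpha> m n"
    and "0 \<le> center_bound \<sigma> s \<alpha> m n"
proof -
  have "1 \<le> real (m + n) / \<alpha>" using assms by (simp add: divide_simps)
  then have "0 \<le> ln (real (m + n) / \<alpha>)" by simp
  then have "0 \<le> \<sigma> * sqrt (real s * ((kappa m n)\<^sup>2 + 1) * ln (real (m + n) / \<alpha>) + real s)" using assms by simp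
  moreover have "0 \<le> \<sigma> * real s * kappa m n * sqrt (ln (1 / \<alpha>))" using assms by (simp add: kappa_def)
  ultimately show "\<sigma> * real s * kappa m n * sqrt (ln (1 / \<alpha>)) \<le> center_bound \<sigma> s \<alpha> m n"
    and "0 \<le> center_bound \<sigma> s \<alpha> m n"
    unfolding center_bound_def by linarith+
qed

lemma end_bound_nonneg:
  assumes "0 < \<sigma>" "0 < \<alpha>" "\<alpha> \<le> 1 / 2" "1 \<le> m"
  shows "\<sigma> * (real s)\<^sup>2 * ln (real m) * kappa m n * sqrt (ln (1 / \<alpha>)) \<le> end_bound \<sigma> s \<alpha> m n"
    and "0 \<le> end_bound \<sigma> s \<alpha> m n"
proof -
  have "1 \<le> real (m + n) / \<alpha>" using assms by (simp add: divide_simps)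
  then have "0 \<le> ln (real (m + n) / \<alpha>)" by simp
  then have "0 \<le> \<sigma> * real s * (kappa m n + 1) * sqrt (ln (real m) * ln (real (m + n) / \<alpha>))"
    using assms by (simp add: kappa_def)
  moreover have "0 \<le> \<sigma> * (real s)\<^sup>2 * ln (real m) * kappa m n * sqrt (ln (1 / \<alpha>))" using assms by (simp add: kappa_def)
  ultimately show "\<sigma> * (real s)\<^sup>2 * ln (real m) * kappa m n * sqrt (ln (1 / \<alpha>)) \<le> end_bound \<sigma> s \<alpha> m n"
    and "0 \<le> end_bound \<sigma> s \<alpha> m n"
    unfolding end_bound_def by linarith+
qed

text \<open>For \<open>L - K\<close> of order \<open>d\<close> the leading terms are about
  \<open>s * sqrt (L / d)\<close> in the center and \<open>s^2 * ln L * sqrt (d / L)\<close> at the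
  ends, times \<open>sqrt (ln (1 / \<alpha>))\<close>. They balance at
  \<open>d = L / (s * ln L)\<close>, where both are of order
  \<open>s^(3/2) * sqrt (ln L * ln (1 / \<alpha>))\<close>.\<close>

lemma good_center_radius:
  fixes s L :: nat and \<alpha> \<sigma> A B :: real
  assumes s: "s \<ge> 1" and L: "even L" "16 \<le> L" "16 * (real s)\<^sup>2 \<le> real L" and \<alpha>: "0 < \<alpha>" "\<alpha> \<le> 1 / 2"
    and \<sigma>: "0 < \<sigma>" and AB: "0 < A" "0 < B"
  shows "\<exists>K\<le>L. even K \<and>
    total_bound A B \<sigma> s \<alpha> L K \<le> \<sigma> * (4 * A + 10 * B) * (real s * sqrt (real s) * ln (real L / \<alpha>))"
proof -
  define S where "S = real s"
  define R where "R = real L"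
  define l where "l = ln R"
  define \<Lambda> where "\<Lambda> = ln (1 / \<alpha>)"
  define h where "h = ln (R / \<alpha>)"
  define Y where "Y = S * sqrt S * h"
  have S: "1 \<le> S" using s by (simp add: S_def)
  have R: "16 \<le> R" using L by (simp add: R_def)
  have logs: "16 / 25 \<le> \<Lambda>" "\<Lambda> \<le> h" "1 \<le> h" "h = l + \<Lambda>"
    using log_factor_bounds[of L \<alpha> 1] L \<alpha> by (auto simp: \<Lambda>_def h_def R_def l_def)
  have l2: "2 \<le> l"
  proof -
    have "ln (2 ^ 4) \<le> l" unfolding l_def using R by (intro ln_mono) auto
    moreover have "ln (2 ^ 4) = 4 * ln (2 :: real)" using ln_realpow[of "2 :: real" 4] by simp
    ultimately show ?thesis using ln2_ge_two_thirds by linarith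
  qed
  \<comment> \<open>The condition \<open>16 s^2 \<le> L\<close> enters here. It makes the target
    width \<open>r\<close> at least \<open>2\<close>, so that rounding costs only a constant
    factor.\<close>
  have "S * l \<le> S * (2 * sqrt R)" using ln_le_two_sqrt[of R] R S by (intro mult_left_mono) (auto simp: l_def)
  also have "\<dots> \<le> R / 2"
  proof -
    have "4 * S \<le> sqrt R" using L by (intro real_le_rsqrt) (simp add: power_mult_distrib S_def R_def)
    then have "(4 * S) * sqrt R \<le> sqrt R * sqrt R" using R by (intro mult_right_mono) auto
    then show ?thesis using R by simp
  qed
  finally have SlR: "S * l \<le> R / 2" .
  have Sl: "2 \<le> S * l" using mult_mono[of 1 S 2 l] S l2 by simp
  define r where "r = R / (S * l)"
  have r2: "2 \<le> r" using SlR Sl by (simp add: r_def field_simps)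
  \<comment> \<open>Half of the width \<open>L - K\<close>. Working with the half keeps
    \<open>K = L - 2 e\<close> even, and rounding up keeps \<open>e\<close> between
    \<open>r / 2\<close> and \<open>r\<close>.\<close>
  define e where "e = nat \<lceil>r / 2\<rceil>"
  have e: "r / 2 \<le> real e" "real e \<le> r"
    using r2 by (auto simp: e_def) linarith+
  have e1: "1 \<le> real e" using e r2 by linarith
  have eR: "2 * real e \<le> R"
  proof -
    have "r \<le> R / 2" unfolding r_def using Sl R by (intro divide_left_mono) auto
    then show ?thesis using e by linarith
  qed
  then have eL: "2 * e \<le> L" unfolding R_def by (metis of_nat_le_iff of_nat_mult of_nat_numeral)
  define K where "K = L - 2 * e"
  have K: "K \<le> L" "even K" "L - K = 2 * e" "(L + K) div 2 = L - e" "(L - K) div 2 = e" "real K = R - 2 * real e"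
    using eL L by (auto simp: K_def R_def of_nat_diff)
  define \<kappa>c where "\<kappa>c = kappa (2 * e) K"
  define \<kappa>e where "\<kappa>e = kappa (L - e) e"
  have \<kappa>c: "\<kappa>c \<ge> 0" "\<kappa>c\<^sup>2 \<le> 3 / 2 * (S * l)"
  proof -
    have "\<kappa>c\<^sup>2 = (2 * real K + 1) / (2 * real (2 * e) + 1)" by (simp add: \<kappa>c_def kappa_def)
    also have "\<dots> \<le> (3 * R) / (2 * r)"
      using K(6) e1 e(1) R r2 by (intro frac_le) auto
    also have "\<dots> = 3 / 2 * (S * l)" using R Sl by (simp add: r_def)
    finally show "\<kappa>c\<^sup>2 \<le> 3 / 2 * (S * l)" .
  qed (simp add: \<kappa>c_def kappa_def)
  have \<kappa>e: "\<kappa>e \<ge> 0" "\<kappa>e\<^sup>2 \<le> 4 / (S * l)"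
  proof -
    have "\<kappa>e\<^sup>2 = (2 * real e + 1) / (2 * real (L - e) + 1)" by (simp add: \<kappa>e_def kappa_def)
    also have "\<dots> \<le> (4 * r) / R"
      using e e1 eR eL R by (intro frac_le) (auto simp: of_nat_diff R_def)
    also have "\<dots> = 4 / (S * l)" using R by (simp add: r_def)
    finally show "\<kappa>e\<^sup>2 \<le> 4 / (S * l)" .
  qed (simp add: \<kappa>e_def kappa_def)
  have l\<Lambda>: "l * \<Lambda> \<le> h\<^sup>2"
  proof -
    have "l * \<Lambda> \<le> h * h" using logs l2 by (intro mult_mono) auto
    then show ?thesis by (simp add: power2_eq_square)
  qed
  have Sh: "S * h \<le> Y"
    using mult_left_mono[of 1 "sqrt S" "S * h"] S logs by (simp add: Y_def mult_ac)
  have c1: "S * \<kappa>c * sqrt \<Lambda> \<le> 2 * Y"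
  proof -
    have "\<kappa>c * sqrt \<Lambda> \<le> 2 * (sqrt S * h)"
    proof (rule power2_le_imp_le)
      have "(\<kappa>c * sqrt \<Lambda>)\<^sup>2 = \<kappa>c\<^sup>2 * \<Lambda>" using logs by (simp add: power_mult_distrib)
      also have "\<dots> \<le> (3 / 2 * (S * l)) * \<Lambda>" using \<kappa>c logs by (intro mult_right_mono) auto
      also have "\<dots> = 3 / 2 * S * (l * \<Lambda>)" by simp
      also have "\<dots> \<le> 4 * S * h\<^sup>2"
      proof (rule mult_mono[OF _ l\<Lambda>])
        show "0 \<le> l * \<Lambda>" using l2 logs by simp
      qed (use S in auto)
      also have "\<dots> = (2 * (sqrt S * h))\<^sup>2" using S by (simp add: power_mult_distrib)
      finally show "(\<kappa>c * sqrt \<Lambda>)\<^sup>2 \<le> (2 * (sqrt S * h))\<^sup>2" .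
    qed (use S logs in auto)
    from mult_left_mono[OF this, of S] show ?thesis using S by (simp add: Y_def mult_ac)
  qed
  have c2: "sqrt (S * (\<kappa>c\<^sup>2 + 1) * h + S) \<le> 2 * Y"
  proof -
    have "sqrt (S * (\<kappa>c\<^sup>2 + 1) * h + S) \<le> 2 * (S * h)"
    proof (rule real_le_lsqrt)
      have 1: "S \<le> S\<^sup>2 * h\<^sup>2"
      proof -
        have "S * 1 \<le> S * (S * h\<^sup>2)"
          using S logs mult_mono[of 1 S 1 "h\<^sup>2"] by (intro mult_left_mono) auto
        then show ?thesis by (simp add: power2_eq_square mult_ac)
      qed
      have 2: "S * h \<le> S\<^sup>2 * h\<^sup>2"
        using mult_mono[of 1 "S * h" "S * h" "S * h"] S logs mult_mono[of 1 S 1 h] by (simp add: power2_eq_square mult_ac)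
      have "S * \<kappa>c\<^sup>2 * h \<le> S * (3 / 2 * (S * l)) * h" using \<kappa>c S logs by (intro mult_right_mono mult_left_mono) auto
      also have "\<dots> = 3 / 2 * S\<^sup>2 * (l * h)" by (simp add: power2_eq_square)
      also have "\<dots> \<le> 3 / 2 * S\<^sup>2 * (h * h)" using logs l2 by (intro mult_left_mono mult_right_mono) auto
      finally have 3: "S * \<kappa>c\<^sup>2 * h \<le> 3 / 2 * (S\<^sup>2 * h\<^sup>2)" by (simp add: power2_eq_square)
      have "S * (\<kappa>c\<^sup>2 + 1) * h + S = S * \<kappa>c\<^sup>2 * h + S * h + S" by (simp add: algebra_simps)
      also have "\<dots> \<le> 4 * (S\<^sup>2 * h\<^sup>2)" using 1 2 3 S by linarith
      finally show "S * (\<kappa>c\<^sup>2 + 1) * h + S \<le> (2 * (S * h))\<^sup>2" by (simp add: power_mult_distrib)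
    qed (use S logs in auto)
    then show ?thesis using Sh by linarith
  qed
  have mn: "2 * e + K = L" "L - e + e = L" using eL by (auto simp: K_def)
  have center: "center_bound \<sigma> s \<alpha> (L - K) K \<le> \<sigma> * (4 * Y)"
  proof -
    have "center_bound \<sigma> s \<alpha> (L - K) K = \<sigma> * (S * \<kappa>c * sqrt \<Lambda> + sqrt (S * (\<kappa>c\<^sup>2 + 1) * h + S))"
      unfolding center_bound_def K(3) mn(1) S_def[symmetric] \<kappa>c_def[symmetric] \<Lambda>_def[symmetric] R_def[symmetric] h_def[symmetric]
      by (simp add: algebra_simps)
    also have "\<dots> \<le> \<sigma> * (4 * Y)" using c1 c2 \<sigma> by (intro mult_left_mono) auto
    finally show ?thesis .
  qed
  define lm where "lm = ln (real (L - e))"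
  have lm: "0 \<le> lm" "lm \<le> l"
  proof -
    have "1 \<le> real (L - e)" "real (L - e) \<le> R" using eR R eL by (auto simp: R_def of_nat_diff)
    then show "0 \<le> lm" "lm \<le> l" by (auto simp: lm_def l_def)
  qed
  have e1: "S\<^sup>2 * lm * \<kappa>e * sqrt \<Lambda> \<le> 2 * Y"
  proof -
    have "lm * (\<kappa>e * sqrt \<Lambda>) \<le> 2 * (h / sqrt S)"
    proof (rule power2_le_imp_le)
      have "(lm * (\<kappa>e * sqrt \<Lambda>))\<^sup>2 = lm\<^sup>2 * (\<kappa>e\<^sup>2 * \<Lambda>)" using logs by (simp add: power_mult_distrib)
      also have "\<dots> \<le> l\<^sup>2 * (4 / (S * l) * \<Lambda>)" using \<kappa>e lm logs Sl by (intro mult_mono power_mono) auto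
      also have "\<dots> = 4 / S * (l * \<Lambda>)" using l2 by (simp add: power2_eq_square)
      also have "\<dots> \<le> 4 / S * h\<^sup>2" using l\<Lambda> S by (intro mult_left_mono) auto
      also have "\<dots> = (2 * (h / sqrt S))\<^sup>2" using S by (simp add: power_mult_distrib power_divide)
      finally show "(lm * (\<kappa>e * sqrt \<Lambda>))\<^sup>2 \<le> (2 * (h / sqrt S))\<^sup>2" .
    qed (use S logs in auto)
    from mult_left_mono[OF this, of "S\<^sup>2"] have "S\<^sup>2 * lm * \<kappa>e * sqrt \<Lambda> \<le> 2 * (S\<^sup>2 / sqrt S * h)" by (simp add: mult_ac)
    also have "S\<^sup>2 / sqrt S = S * sqrt S" using S by (simp add: divide_simps power2_eq_square)
    finally show ?thesis by (simp add: Y_def)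
  qed
  have e2: "S * (\<kappa>e + 1) * sqrt (lm * h) \<le> 3 * Y"
  proof -
    have "\<kappa>e\<^sup>2 \<le> 2\<^sup>2"
    proof -
      have "4 / (S * l) \<le> 4 / 2" using Sl by (intro divide_left_mono) auto
      then show ?thesis using \<kappa>e by simp
    qed
    then have k2: "\<kappa>e \<le> 2" by (rule power2_le_imp_le) simp
    have "sqrt (lm * h) \<le> sqrt (h * h)" using lm logs by (intro real_sqrt_le_mono mult_right_mono) auto
    then have "sqrt (lm * h) \<le> h" using logs by simp
    then have "(\<kappa>e + 1) * sqrt (lm * h) \<le> 3 * h" using k2 \<kappa>e lm logs by (intro mult_mono) auto
    then have "S * ((\<kappa>e + 1) * sqrt (lm * h)) \<le> S * (3 * h)" using S by (intro mult_left_mono) auto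
    also have "\<dots> \<le> 3 * Y" using Sh by simp
    finally show ?thesis by (simp add: mult.assoc)
  qed
  have "end_bound \<sigma> s \<alpha> ((L + K) div 2) ((L - K) div 2) \<le> \<sigma> * (5 * Y)"
  proof -
    have "end_bound \<sigma> s \<alpha> ((L + K) div 2) ((L - K) div 2) = \<sigma> * (S\<^sup>2 * lm * \<kappa>e * sqrt \<Lambda> + S * (\<kappa>e + 1) * sqrt (lm * h))"
      unfolding end_bound_def K(4,5) mn(2) S_def[symmetric] \<kappa>e_def[symmetric] \<Lambda>_def[symmetric] R_def[symmetric] h_def[symmetric] lm_def[symmetric]
      by (simp add: algebra_simps)
    also have "\<dots> \<le> \<sigma> * (5 * Y)" using e1 e2 \<sigma> by (intro mult_left_mono) auto
    finally show ?thesis .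
  qed
  then have "total_bound A B \<sigma> s \<alpha> L K \<le> A * (\<sigma> * (4 * Y)) + 2 * (B * (\<sigma> * (5 * Y)))"
    unfolding total_bound_def using center AB by (intro add_mono mult_left_mono) auto
  also have "\<dots> = \<sigma> * (4 * A + 10 * B) * Y" by (simp add: algebra_simps)
  finally show ?thesis using K(1,2) unfolding Y_def S_def h_def R_def by blast
qed

text \<open>With \<open>C0 = 0\<close> the filter would vanish and could not reproduce the constant
  sequence, which solves the recurrence for \<open>s = 1\<close> and frequency
  \<open>0\<close>.\<close>

lemma filter_bound_constant_nonzero:
  assumes "filter_bound_constant C0"
  shows "C0 \<noteq> 0"
proof
  assume C0: "C0 = 0"
  obtain c' where c': "\<And>s \<omega> m. s \<ge> 1 \<Longrightarrow> \<omega> \<in> freqs s \<Longrightarrow> real m \<ge> c' \<Longrightarrow> real m \<ge> c' * (real s)\<^sup>2 * ln (real s) \<Longrightarrow>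
      \<exists>\<phi>\<in>seqs_upto m. (\<forall>x\<in>oscillations_at s \<omega>. x = conv \<phi> (lag (int m) x)) \<and>
        seminorm2 m \<phi> \<le> C0 * real s * sqrt (ln (real m) / real m)"
    using assms unfolding filter_bound_constant_def by blast
  obtain m :: nat where m: "c' \<le> real m" using real_arch_simple by blast
  have "(\<lambda>_. 0) \<in> freqs 1" by (simp add: freqs_def)
  from c'[OF _ this m] obtain \<phi> where \<phi>: "\<phi> \<in> seqs_upto m"
    "\<And>x. x \<in> oscillations_at 1 (\<lambda>_. 0) \<Longrightarrow> x = conv \<phi> (lag (int m) x)" "seminorm2 m \<phi> \<le> 0"
    using C0 by auto
  have "(\<Sum>\<tau>\<in>{- int m..int m}. (cmod (\<phi> \<tau>))\<^sup>2) = 0"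
    using \<phi>(3) by (simp add: seminorm2_def sum_nonneg order_antisym)
  then have z: "\<phi> \<tau> = 0" if "\<tau> \<in> {- int m..int m}" for \<tau>
    using that by (subst (asm) sum_nonneg_eq_0_iff) auto
  have "(\<lambda>_. 1) \<in> oscillations_at 1 (\<lambda>_. 0)"
    by (simp add: oscillations_at_eq roots_def)
  from fun_cong[OF \<phi>(2)[OF this], of 0] show False
    unfolding conv_eq_sum[OF \<phi>(1)] using z by simp
qed

theorem proposition4p8:
  fixes C0 A B :: real
  assumes "filter_bound_constant C0"
    and "A > 0" and "B > 0"
  shows "\<exists>c > 0. \<exists>C > 0. \<forall>(s::nat) (L::nat) (K::nat) (\<sigma>::real) (\<alpha>::real) (xh :: seq \<Rightarrow> seq).
    s \<ge> 1 \<and> even L \<and> real L \<ge> c \<and> real L \<ge> c * (real s)\<^sup>2 * ln (real s) \<and>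
    \<sigma> > 0 \<and> 0 < \<alpha> \<and> \<alpha> \<le> 1 / 2 \<and>
    is_arg_min (total_bound A B \<sigma> s \<alpha> L) (\<lambda>K. even K \<and> K \<le> L) K \<and>
    (\<forall>y\<in>seqs_upto L. composite_estimate C0 s L K y (xh y))
    \<longrightarrow> risk \<sigma> L \<alpha> xh (oscillations s) \<le> ereal (C * \<sigma> * real s powr (3 / 2) * ln (real L / \<alpha>))"
proof -
  have C0: "C0\<^sup>2 > 0" using filter_bound_constant_nonzero[OF assms(1)] by simp
  \<comment> \<open>The summand \<open>40\<close> yields \<open>16 s^2 \<le> L\<close>, directly for
    \<open>s = 1\<close> and by \<open>ln s \<ge> 1 / 2\<close> otherwise. The exponential yields
    \<open>C0^2 * ln L \<ge> 80\<close>, hence an end radius of at least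
    \<open>160 s^2\<close>.\<close>
  define c where "c = 40 + exp (80 / C0\<^sup>2)"
  define T where "T = 4 * A + 10 * B"
  \<comment> \<open>The total bound at \<open>K\<close> is at most \<open>\<sigma> * T * Y\<close>.
    Dividing by the factor \<open>A\<close> or \<open>B\<close> of a piece and inserting its radius
    gives the two summands, one for the center and one for the ends.\<close>
  define D where "D = 4 * T / A + 2 * C0\<^sup>2 * T / B"
  define c1 where "c1 = 240 * D\<^sup>2 + 1360 * D + 96"
  \<comment> \<open>Three windows with squared error at most \<open>\<sigma>^2 * c1 * Y^2\<close>
    each. The summand \<open>1\<close> makes the final inequality strict, since the event in
    \<open>risk\<close> is that the error is at least \<open>r\<close>.\<close>
  define C where "C = sqrt (3 * c1) + 1"
  have T: "T > 0" using assms by (simp add: T_def)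
  have D: "0 \<le> D" "4 * T / A \<le> D" "2 * C0\<^sup>2 * T / B \<le> D" using T assms C0 by (auto simp: D_def)
  have c1: "c1 \<ge> 0" using D by (simp add: c1_def)
  have "c > 0" by (simp add: c_def add_pos_pos)
  moreover have "C > 0" using c1 by (simp add: C_def add_nonneg_pos)
  moreover have "risk \<sigma> L \<alpha> xh (oscillations s) \<le> ereal (C * \<sigma> * real s powr (3 / 2) * ln (real L / \<alpha>))"
    if s: "s \<ge> 1" and evL: "even L" and Lc: "real L \<ge> c" "real L \<ge> c * (real s)\<^sup>2 * ln (real s)"
      and \<sigma>: "\<sigma> > 0" and \<alpha>: "0 < \<alpha>" "\<alpha> \<le> 1 / 2"
      and Kmin: "is_arg_min (total_bound A B \<sigma> s \<alpha> L) (\<lambda>K. even K \<and> K \<le> L) K"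
      and est: "\<forall>y\<in>seqs_upto L. composite_estimate C0 s L K y (xh y)"
    for s L K :: nat and \<sigma> \<alpha> :: real and xh :: "seq \<Rightarrow> seq"
  proof -
    define Y where "Y = real s * sqrt (real s) * ln (real L / \<alpha>)"
    have L40: "40 \<le> real L" using Lc(1) exp_ge_zero[of "80 / C0\<^sup>2"] unfolding c_def by linarith
    then have L: "L \<ge> 3" "L \<ge> 16" by auto
    have s2: "16 * (real s)\<^sup>2 \<le> real L"
    proof (cases "s = 1")
      case True then show ?thesis using L40 by simp
    next
      case False
      then have "ln 2 \<le> ln (real s)" using s by (intro ln_mono) auto
      then have "1 / 2 \<le> ln (real s)" using ln2_ge_two_thirds by linarith
      then have "(40 * (real s)\<^sup>2) * (1 / 2) \<le> (c * (real s)\<^sup>2) * ln (real s)"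
        by (intro mult_mono mult_right_mono) (auto simp: c_def)
      moreover have "0 \<le> (real s)\<^sup>2" by simp
      ultimately show ?thesis using Lc(2) by linarith
    qed
    have lnL: "80 / C0\<^sup>2 \<le> ln (real L)"
    proof -
      have "exp (80 / C0\<^sup>2) \<le> real L" using Lc(1) by (simp add: c_def)
      then show ?thesis using L40 by (simp add: ln_ge_iff)
    qed
    have K: "even K" "K \<le> L" using Kmin by (auto simp: is_arg_min_def)
    define m where "m = (L + K) div 2"
    define k where "k = (L - K) div 2"
    have mk: "m + k = L" "int m - int k = int K" "2 * m \<ge> L" using K evL by (auto simp: m_def k_def elim!: evenE)
    have logs: "16 / 25 \<le> ln (1 / \<alpha>)" "1 \<le> ln (real L / \<alpha>)"
      using log_factor_bounds[of L \<alpha> 1] L \<alpha> by auto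
    have Y: "Y > 0" using s logs by (simp add: Y_def)
    have total: "total_bound A B \<sigma> s \<alpha> L K \<le> \<sigma> * T * Y"
    proof -
      obtain K' where K': "K' \<le> L" "even K'" "total_bound A B \<sigma> s \<alpha> L K' \<le> \<sigma> * T * Y"
        using good_center_radius[OF s evL L(2) s2 \<alpha> \<sigma> assms(2,3)] unfolding T_def Y_def by blast
      have "\<not> total_bound A B \<sigma> s \<alpha> L K' < total_bound A B \<sigma> s \<alpha> L K"
        using Kmin K'(1,2) unfolding is_arg_min_def by blast
      then show ?thesis using K'(3) by linarith
    qed
    have m1: "1 \<le> m" using mk L by simp
    have sizes: "1 \<le> (L - K) + K" using L by simp
    note cb = center_bound_nonneg[OF \<sigma> \<alpha> sizes, of s] and eb = end_bound_nonneg[OF \<sigma> \<alpha> m1, of s k]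
    have tb: "total_bound A B \<sigma> s \<alpha> L K = A * center_bound \<sigma> s \<alpha> (L - K) K + 2 * (B * end_bound \<sigma> s \<alpha> m k)"
      by (simp add: total_bound_def m_def k_def)
    have Xc: "4 * real s * kappa (L - K) K * sqrt (ln (1 / \<alpha>)) \<le> D * Y"
    proof -
      have "A * (\<sigma> * real s * kappa (L - K) K * sqrt (ln (1 / \<alpha>))) \<le> A * center_bound \<sigma> s \<alpha> (L - K) K"
        using cb(1) assms by (intro mult_left_mono) auto
      also have "\<dots> \<le> \<sigma> * T * Y"
        using total mult_nonneg_nonneg[OF less_imp_le[OF assms(3)] eb(2)] unfolding tb by linarith
      finally have "(\<sigma> * A) * (real s * kappa (L - K) K * sqrt (ln (1 / \<alpha>))) \<le> (\<sigma> * A) * (T / A * Y)"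
        using assms by (simp add: mult_ac)
      then have "real s * kappa (L - K) K * sqrt (ln (1 / \<alpha>)) \<le> T / A * Y"
        using \<sigma> assms by (subst (asm) mult_le_cancel_left_pos) auto
      then have "4 * real s * kappa (L - K) K * sqrt (ln (1 / \<alpha>)) \<le> 4 * T / A * Y" by simp
      also have "\<dots> \<le> D * Y" using D Y by (intro mult_right_mono) auto
      finally show ?thesis .
    qed
    define \<rho> where "\<rho> = 2 * C0\<^sup>2 * (real s)\<^sup>2 * ln (real L)"
    \<comment> \<open>The end bound contains \<open>ln m\<close>, the radius of the end problem
      \<open>ln L\<close>; they differ by a factor of at most \<open>2\<close> because
      \<open>L \<le> 2 m \<le> m^2\<close>.\<close>
    have lm: "ln (real L) \<le> 2 * ln (real m)"
    proof -
      have "real L \<le> (real m)\<^sup>2"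
      proof -
        have "2 \<le> real m" "real L \<le> 2 * real m" using mk(3) L by auto
        moreover have "2 * real m \<le> real m * real m" using \<open>2 \<le> real m\<close> by (intro mult_right_mono) auto
        ultimately show ?thesis unfolding power2_eq_square by linarith
      qed
      then have "ln (real L) \<le> ln ((real m)\<^sup>2)" using L by (intro ln_mono) auto
      then show ?thesis using m1 ln_realpow[of "real m" 2] by simp
    qed
    have Xe: "\<rho> * kappa m k * sqrt (ln (1 / \<alpha>)) \<le> D * Y"
    proof -
      define q where "q = kappa m k * sqrt (ln (1 / \<alpha>))"
      have q: "q \<ge> 0" using logs by (simp add: q_def kappa_def)
      have "(2 * B) * (\<sigma> * (real s)\<^sup>2 * ln (real m) * kappa m k * sqrt (ln (1 / \<alpha>))) \<le> (2 * B) * end_bound \<sigma> s \<alpha> m k"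
        using eb(1) assms by (intro mult_left_mono) auto
      also have "\<dots> \<le> \<sigma> * T * Y"
        using total mult_nonneg_nonneg[OF less_imp_le[OF assms(2)] cb(2)] unfolding tb by linarith
      finally have "(2 * B * \<sigma>) * ((real s)\<^sup>2 * ln (real m) * q) \<le> (2 * B * \<sigma>) * (T / (2 * B) * Y)"
        using assms by (simp add: mult_ac q_def)
      then have 1: "(real s)\<^sup>2 * ln (real m) * q \<le> T / (2 * B) * Y"
        using \<sigma> assms by (subst (asm) mult_le_cancel_left_pos) auto
      have "\<rho> * q \<le> 2 * C0\<^sup>2 * (real s)\<^sup>2 * (2 * ln (real m)) * q"
        unfolding \<rho>_def using lm q by (intro mult_right_mono mult_left_mono) auto
      also have "\<dots> = 4 * C0\<^sup>2 * ((real s)\<^sup>2 * ln (real m) * q)" by simp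
      also have "\<dots> \<le> 4 * C0\<^sup>2 * (T / (2 * B) * Y)" using 1 by (intro mult_left_mono) auto
      also have "\<dots> = 2 * C0\<^sup>2 * T / B * Y" by simp
      also have "\<dots> \<le> D * Y" using D Y by (intro mult_right_mono) auto
      finally show ?thesis by (simp add: q_def mult.assoc)
    qed
    \<comment> \<open>This is where the squared logarithm-free filter becomes feasible for the end
      problems.\<close>
    have \<rho>160: "160 * (real s)\<^sup>2 \<le> \<rho>"
    proof -
      have "80 \<le> C0\<^sup>2 * ln (real L)" using lnL C0 by (simp add: pos_divide_le_eq mult.commute)
      from mult_right_mono[OF this, of "2 * (real s)\<^sup>2"] show ?thesis by (simp add: \<rho>_def mult_ac)
    qed
    have s1: "1 \<le> (real s)\<^sup>2" using s by simp
    have \<rho>1: "1 \<le> \<rho>" using \<rho>160 s1 by linarith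
    have sm: "4 * s \<le> Suc m"
    proof -
      have "real s * 1 \<le> real s * real s" using s by (intro mult_left_mono) auto
      then have "8 * real s \<le> real L" using s2 by (simp add: power2_eq_square)
      then have "8 * s \<le> L" by (metis of_nat_le_iff of_nat_mult of_nat_numeral)
      then show ?thesis using mk(3) by linarith
    qed
    define r where "r = C * \<sigma> * real s powr (3 / 2) * ln (real L / \<alpha>)"
    have rY: "r = C * \<sigma> * Y" by (simp add: r_def Y_def powr_three_halves)
    \<comment> \<open>The supremum over \<open>x\<close> stands outside the probability, so the
      exceptional set may depend on the frequencies of \<open>x\<close>. Being measurable and
      containing all bad outcomes, it bounds their outer measure.\<close>
    have bad: "outer_measure_of (noise_law L)
          {\<zeta> \<in> space (noise_law L). seminorm2 L (\<lambda>t. xh (observation \<sigma> L x \<zeta>) t - x t) \<ge> r} \<le> ennreal \<alpha>"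
      if x: "x \<in> oscillations s" for x
    proof -
      obtain \<omega> where "x \<in> oscillations_at s \<omega>" using x by (auto simp: oscillations_def)
      define ws where "ws = roots s \<omega>"
      have xk: "seq_killed ws x" using \<open>x \<in> oscillations_at s \<omega>\<close> by (simp add: oscillations_at_eq ws_def)
      have ws: "s = length ws" "\<And>w. w \<in> set ws \<Longrightarrow> cmod w = 1" by (auto simp: ws_def norm_roots)
      let ?ok = "\<lambda>a m n \<rho> U. \<forall>\<zeta>\<in>space (noise_law L) - U. \<forall>\<sigma> x \<phi>. 0 < \<sigma> \<and> seq_killed ws x \<and>
          optimal_filter a m n \<rho> (observation \<sigma> L x \<zeta>) \<phi> \<longrightarrow>
          (\<Sum>t\<in>{a - int n..a + int n}. (cmod (x t - conv \<phi> (lag a (observation \<sigma> L x \<zeta>)) t))\<^sup>2) \<le> \<sigma>\<^sup>2 * (c1 * Y\<^sup>2)"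
      obtain Uc where Uc: "Uc \<in> sets (noise_law L)" "emeasure (noise_law L) Uc \<le> ennreal (\<alpha> / 3)"
        "?ok 0 (L - K) K (4 * real s) Uc"
      proof -
        have "even (L - K)" using evL K by simp
        from center_filter[OF ws(2) this] obtain \<phi>0 where \<phi>0: "\<phi>0 \<in> seqs_upto (L - K)"
          "\<And>x. seq_killed ws x \<Longrightarrow> x = conv \<phi>0 (lag 0 x)"
          "l1_norm (L - K) (dft (L - K) \<phi>0) \<le> 4 * real s / sqrt (2 * real (L - K) + 1)"
          unfolding ws(1) by blast
        have "\<exists>U\<in>sets (noise_law L). emeasure (noise_law L) U \<le> ennreal (\<alpha> / 3) \<and> ?ok 0 (L - K) K (4 * real s) U"
          unfolding c1_def Y_def
          by (rule piece_risk[OF _ _ L(1) ws(1) s ws(2) \<alpha> _ D(1) Xc[unfolded Y_def] \<phi>0]) (use K s in auto)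
        then show ?thesis using that by blast
      qed
      have ends: "\<exists>U\<in>sets (noise_law L). emeasure (noise_law L) U \<le> ennreal (\<alpha> / 3) \<and> ?ok a m k \<rho> U"
        if a: "a = int m \<or> a = - int m" for a
      proof -
        from end_filter[OF ws(2) ws(1) s sm a] obtain \<phi>0 where \<phi>0: "\<phi>0 \<in> seqs_upto m"
          "\<And>x. seq_killed ws x \<Longrightarrow> x = conv \<phi>0 (lag a x)"
          "l1_norm m (dft m \<phi>0) \<le> 160 * (real s)\<^sup>2 / sqrt (2 * real m + 1)"
          by blast
        have "160 * (real s)\<^sup>2 / sqrt (2 * real m + 1) \<le> \<rho> / sqrt (2 * real m + 1)"
          using \<rho>160 by (intro divide_right_mono) auto
        with \<phi>0(3) have \<phi>3: "l1_norm m (dft m \<phi>0) \<le> \<rho> / sqrt (2 * real m + 1)" by linarith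
        show ?thesis unfolding c1_def Y_def
          by (rule piece_risk[OF mk(1) _ L(1) ws(1) s ws(2) \<alpha> \<rho>1 D(1) Xe[unfolded Y_def] \<phi>0(1,2) \<phi>3]) (use a mk in auto)
      qed
      obtain Ur where Ur: "Ur \<in> sets (noise_law L)" "emeasure (noise_law L) Ur \<le> ennreal (\<alpha> / 3)" "?ok (int m) m k \<rho> Ur"
        using ends[of "int m"] by blast
      obtain Ul where Ul: "Ul \<in> sets (noise_law L)" "emeasure (noise_law L) Ul \<le> ennreal (\<alpha> / 3)" "?ok (- int m) m k \<rho> Ul"
        using ends[of "- int m"] by blast
      define U where "U = Uc \<union> Ur \<union> Ul"
      have U: "U \<in> sets (noise_law L)" using Uc(1) Ur(1) Ul(1) by (simp add: U_def)
      have mU: "emeasure (noise_law L) U \<le> ennreal \<alpha>"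
      proof -
        have "emeasure (noise_law L) U \<le> emeasure (noise_law L) Uc + emeasure (noise_law L) Ur + emeasure (noise_law L) Ul"
          unfolding U_def using emeasure_subadditive[OF sets.Un[OF Uc(1) Ur(1)] Ul(1)] emeasure_subadditive[OF Uc(1) Ur(1)]
          by (rule order_trans[OF _ add_right_mono])
        also have "\<dots> \<le> ennreal (\<alpha> / 3) + ennreal (\<alpha> / 3) + ennreal (\<alpha> / 3)"
          by (intro add_mono Uc Ur Ul)
        also have "\<dots> = ennreal \<alpha>" using \<alpha> by (simp add: ennreal_plus[symmetric] del: ennreal_plus)
        finally show ?thesis .
      qed
      have good: "seminorm2 L (\<lambda>t. xh (observation \<sigma> L x \<zeta>) t - x t) < r" if \<zeta>: "\<zeta> \<in> space (noise_law L) - U" for \<zeta>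
      proof -
        define y where "y = observation \<sigma> L x \<zeta>"
        have "y \<in> seqs_upto L" by (auto simp: y_def observation_def seqs_upto_def)
        then have "composite_estimate C0 s L K y (xh y)" using est by blast
        then obtain \<phi> \<phi>r \<phi>l where
          oc: "optimal_filter 0 (L - K) K (4 * real s) y \<phi>" and
          or: "optimal_filter (int m) m k \<rho> y \<phi>r" and
          ol: "optimal_filter (- int m) m k \<rho> y \<phi>l" and
          xc: "\<And>t. t \<in> {- int K..int K} \<Longrightarrow> xh y t = conv \<phi> y t" and
          xr: "\<And>t. t \<in> {int K + 1..int L} \<Longrightarrow> xh y t = conv \<phi>r (lag (int m) y) t" and
          xl: "\<And>t. t \<in> {- int L..- int K - 1} \<Longrightarrow> xh y t = conv \<phi>l (lag (- int m) y) t"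
          unfolding composite_estimate_def Let_def m_def[symmetric] k_def[symmetric] \<rho>_def[symmetric] by blast
        define E where "E = \<sigma>\<^sup>2 * (c1 * Y\<^sup>2)"
        define d where "d = (\<lambda>t. (cmod (xh y t - x t))\<^sup>2)"
        have lag0: "lag 0 y = y" by (simp add: lag_def)
        have sc: "(\<Sum>t\<in>{- int K..int K}. d t) \<le> E"
        proof -
          have "(\<Sum>t\<in>{- int K..int K}. d t) = (\<Sum>t\<in>{0 - int K..0 + int K}. (cmod (x t - conv \<phi> (lag 0 y) t))\<^sup>2)"
            by (intro sum.cong) (auto simp: d_def xc lag0 norm_minus_commute)
          also have "\<dots> \<le> E" unfolding E_def y_def
            by (rule Uc(3)[rule_format]) (use \<zeta> \<sigma> xk oc in \<open>auto simp: U_def y_def\<close>)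
          finally show ?thesis .
        qed
        have sr: "(\<Sum>t\<in>{int K + 1..int L}. d t) \<le> E"
        proof -
          have "(\<Sum>t\<in>{int K + 1..int L}. d t) = (\<Sum>t\<in>{int K + 1..int L}. (cmod (x t - conv \<phi>r (lag (int m) y) t))\<^sup>2)"
            by (intro sum.cong) (auto simp: d_def xr norm_minus_commute)
          \<comment> \<open>As \<open>m - k = K\<close> and \<open>m + k = L\<close>, the window of
            the end problem is \<open>{K..L}\<close>, one point more than the right end
            piece.\<close>
          also have "\<dots> \<le> (\<Sum>t\<in>{int m - int k..int m + int k}. (cmod (x t - conv \<phi>r (lag (int m) y) t))\<^sup>2)"
            using mk by (intro sum_mono2) auto
          also have "\<dots> \<le> E" unfolding E_def y_def
            by (rule Ur(3)[rule_format]) (use \<zeta> \<sigma> xk or in \<open>auto simp: U_def y_def\<close>)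
          finally show ?thesis .
        qed
        have sl: "(\<Sum>t\<in>{- int L..- int K - 1}. d t) \<le> E"
        proof -
          have "(\<Sum>t\<in>{- int L..- int K - 1}. d t) = (\<Sum>t\<in>{- int L..- int K - 1}. (cmod (x t - conv \<phi>l (lag (- int m) y) t))\<^sup>2)"
            by (intro sum.cong) (auto simp: d_def xl norm_minus_commute)
          also have "\<dots> \<le> (\<Sum>t\<in>{- int m - int k..- int m + int k}. (cmod (x t - conv \<phi>l (lag (- int m) y) t))\<^sup>2)"
            using mk by (intro sum_mono2) auto
          also have "\<dots> \<le> E" unfolding E_def y_def
            by (rule Ul(3)[rule_format]) (use \<zeta> \<sigma> xk ol in \<open>auto simp: U_def y_def\<close>)
          finally show ?thesis .
        qed
        have "(\<Sum>t\<in>{- int L..int L}. d t)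
            = (\<Sum>t\<in>{- int L..- int K - 1}. d t) + (\<Sum>t\<in>{- int K..int K}. d t) + (\<Sum>t\<in>{int K + 1..int L}. d t)"
        proof -
          have "{- int L..int L} = ({- int L..- int K - 1} \<union> {- int K..int K}) \<union> {int K + 1..int L}" using K by auto
          moreover have "(\<Sum>t\<in>({- int L..- int K - 1} \<union> {- int K..int K}) \<union> {int K + 1..int L}. d t)
            = (\<Sum>t\<in>{- int L..- int K - 1} \<union> {- int K..int K}. d t) + (\<Sum>t\<in>{int K + 1..int L}. d t)"
            by (rule sum.union_disjoint) auto
          moreover have "(\<Sum>t\<in>{- int L..- int K - 1} \<union> {- int K..int K}. d t)
            = (\<Sum>t\<in>{- int L..- int K - 1}. d t) + (\<Sum>t\<in>{- int K..int K}. d t)"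
            by (rule sum.union_disjoint) auto
          ultimately show ?thesis by simp
        qed
        moreover have "3 * E = (3 * c1) * (\<sigma> * Y)\<^sup>2" by (simp add: E_def power_mult_distrib)
        ultimately have "(\<Sum>t\<in>{- int L..int L}. d t) \<le> (3 * c1) * (\<sigma> * Y)\<^sup>2"
          using sc sr sl by linarith
        then have "seminorm2 L (\<lambda>t. xh y t - x t) \<le> sqrt ((3 * c1) * (\<sigma> * Y)\<^sup>2)"
          unfolding seminorm2_def d_def[symmetric] by (rule real_sqrt_le_mono)
        also have "\<dots> = sqrt (3 * c1) * (\<sigma> * Y)" using \<sigma> Y by (simp add: real_sqrt_mult)
        also have "\<dots> < r" unfolding rY using \<sigma> Y by (simp add: C_def algebra_simps)
        finally show ?thesis by (simp add: y_def)
      qed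
      have "outer_measure_of (noise_law L)
          {\<zeta> \<in> space (noise_law L). seminorm2 L (\<lambda>t. xh (observation \<sigma> L x \<zeta>) t - x t) \<ge> r} \<le> outer_measure_of (noise_law L) U"
        using good by (intro outer_measure_of_mono) (auto simp: not_less[symmetric])
      also have "\<dots> = emeasure (noise_law L) U" using U by simp
      finally show ?thesis using mU by simp
    qed
    have "risk \<sigma> L \<alpha> xh (oscillations s) \<le> ereal r"
      unfolding risk_def
    proof (rule Inf_lower, rule CollectI, rule exI[of _ r], rule conjI[OF refl], rule SUP_least)
      fix x assume "x \<in> oscillations s"
      then show "outer_measure_of (noise_law L)
          {\<zeta> \<in> space (noise_law L). seminorm2 L (\<lambda>t. xh (observation \<sigma> L x \<zeta>) t - x t) \<ge> r} \<le> ennreal \<alpha>"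
        by (rule bad)
    qed
    then show ?thesis by (simp add: r_def)
  qed
  ultimately show ?thesis by blast
qed

end
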